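(* Let $(\pi_t)_{t\ge0}$ be the oriented swap process on the half line. Let $J_t$ be the number of successful swaps between positions $1$ and $2$ during the time interval $[0,t]$ (equivalently, the number of jumps of $s\mapsto\pi_s^{-1}(1)$ on $[0,t]$). Then $$\lim_{t\to\infty}\mathbb{E}\left[\frac{J_t}{\sqrt t}\right]=\frac{2}{\sqrt\pi}.$$ Moreover, let $\mathbb{E}[H_t\mid A_t]$ be the expected height of a swap at position $1$ conditioned on such a swap occurring at time $t$, i.e. $$\mathbb{E}[H_t\mid A_t]:=\lim_{\epsilon\to0+}\mathbb{E}\left[\pi_{t+\epsilon}^{-1}(1)-\pi_t^{-1}(1)\ \middle|\ \pi_t^{-1}(1)<\pi_{t+\epsilon}^{-1}(1)\right].$$ Then $$\lim_{t\to\infty}\frac{\mathbb{E}[H_t\mid A_t]}{\sqrt t}=\sqrt\pi .$$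
   Context: Oriented swap process on the half line: particles labelled by $\mathbb{Z}^+=\{1,2,\dots\}$ occupy the positions $\mathbb{Z}^+$, one per position. At time $0$ particle $i$ is at position $i$ for all $i$. For each $i\ge 1$ there is an independent rate-$1$ Poisson process on $\mathbb{R}^+$ attached to the pair of positions $(i,i+1)$. When it rings, the particles at positions $i$ and $i+1$ exchange positions (a successful swap) if the label of the particle at position $i$ is smaller than the label of the particle at position $i+1$; otherwise nothing happens. The process is well defined almost surely by the Harris graphical construction: for a fixed time $t$, almost surely infinitely many pairs $(i,i+1)$ have no ring up to time $t$, so that the half line splits into finite segments evolving separately. $\pi_t(i)$ denotes the position at time $t$ of the particle with label $i$, and $\pi_t^{-1}(i)$ denotes the label of the particle which is at position $i$ at time $t$. The function $t\mapsto\pi_t^{-1}(1)$ is non-decreasing. $H_t=\pi_{t+}^{-1}(1)-\pi_{t-}^{-1}(1)$ is the height of its jump at time $t$, and $A_t$ is the (probability zero) event that it jumps at time $t$; conditioning on $A_t$ is understood through the limit written in the claim. *)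

theory Defs
  imports "HOL-Probability.Probability"
begin

text \<open>The path properties of a Poisson process are only required almost surely.\<close>

definition poisson_process :: "'a measure \<Rightarrow> real \<Rightarrow> (real \<Rightarrow> 'a \<Rightarrow> nat) \<Rightarrow> bool" where
  "poisson_process M r N \<longleftrightarrow>
     (\<forall>t\<ge>0. N t \<in> measurable M (count_space UNIV)) \<and>
     (AE \<omega> in M. N 0 \<omega> = 0 \<and> mono_on {0..} (\<lambda>t. N t \<omega>) \<and>
        (\<forall>t\<ge>0. continuous (at_right t) (\<lambda>s. N s \<omega>))) \<and>
     (\<forall>s t. 0 \<le> s \<longrightarrow> s < t \<longrightarrow>
        distr M (count_space UNIV) (\<lambda>\<omega>. N t \<omega> - N s \<omega>) = measure_pmf (poisson_pmf (r * (t - s)))) \<and>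
     (\<forall>(\<tau> :: nat \<Rightarrow> real) n. 0 \<le> \<tau> 0 \<longrightarrow> incseq \<tau> \<longrightarrow>
        prob_space.indep_vars M (\<lambda>_. count_space UNIV)
          (\<lambda>k \<omega>. N (\<tau> (Suc k)) \<omega> - N (\<tau> k) \<omega>) {..<n})"

text \<open>Jump times of a non-decreasing right-continuous integer path.\<close>

definition ring_times :: "(real \<Rightarrow> nat) \<Rightarrow> real set" where
  "ring_times n = {t. 0 < t \<and> (\<forall>s\<in>{0..<t}. n s < n t)}"

definition rings :: "(nat \<Rightarrow> real \<Rightarrow> 'a \<Rightarrow> nat) \<Rightarrow> 'a \<Rightarrow> nat \<Rightarrow> real set" where
  "rings N \<omega> i = ring_times (\<lambda>t. N i t \<omega>)"

text \<open>
  A configuration \<open>\<sigma>\<close> maps positions to labels; only positions \<open>\<ge> 1\<close> are meaningful.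
  Below, \<open>R i\<close> is the set of ring times of the pair of positions \<open>(i, i + 1)\<close>, for \<open>i \<ge> 1\<close>.
\<close>

definition swap_step :: "nat \<Rightarrow> (nat \<Rightarrow> nat) \<Rightarrow> (nat \<Rightarrow> nat)" where
  "swap_step i \<sigma> = (if \<sigma> i < \<sigma> (Suc i) then \<sigma>(i := \<sigma> (Suc i), Suc i := \<sigma> i) else \<sigma>)"

text \<open>
  Configuration at time \<open>t\<close> when only the pairs inside the segment \<open>{1..m}\<close> are active: the rings
  are processed in chronological order. Almost surely the rings up to time \<open>t\<close> are finitely many
  and no two pairs ring simultaneously, so that the pair ringing at time \<open>s\<close> is unique.
\<close>

definition osp_segment :: "(nat \<Rightarrow> real set) \<Rightarrow> nat \<Rightarrow> real \<Rightarrow> nat \<Rightarrow> nat" where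
  "osp_segment R m t =
     fold (\<lambda>s. swap_step (THE j. j \<in> {1..<m} \<and> s \<in> R j))
       (sorted_list_of_set {s \<in> {0..t}. \<exists>j\<in>{1..<m}. s \<in> R j}) id"

text \<open>
  \<open>osp_label R t i\<close> is $\pi_t^{-1}(i)$, the label of the particle at position \<open>i\<close> at time \<open>t\<close>
  (Harris construction): if the pair \<open>(m, m + 1)\<close> with \<open>m \<ge> i\<close> has not rung up to time \<open>t\<close>, the
  segment \<open>{1..m}\<close> has evolved on its own. Almost surely such an \<open>m\<close> exists.
\<close>

definition osp_label :: "(nat \<Rightarrow> real set) \<Rightarrow> real \<Rightarrow> nat \<Rightarrow> nat" where
  "osp_label R t i = osp_segment R (LEAST m. i \<le> m \<and> R m \<inter> {0..t} = {}) t i"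

text \<open>
  $J_t$: a ring of the pair \<open>(1, 2)\<close> at time \<open>s\<close> is a successful swap if just before \<open>s\<close> the label
  at position 1 is smaller than the label at position 2.
\<close>

definition osp_swaps :: "(nat \<Rightarrow> real set) \<Rightarrow> real \<Rightarrow> nat" where
  "osp_swaps R t =
     card {s \<in> {0..t}. s \<in> R 1 \<and> (\<forall>\<^sub>F u in at_left s. osp_label R u 1 < osp_label R u 2)}"

definition event_expectation :: "'a measure \<Rightarrow> ('a \<Rightarrow> real) \<Rightarrow> 'a set \<Rightarrow> real" where
  "event_expectation M X B = (LINT \<omega>:B|M. X \<omega>) / measure M B"

text \<open>$E[\pi_{t+\epsilon}^{-1}(1) - \pi_t^{-1}(1) \mid \pi_t^{-1}(1) < \pi_{t+\epsilon}^{-1}(1)]$\<close>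

definition osp_increment_height ::
    "'a measure \<Rightarrow> (nat \<Rightarrow> real \<Rightarrow> 'a \<Rightarrow> nat) \<Rightarrow> real \<Rightarrow> real \<Rightarrow> real" where
  "osp_increment_height M N t \<epsilon> =
     event_expectation M
       (\<lambda>\<omega>. real (osp_label (rings N \<omega>) (t + \<epsilon>) 1) - real (osp_label (rings N \<omega>) t 1))
       {\<omega> \<in> space M. osp_label (rings N \<omega>) t 1 < osp_label (rings N \<omega>) (t + \<epsilon>) 1}"

text \<open>$E[H_t \mid A_t]$; \<open>Lim\<close> is meaningful only if the limit exists.\<close>

definition osp_jump_height :: "'a measure \<Rightarrow> (nat \<Rightarrow> real \<Rightarrow> 'a \<Rightarrow> nat) \<Rightarrow> real \<Rightarrow> real" where
  "osp_jump_height M N t = Lim (at_right 0) (osp_increment_height M N t)"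

text \<open>
  Since the process is defined only up to null sets, its functionals need not be measurable with
  respect to \<open>M\<close> itself. Expectations and probabilities are therefore to be taken with respect to
  \<open>completion M\<close>; for \<open>M\<close>-measurable functions and events this makes no difference.
\<close>

end

theory Submission imports Defs begin

text \<open>
  Let \<open>M\<^sub>a\<close> be the largest label among positions \<open>1, \<dots>, a\<close>. A ring of the pair \<open>(i, i + 1)\<close> moves
  the larger of two labels to position \<open>i\<close>; it therefore replaces \<open>M\<^sub>i\<close> by \<open>M\<^sub>i\<^sub>+\<^sub>1\<close> and leaves every
  other prefix maximum alone (\<open>prefix_max_swap_step\<close>). So \<open>M\<^sub>a\<close> at time \<open>t\<close> is found by a walk
  backwards in time: it starts at \<open>a\<close> and steps from \<open>i\<close> to \<open>i + 1\<close> at each ring of \<open>(i, i + 1)\<close>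
  that it meets; its end point at time \<open>0\<close> is \<open>M\<^sub>a\<close>. Walks that meet stay together. The label at
  position 1 is \<open>M\<^sub>1\<close>, and the labels at positions 1 and 2 are in increasing order exactly if
  \<open>M\<^sub>1 < M\<^sub>2\<close>, that is, if the walks from 1 and 2 have not met.

  One walk makes steps at rate 1, so \<open>M\<^sub>1 - 1\<close> is Poisson distributed with mean \<open>t\<close>
  (\<open>prob_lmax_1\<close>). The distance of two walks is, until it vanishes, a simple random walk with
  jump rate 2, and by the ballot theorem
  $$p(t) = P(M_1 < M_2) = \sum_n e^{-2t} \frac{(2t)^n}{n!} \cdot 2^{-n} {n \choose \lfloor n/2 \rfloor}$$
  (\<open>ascent_prob_sums\<close>). Wallis' product makes the binomial factor asymptotic to
  $\sqrt{2/(\pi n)}$, and since a Poisson variable is concentrated near its mean,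
  $p(t) \sim 1/\sqrt{\pi t}$ (\<open>ascent_prob_asymptotics\<close>).

  Both claims follow from \<open>p\<close>. The label at position 1 changes during \<open>(t, t + h]\<close> with probability
  \<open>h p(t) + O(h\<^sup>2)\<close>, uniformly in \<open>t\<close> (\<open>prob_jump\<close>), while its mean grows by exactly \<open>h\<close>. The mean
  height of a jump at time \<open>t\<close> is therefore \<open>1 / p(t)\<close>, which is asymptotic to $\sqrt{\pi t}$.
  Summing the jump probabilities over finer and finer grids gives $E J_t = \int_0^t p$
  (\<open>expectation_osp_swaps\<close>), and l'Hopital's rule gives $E J_t \sim 2\sqrt{t/\pi}$.

  The Markov property enters only in the form that the rings after time \<open>t\<close> are independent of the
  maxima at time \<open>t\<close>. This reduces to finitely many increments of the clocks,
  because \<open>M\<^sub>a\<close> is almost surely the eventual value of the backward walk along grids of decreasing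
  mesh (\<open>eventually_walk_eq_label_max\<close>). From it one gets \<open>E F(M\<^sub>a, M\<^sub>b)\<close> at time \<open>t + h\<close> up to
  \<open>O(h\<^sup>2)\<close>, hence a linear system of differential equations. Its solutions are read off from
  Taylor's formula at time \<open>0\<close>, where the derivatives are numbers of lattice paths.
\<close>

section \<open>Prefix maxima under oriented swaps\<close>

definition prefix_max :: "(nat \<Rightarrow> nat) \<Rightarrow> nat \<Rightarrow> nat" where
  "prefix_max \<sigma> a = Max (\<sigma> ` {1..a})"

lemma prefix_max_1 [simp]: "prefix_max \<sigma> (Suc 0) = \<sigma> 1"
  by (simp add: prefix_max_def)

lemma prefix_max_Suc: "1 \<le> a \<Longrightarrow> prefix_max \<sigma> (Suc a) = max (prefix_max \<sigma> a) (\<sigma> (Suc a))"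
  by (simp add: prefix_max_def atLeastAtMostSuc_conv max.commute)

lemma prefix_max_id: "1 \<le> a \<Longrightarrow> prefix_max id a = a"
  by (induction a rule: nat_induct_at_least) (simp_all add: prefix_max_Suc)

lemma prefix_max_cong: "(\<And>i. 1 \<le> i \<Longrightarrow> i \<le> a \<Longrightarrow> \<sigma> i = \<rho> i) \<Longrightarrow> prefix_max \<sigma> a = prefix_max \<rho> a"
  unfolding prefix_max_def by (rule arg_cong[where f=Max]) (auto intro!: image_cong)

text \<open>
  The larger of the labels at \<open>i\<close> and \<open>i + 1\<close> ends up at \<open>i\<close>, so that the prefix of length \<open>i\<close> now
  contains the largest label of the prefix of length \<open>i + 1\<close>. A shorter prefix is untouched, and a
  longer one keeps its set of labels.
\<close>

lemma prefix_max_swap_step: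
  assumes "1 \<le> i" "1 \<le> a"
  shows "prefix_max (swap_step i \<sigma>) a = prefix_max \<sigma> (if a = i then Suc a else a)"
proof -
  have below: "prefix_max (swap_step i \<sigma>) b = prefix_max \<sigma> b" if "b < i" for b
    using that by (intro prefix_max_cong) (auto simp: swap_step_def)
  have at: "prefix_max (swap_step i \<sigma>) i = prefix_max \<sigma> (Suc i)"
  proof (cases "i = 1")
    case True
    then show ?thesis by (simp add: prefix_max_Suc swap_step_def)
  next
    case False
    then obtain b where b: "i = Suc b" "1 \<le> b" using assms by (cases i) auto
    then show ?thesis using below[of b] by (auto simp: prefix_max_Suc swap_step_def)
  qed
  have above: "prefix_max (swap_step i \<sigma>) b = prefix_max \<sigma> b" if "Suc i \<le> b" for b
    using that
  proof (induction b rule: nat_induct_at_least)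
    case base
    then show ?case using assms at by (auto simp: prefix_max_Suc swap_step_def)
  next
    case (Suc b)
    then show ?case using assms by (auto simp: prefix_max_Suc swap_step_def)
  qed
  show ?thesis using below at above by (cases a i rule: linorder_cases) auto
qed

lemma prefix_max_fold_absent:
  assumes "1 \<le> a" "\<And>j. j \<in> set js \<Longrightarrow> 1 \<le> j" "a \<notin> set js"
  shows "prefix_max (fold swap_step js \<sigma>) a = prefix_max \<sigma> a"
  using assms by (induction js arbitrary: \<sigma>) (auto simp: prefix_max_swap_step)

text \<open>
  The last occurrence of \<open>a\<close> pulls \<open>M\<^sub>a\<^sub>+\<^sub>1\<close> down to \<open>M\<^sub>a\<close>, overwriting what happened to \<open>M\<^sub>a\<close> before;
  \<open>M\<^sub>a\<^sub>+\<^sub>1\<close> itself still has its initial value because \<open>a + 1\<close> does not occur earlier.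
\<close>

lemma prefix_max_fold_once:
  assumes "1 \<le> a" "\<And>j. j \<in> set (us @ a # vs) \<Longrightarrow> 1 \<le> j" "a \<notin> set vs" "Suc a \<notin> set us"
  shows "prefix_max (fold swap_step (us @ a # vs) \<sigma>) a = prefix_max \<sigma> (Suc a)"
  using assms by (simp add: prefix_max_fold_absent prefix_max_swap_step)

lemma prefix_max_fold_mono:
  assumes "1 \<le> a" "\<And>j. j \<in> set js \<Longrightarrow> 1 \<le> j"
  shows "prefix_max \<sigma> a \<le> prefix_max (fold swap_step js \<sigma>) a"
  using assms
proof (induction js arbitrary: \<sigma>)
  case (Cons j js)
  have "prefix_max \<sigma> a \<le> prefix_max (swap_step j \<sigma>) a"
    using Cons.prems by (simp add: prefix_max_swap_step prefix_max_Suc)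
  also have "\<dots> \<le> prefix_max (fold swap_step (j # js) \<sigma>) a"
    using Cons.IH[of "swap_step j \<sigma>"] Cons.prems by simp
  finally show ?case .
qed simp

section \<open>The Harris construction\<close>

definition label_max :: "(nat \<Rightarrow> real set) \<Rightarrow> real \<Rightarrow> nat \<Rightarrow> nat" where
  "label_max R t a = prefix_max (osp_label R t) a"

text \<open>The properties that almost every realisation of the rings has.\<close>

locale harris =
  fixes R :: "nat \<Rightarrow> real set"
  assumes rings_pos: "1 \<le> i \<Longrightarrow> r \<in> R i \<Longrightarrow> 0 < r"
    and finite_rings: "1 \<le> i \<Longrightarrow> finite (R i \<inter> {0..t})"
    and rings_disjoint: "1 \<le> i \<Longrightarrow> 1 \<le> j \<Longrightarrow> i \<noteq> j \<Longrightarrow> R i \<inter> R j = {}"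
    and silent_pair: "\<exists>m\<ge>i. R m \<inter> {0..t} = {}"
begin

definition ringing_pair :: "nat \<Rightarrow> real \<Rightarrow> nat" where
  "ringing_pair m s = (THE j. j \<in> {1..<m} \<and> s \<in> R j)"

definition ring_list :: "nat \<Rightarrow> real set \<Rightarrow> nat list" where
  "ring_list m I = map (ringing_pair m) (sorted_list_of_set {s \<in> I. \<exists>j\<in>{1..<m}. s \<in> R j})"

lemma osp_segment_eq: "osp_segment R m t = fold swap_step (ring_list m {0..t}) id"
  unfolding osp_segment_def ring_list_def ringing_pair_def fold_map comp_def ..

text \<open>
  No two pairs ring simultaneously, so the definite description in the definition of the segment
  dynamics denotes the pair that rings.
\<close>

lemma ringing_pair_eq: "1 \<le> j \<Longrightarrow> j < m \<Longrightarrow> s \<in> R j \<Longrightarrow> ringing_pair m s = j"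
  unfolding ringing_pair_def using rings_disjoint by (intro the_equality) (simp, fastforce)

lemma finite_segment_rings: "I \<subseteq> {0..t} \<Longrightarrow> finite {s \<in> I. \<exists>j\<in>{1..<m}. s \<in> R j}"
  by (rule finite_subset[of _ "\<Union>j\<in>{1..<m}. R j \<inter> {0..t}"])
    (blast, intro finite_UN_I, simp, rule finite_rings, simp)

lemma set_ring_list:
  assumes "I \<subseteq> {0..t}"
  shows "set (ring_list m I) = {j \<in> {1..<m}. R j \<inter> I \<noteq> {}}"
proof -
  have "set (ring_list m I) = ringing_pair m ` {s \<in> I. \<exists>j\<in>{1..<m}. s \<in> R j}"
    using finite_segment_rings[OF assms] by (simp add: ring_list_def)
  also have "\<dots> = {j \<in> {1..<m}. R j \<inter> I \<noteq> {}}"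
  proof (intro equalityI subsetI)
    fix j assume "j \<in> ringing_pair m ` {s \<in> I. \<exists>j\<in>{1..<m}. s \<in> R j}"
    then obtain s i where "s \<in> I" "i \<in> {1..<m}" "s \<in> R i" "j = ringing_pair m s" by blast
    then show "j \<in> {j \<in> {1..<m}. R j \<inter> I \<noteq> {}}" using ringing_pair_eq[of i m s] by auto
  next
    fix j assume "j \<in> {j \<in> {1..<m}. R j \<inter> I \<noteq> {}}"
    then obtain s where s: "1 \<le> j" "j < m" "s \<in> R j" "s \<in> I" by auto
    then have "j = ringing_pair m s" by (simp add: ringing_pair_eq)
    then show "j \<in> ringing_pair m ` {s \<in> I. \<exists>j\<in>{1..<m}. s \<in> R j}" using s by fastforce
  qed
  finally show ?thesis .
qed

lemma ring_list_append:
  assumes "I \<union> J \<subseteq> {0..t}" "\<And>x y. x \<in> I \<Longrightarrow> y \<in> J \<Longrightarrow> x < y"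
  shows "ring_list m (I \<union> J) = ring_list m I @ ring_list m J"
proof -
  let ?P = "\<lambda>s. \<exists>j\<in>{1..<m}. s \<in> R j"
  have fin: "finite {s \<in> I. ?P s}" "finite {s \<in> J. ?P s}"
    by (rule finite_segment_rings[of _ t], use assms(1) in blast)+
  have "sorted_list_of_set {s \<in> I \<union> J. ?P s} = sorted_list_of_set {s \<in> I. ?P s} @ sorted_list_of_set {s \<in> J. ?P s}"
  proof (rule sorted_distinct_set_unique)
    show "sorted (sorted_list_of_set {s \<in> I. ?P s} @ sorted_list_of_set {s \<in> J. ?P s})"
      unfolding sorted_append using fin assms(2) by (simp add: less_imp_le)
    show "distinct (sorted_list_of_set {s \<in> I. ?P s} @ sorted_list_of_set {s \<in> J. ?P s})"
      unfolding distinct_append using fin assms(2) by fastforce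
    show "set (sorted_list_of_set {s \<in> I \<union> J. ?P s}) =
        set (sorted_list_of_set {s \<in> I. ?P s} @ sorted_list_of_set {s \<in> J. ?P s})"
      using fin finite_segment_rings[OF assms(1), of m] by (simp del: One_nat_def) blast
  qed simp_all
  then show ?thesis by (simp add: ring_list_def)
qed

lemma osp_segment_later:
  assumes "0 \<le> s" "s \<le> t"
  shows "osp_segment R m t = fold swap_step (ring_list m {s<..t}) (osp_segment R m s)"
proof -
  have "{0..s} \<union> {s<..t} = {0..t}" using assms by auto
  moreover have "ring_list m ({0..s} \<union> {s<..t}) = ring_list m {0..s} @ ring_list m {s<..t}"
    by (rule ring_list_append[of _ _ t]) (use assms in auto)
  ultimately show ?thesis by (simp add: osp_segment_eq)
qed

lemma swap_step_agree:
  assumes "\<And>i. 1 \<le> i \<Longrightarrow> i \<le> m \<Longrightarrow> \<sigma> i = \<rho> i" "j < m \<or> m < j" "1 \<le> i" "i \<le> m" "1 \<le> j"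
  shows "swap_step j \<sigma> i = (if j < m then swap_step j \<rho> i else \<rho> i)"
  using assms by (auto simp: swap_step_def)

text \<open>Without a swap across \<open>(m, m + 1)\<close> the segment \<open>{1..m}\<close> evolves on its own.\<close>

lemma fold_swap_step_filter:
  assumes "\<And>i. 1 \<le> i \<Longrightarrow> i \<le> m \<Longrightarrow> \<sigma> i = \<rho> i" "m \<notin> set js" "\<And>j. j \<in> set js \<Longrightarrow> 1 \<le> j" "1 \<le> i" "i \<le> m"
  shows "fold swap_step js \<sigma> i = fold swap_step (filter (\<lambda>j. j < m) js) \<rho> i"
  using assms
proof (induction js arbitrary: \<sigma> \<rho>)
  case (Cons j js)
  have "swap_step j \<sigma> i = (if j < m then swap_step j \<rho> else \<rho>) i" if "1 \<le> i" "i \<le> m" for i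
    using swap_step_agree[of m \<sigma> \<rho> j i] Cons.prems that by auto
  then have "fold swap_step js (swap_step j \<sigma>) i =
      fold swap_step (filter (\<lambda>j. j < m) js) (if j < m then swap_step j \<rho> else \<rho>) i"
    using Cons.prems by (intro Cons.IH) auto
  then show ?case by simp
qed simp

lemma ring_list_filter:
  assumes "I \<subseteq> {0..t}" "m \<le> m'"
  shows "filter (\<lambda>j. j < m) (ring_list m' I) = ring_list m I"
proof -
  let ?P = "\<lambda>m s. \<exists>j\<in>{1..<m}. s \<in> R j"
  let ?S = "\<lambda>m. {s \<in> I. ?P m s}"
  have fin: "finite (?S m)" for m using assms(1) by (rule finite_segment_rings)
  have lt: "ringing_pair m' s < m \<longleftrightarrow> ?P m s" if ring: "?P m' s" for s
  proof -
    obtain j where j: "1 \<le> j" "j < m'" "s \<in> R j" using ring by auto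
    have unique: "i = j" if "1 \<le> i" "s \<in> R i" for i
      using rings_disjoint[of i j] that j by (metis disjoint_iff)
    have "ringing_pair m' s = j" using j by (rule ringing_pair_eq)
    moreover have "?P m s \<longleftrightarrow> j < m"
    proof
      assume "?P m s"
      then obtain i where "i \<in> {1..<m}" "s \<in> R i" by blast
      then show "j < m" using unique[of i] by simp
    next
      assume "j < m"
      then show "?P m s" using j by (intro bexI[of _ j]) simp_all
    qed
    ultimately show ?thesis by simp
  qed
  have "filter (\<lambda>j. j < m) (ring_list m' I) =
      map (ringing_pair m') (filter (\<lambda>s. ringing_pair m' s < m) (sorted_list_of_set (?S m')))"
    by (simp add: ring_list_def filter_map comp_def)
  also have "filter (\<lambda>s. ringing_pair m' s < m) (sorted_list_of_set (?S m')) = sorted_list_of_set (?S m)"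
  proof (rule sorted_distinct_set_unique)
    have "?S m = {s \<in> ?S m'. ringing_pair m' s < m}"
    proof -
      have "?P m' s" if "?P m s" for s using that assms(2) by fastforce
      then show ?thesis using lt by blast
    qed
    then show "set (filter (\<lambda>s. ringing_pair m' s < m) (sorted_list_of_set (?S m'))) =
        set (sorted_list_of_set (?S m))"
      using fin[of m] fin[of m'] by auto
  qed (auto simp: sorted_wrt_filter)
  also have "map (ringing_pair m') (sorted_list_of_set (?S m)) = ring_list m I"
    unfolding ring_list_def using fin[of m] assms(2)
    by (intro map_cong) (auto simp: ringing_pair_eq)
  finally show ?thesis .
qed

lemma osp_segment_consistent:
  assumes "1 \<le> i" "i \<le> m" "m \<le> m'" "R m \<inter> {0..t} = {}"
  shows "osp_segment R m' t i = osp_segment R m t i"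
proof -
  have "osp_segment R m' t i = fold swap_step (filter (\<lambda>j. j < m) (ring_list m' {0..t})) id i"
    unfolding osp_segment_eq using assms
    by (intro fold_swap_step_filter) (auto simp: set_ring_list[of _ t])
  also have "filter (\<lambda>j. j < m) (ring_list m' {0..t}) = ring_list m {0..t}"
    using assms by (intro ring_list_filter) auto
  finally show ?thesis unfolding osp_segment_eq .
qed

text \<open>
  The labels at different positions are defined through different silent pairs; by consistency one
  silent pair serves for all positions to its left.
\<close>

lemma osp_label_eq_segment:
  assumes "1 \<le> i" "i \<le> m" "R m \<inter> {0..t} = {}"
  shows "osp_label R t i = osp_segment R m t i"
proof -
  let ?Q = "\<lambda>m. i \<le> m \<and> R m \<inter> {0..t} = {}"
  have "?Q (LEAST m. ?Q m)" using assms by (intro LeastI[of ?Q m]) auto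
  moreover have "(LEAST m. ?Q m) \<le> m" using assms by (intro Least_le) auto
  ultimately show ?thesis
    using osp_segment_consistent[of i "LEAST m. ?Q m" m t] assms by (simp add: osp_label_def)
qed

lemma label_max_eq_segment:
  assumes "a \<le> m" "R m \<inter> {0..t} = {}"
  shows "label_max R t a = prefix_max (osp_segment R m t) a"
  unfolding label_max_def using assms by (intro prefix_max_cong osp_label_eq_segment) auto

text \<open>
  A single silent pair, chosen for the later time, describes the configurations at both times as
  states of one finite list of swaps.
\<close>

lemma label_max_later:
  assumes "0 \<le> s" "s \<le> t" "1 \<le> a"
  obtains m where "a < m" "R m \<inter> {0..t} = {}"
    "\<forall>b\<le>m. label_max R s b = prefix_max (osp_segment R m s) b"
    "label_max R t a = prefix_max (fold swap_step (ring_list m {s<..t}) (osp_segment R m s)) a"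
    "set (ring_list m {s<..t}) = {j \<in> {1..<m}. R j \<inter> {s<..t} \<noteq> {}}"
proof -
  obtain m where m: "m \<ge> Suc a" "R m \<inter> {0..t} = {}" using silent_pair by blast
  have "{0..s} \<subseteq> {0..t}" using assms by simp
  then have silent: "R m \<inter> {0..s} = {}" using m(2) by blast
  have seg: "label_max R s b = prefix_max (osp_segment R m s) b" if "b \<le> m" for b
    by (rule label_max_eq_segment[OF that silent])
  have "label_max R t a = prefix_max (fold swap_step (ring_list m {s<..t}) (osp_segment R m s)) a"
    using m assms label_max_eq_segment[of a m t] osp_segment_later[of s t m] by simp
  moreover have "set (ring_list m {s<..t}) = {j \<in> {1..<m}. R j \<inter> {s<..t} \<noteq> {}}"
    using assms by (intro set_ring_list[of _ t]) auto
  ultimately show thesis using m seg by (intro that[of m]) simp_all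
qed

lemma label_max_0: "1 \<le> a \<Longrightarrow> label_max R 0 a = a"
proof -
  assume a: "1 \<le> a"
  obtain m where m: "m \<ge> a" "R m \<inter> {0..0} = {}" using silent_pair by blast
  have "R j \<inter> {0..0} = {}" if "1 \<le> j" for j using rings_pos[OF that, of 0] by auto
  then have "set (ring_list m {0..0}) = {}"
    using set_ring_list[of "{0..0}" 0 m] by simp
  then have "osp_segment R m 0 = id" by (simp add: osp_segment_eq)
  then show ?thesis using a m label_max_eq_segment[of a m 0] prefix_max_id[of a] by simp
qed

lemma label_max_mono:
  assumes "0 \<le> s" "s \<le> t" "1 \<le> a"
  shows "label_max R s a \<le> label_max R t a"
proof -
  obtain m where m: "a < m" "R m \<inter> {0..t} = {}"
    "\<forall>b\<le>m. label_max R s b = prefix_max (osp_segment R m s) b"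
    "label_max R t a = prefix_max (fold swap_step (ring_list m {s<..t}) (osp_segment R m s)) a"
    "set (ring_list m {s<..t}) = {j \<in> {1..<m}. R j \<inter> {s<..t} \<noteq> {}}"
    by (rule label_max_later[OF assms])
  have "prefix_max (osp_segment R m s) a \<le>
      prefix_max (fold swap_step (ring_list m {s<..t}) (osp_segment R m s)) a"
    by (rule prefix_max_fold_mono) (use assms m(5) in auto)
  then show ?thesis using m(1) by (simp add: m(3,4))
qed

lemma label_max_ge: "0 \<le> t \<Longrightarrow> 1 \<le> a \<Longrightarrow> a \<le> label_max R t a"
  using label_max_mono[of 0 t a] by (simp add: label_max_0)

lemma label_max_silent:
  assumes "0 \<le> s" "s \<le> t" "1 \<le> a" "R a \<inter> {s<..t} = {}"
  shows "label_max R t a = label_max R s a"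
proof -
  obtain m where m: "a < m" "R m \<inter> {0..t} = {}"
    "\<forall>b\<le>m. label_max R s b = prefix_max (osp_segment R m s) b"
    "label_max R t a = prefix_max (fold swap_step (ring_list m {s<..t}) (osp_segment R m s)) a"
    "set (ring_list m {s<..t}) = {j \<in> {1..<m}. R j \<inter> {s<..t} \<noteq> {}}"
    by (rule label_max_later[OF assms(1-3)])
  have "prefix_max (fold swap_step (ring_list m {s<..t}) (osp_segment R m s)) a =
      prefix_max (osp_segment R m s) a"
    by (rule prefix_max_fold_absent) (use assms m(5) in auto)
  then show ?thesis using m(1) by (simp add: m(3,4))
qed

text \<open>
  Up to the ring \<open>M\<^sub>a\<^sub>+\<^sub>1\<close> keeps its value, the ring hands this value to \<open>M\<^sub>a\<close>, and afterwards \<open>M\<^sub>a\<close>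
  keeps it.
\<close>

lemma label_max_one_ring:
  assumes "0 \<le> s" "s \<le> t" "1 \<le> a" "R a \<inter> {s<..t} = {r}" "R (Suc a) \<inter> {s<..t} = {}"
  shows "label_max R t a = label_max R s (Suc a)"
proof -
  have r: "s < r" "r \<le> t" "r \<in> R a" using assms(4) by auto
  have "label_max R t a = label_max R r a"
    using assms r by (intro label_max_silent) auto
  moreover have "label_max R r a = label_max R s (Suc a)"
  proof -
    obtain m where m: "a < m" "R m \<inter> {0..r} = {}"
      "\<forall>b\<le>m. label_max R s b = prefix_max (osp_segment R m s) b"
      "label_max R r a = prefix_max (fold swap_step (ring_list m {s<..r}) (osp_segment R m s)) a"
      "set (ring_list m {s<..r}) = {j \<in> {1..<m}. R j \<inter> {s<..r} \<noteq> {}}"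
      by (rule label_max_later[OF assms(1) less_imp_le[OF r(1)] assms(3)])
    have "ring_list m ({s<..<r} \<union> {r}) = ring_list m {s<..<r} @ ring_list m {r}"
      by (rule ring_list_append[of _ _ r]) (use assms(1) r in auto)
    moreover have "{s<..<r} \<union> {r} = {s<..r}" using r by auto
    moreover have "ring_list m {r} = [a]"
    proof -
      have "{s \<in> {r}. \<exists>j\<in>{1..<m}. s \<in> R j} = {r}" using r m(1) assms(3) by force
      then show ?thesis using ringing_pair_eq[of a m r] r m assms(3) by (simp add: ring_list_def)
    qed
    ultimately have split: "ring_list m {s<..r} = ring_list m {s<..<r} @ a # []" by simp
    have set: "set (ring_list m {s<..<r}) = {j \<in> {1..<m}. R j \<inter> {s<..<r} \<noteq> {}}"
      using assms by (intro set_ring_list[of _ r]) auto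
    have "R (Suc a) \<inter> {s<..<r} = {}" using assms(5) r by auto
    then have "Suc a \<notin> set (ring_list m {s<..<r})" using set by blast
    then have "prefix_max (fold swap_step (ring_list m {s<..<r} @ a # []) (osp_segment R m s)) a =
        prefix_max (osp_segment R m s) (Suc a)"
      by (intro prefix_max_fold_once) (use assms(3) set in auto)
    then show ?thesis using m(1) by (simp add: m(3,4) split)
  qed
  ultimately show ?thesis by simp
qed

end

section \<open>The backward walk on a time grid\<close>

definition grid :: "real \<Rightarrow> nat \<Rightarrow> nat \<Rightarrow> real" where
  "grid t n k = t * real k / real n"

definition slot :: "real \<Rightarrow> nat \<Rightarrow> nat \<Rightarrow> real set" where
  "slot t n k = {grid t n k<..grid t n (Suc k)}"

text \<open>
  \<open>c i k\<close> is the number of rings of the pair \<open>(i, i + 1)\<close> in slot \<open>k\<close>. The walk starts at \<open>a\<close> after the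
  last slot and goes back in time, making at most one step per slot.
\<close>

fun walk :: "(nat \<Rightarrow> nat \<Rightarrow> nat) \<Rightarrow> nat \<Rightarrow> nat \<Rightarrow> nat" where
  "walk c 0 a = a"
| "walk c (Suc k) a = walk c k (if c a k = 0 then a else Suc a)"

lemma grid_0 [simp]: "grid t n 0 = 0"
  by (simp add: grid_def)

lemma grid_end: "0 < n \<Longrightarrow> grid t n n = t"
  by (simp add: grid_def)

lemma grid_Suc: "grid t n (Suc k) = grid t n k + t / n"
  by (simp add: grid_def algebra_simps add_divide_distrib)

lemma grid_mono: "0 \<le> t \<Longrightarrow> k \<le> l \<Longrightarrow> grid t n k \<le> grid t n l"
  unfolding grid_def by (intro divide_right_mono mult_left_mono) auto

lemma grid_nonneg: "0 \<le> t \<Longrightarrow> 0 \<le> grid t n k"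
  by (simp add: grid_def)

lemma grid_le: "0 \<le> t \<Longrightarrow> k \<le> n \<Longrightarrow> 0 < n \<Longrightarrow> grid t n k \<le> t"
  using grid_mono[of t k n n] by (simp add: grid_end)

lemma slot_disjoint:
  assumes "0 \<le> t" "r \<in> slot t n k" "r \<in> slot t n l"
  shows "k = l"
proof (rule ccontr)
  assume "k \<noteq> l"
  then have "Suc k \<le> l \<or> Suc l \<le> k" by arith
  then have "grid t n (Suc k) \<le> grid t n l \<or> grid t n (Suc l) \<le> grid t n k"
    using grid_mono[OF assms(1)] by blast
  then show False using assms by (auto simp: slot_def)
qed

lemma in_some_slot:
  assumes "0 < r" "r \<le> t" "0 < n"
  shows "\<exists>k<n. r \<in> slot t n k"
proof -
  have "\<exists>k<l. r \<in> slot t n k" if "r \<le> grid t n l" for l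
    using that
  proof (induction l)
    case (Suc l)
    then show ?case
      by (cases "r \<le> grid t n l") (auto simp: slot_def less_Suc_eq)
  qed (use assms in simp)
  then show ?thesis using assms by (simp add: grid_end)
qed

lemma eventually_slots_separate:
  assumes "finite S"
  shows "\<forall>\<^sub>F n in sequentially. \<forall>k. \<forall>x\<in>S. \<forall>y\<in>S. x \<in> slot t n k \<longrightarrow> y \<in> slot t n k \<longrightarrow> x = y"
proof -
  have "\<forall>\<^sub>F n in sequentially. \<forall>k. x \<in> slot t n k \<longrightarrow> y \<in> slot t n k \<longrightarrow> x = y" for x y
  proof (cases "x = y")
    case False
    have "(\<lambda>n. t / real n) \<longlonglongrightarrow> 0" by (rule lim_const_over_n)
    then have "\<forall>\<^sub>F n in sequentially. t / real n < \<bar>x - y\<bar>"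
      using False by (intro order_tendstoD) auto
    then show ?thesis
      by eventually_elim (auto simp: slot_def grid_Suc)
  qed simp
  then have "\<forall>\<^sub>F n in sequentially. \<forall>x\<in>S. \<forall>y\<in>S. \<forall>k. x \<in> slot t n k \<longrightarrow> y \<in> slot t n k \<longrightarrow> x = y"
    using assms by (intro eventually_ball_finite ballI)
  then show ?thesis by eventually_elim blast
qed

context harris
begin

lemma label_max_slot:
  assumes "0 \<le> t" "1 \<le> a" "R (Suc a) \<inter> slot t n k = {} \<or> R a \<inter> slot t n k = {}"
    and "\<And>x y. x \<in> R a \<inter> slot t n k \<Longrightarrow> y \<in> R a \<inter> slot t n k \<Longrightarrow> x = y"
  shows "label_max R (grid t n (Suc k)) a =
    label_max R (grid t n k) (if R a \<inter> slot t n k = {} then a else Suc a)"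
proof (cases "R a \<inter> slot t n k = {}")
  case True
  then show ?thesis
    using assms(1,2) label_max_silent[of "grid t n k" "grid t n (Suc k)" a]
    by (simp add: grid_nonneg grid_mono slot_def)
next
  case False
  then obtain r where "r \<in> R a \<inter> slot t n k" by blast
  then have "R a \<inter> slot t n k = {r}" using assms(4) by blast
  then show ?thesis
    using assms(1-3) False label_max_one_ring[of "grid t n k" "grid t n (Suc k)" a r]
    by (simp add: grid_nonneg grid_mono slot_def)
qed

text \<open>
  Only the finitely many rings to the left of some silent pair matter. Once the mesh is so small that
  each slot contains at most one of them, every slot acts on \<open>M\<close> as one step of the walk.
\<close>

lemma eventually_walk_eq_label_max:
  assumes "0 \<le> t" "1 \<le> a"
  shows "\<forall>\<^sub>F n in sequentially. \<forall>c.
    (\<forall>i\<ge>1. \<forall>k<n. c i k = 0 \<longleftrightarrow> R i \<inter> slot t n k = {}) \<longrightarrow> walk c n a = label_max R t a"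
proof -
  \<comment> \<open>The walk from \<open>a \<le> m\<close> cannot pass the silent pair at \<open>m\<close>.\<close>
  obtain m where m: "a \<le> m" "R m \<inter> {0..t} = {}" using silent_pair by blast
  define S where "S = (\<Union>j\<in>{1..<m}. R j \<inter> {0..t})"
  have "finite S" unfolding S_def by (intro finite_UN_I finite_rings) auto
  from eventually_slots_separate[OF this, of t] eventually_gt_at_top[of 0]
  show ?thesis
  proof eventually_elim
    case (elim n)
    show ?case
    proof (intro allI impI)
      fix c :: "nat \<Rightarrow> nat \<Rightarrow> nat"
      assume c: "\<forall>i\<ge>1. \<forall>k<n. c i k = 0 \<longleftrightarrow> R i \<inter> slot t n k = {}"
      have "walk c k b = label_max R (grid t n k) b" if "k \<le> n" "1 \<le> b" "b \<le> m" for k b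
        using that
      proof (induction k arbitrary: b)
        case 0
        then show ?case by (simp add: label_max_0)
      next
        case (Suc k)
        have sub: "slot t n k \<subseteq> {0..t}"
          using grid_nonneg[OF assms(1), of n k] grid_le[OF assms(1), of "Suc k" n] Suc.prems
          by (auto simp: slot_def)
        have ring_m: "R m \<inter> slot t n k = {}" using m(2) sub by blast
        have same: "x = y" if "x \<in> R i \<inter> slot t n k" "y \<in> R j \<inter> slot t n k" "1 \<le> i" "i \<le> m" "1 \<le> j" "j \<le> m" for i j x y
        proof -
          have "i \<noteq> m" "j \<noteq> m" using ring_m that by auto
          then have "x \<in> S" "y \<in> S" using that sub by (auto simp: S_def)
          then show ?thesis using elim(1) that by blast
        qed
        have alone: "R (Suc b) \<inter> slot t n k = {} \<or> R b \<inter> slot t n k = {}"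
        proof (cases "b = m")
          case True
          then show ?thesis using ring_m by simp
        next
          case False
          then have "Suc b \<le> m" using Suc.prems by simp
          then show ?thesis
            using same[of _ "Suc b" _ b] rings_disjoint[of "Suc b" b] Suc.prems by fastforce
        qed
        have "label_max R (grid t n (Suc k)) b =
            label_max R (grid t n k) (if R b \<inter> slot t n k = {} then b else Suc b)"
          using Suc.prems alone same[of _ b _ b] by (intro label_max_slot assms(1)) auto
        also have "(if R b \<inter> slot t n k = {} then b else Suc b) = (if c b k = 0 then b else Suc b)"
          using c Suc.prems by auto
        also have "label_max R (grid t n k) (if c b k = 0 then b else Suc b) =
            walk c k (if c b k = 0 then b else Suc b)"
        proof -
          have "c b k = 0" if "b = m" using c ring_m that Suc.prems by auto
          then show ?thesis using Suc.prems by (intro Suc.IH[symmetric]) (auto simp: le_less)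
        qed
        finally show ?case by simp
      qed
      from this[of n a] show "walk c n a = label_max R t a"
        using assms m elim by (simp add: grid_end)
    qed
  qed
qed

text \<open>
  Before its only ring of \<open>(1, 2)\<close> the interval leaves both \<open>M\<^sub>1\<close> and \<open>M\<^sub>2\<close> constant, and the ring
  replaces \<open>M\<^sub>1\<close> by \<open>M\<^sub>2\<close>. The swap succeeds exactly if \<open>M\<^sub>1 < M\<^sub>2\<close>, that is, if \<open>M\<^sub>1\<close> grows.
\<close>

lemma successful_ring_iff_jump:
  assumes "0 \<le> s" "r \<in> R 1 \<inter> {s<..t}" "R 1 \<inter> {s<..t} = {r}" "R 2 \<inter> {s<..t} = {}"
  shows "(\<forall>\<^sub>F u in at_left r. osp_label R u 1 < osp_label R u 2) \<longleftrightarrow> label_max R s 1 < label_max R t 1"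
proof -
  have lt: "osp_label R u 1 < osp_label R u 2 \<longleftrightarrow> label_max R u 1 < label_max R u 2" for u
    by (auto simp: label_max_def prefix_max_Suc numeral_2_eq_2)
  have const: "label_max R u 1 = label_max R s 1" "label_max R u 2 = label_max R s 2" if "s < u" "u < r" for u
  proof -
    have "{s<..u} \<subseteq> {s<..t} - {r}" using that assms(2) by auto
    moreover have "R 1 \<inter> ({s<..t} - {r}) = {}" "R 2 \<inter> ({s<..t} - {r}) = {}"
      using assms(3,4) by auto
    ultimately have "R 1 \<inter> {s<..u} = {}" "R 2 \<inter> {s<..u} = {}" by (meson disjoint_iff subsetD)+
    then show "label_max R u 1 = label_max R s 1" "label_max R u 2 = label_max R s 2"
      using that assms(1) by (auto intro!: label_max_silent)
  qed
  have "\<forall>\<^sub>F u in at_left r. s < u \<and> u < r"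
    using assms eventually_at_left_real[of s r] by (auto elim: eventually_mono)
  then have "\<forall>\<^sub>F u in at_left r. label_max R u 1 < label_max R u 2 \<longleftrightarrow> label_max R s 1 < label_max R s 2"
    by (rule eventually_mono) (use const in simp)
  then have "(\<forall>\<^sub>F u in at_left r. label_max R u 1 < label_max R u 2) \<longleftrightarrow>
      (\<forall>\<^sub>F u in at_left r. label_max R s 1 < label_max R s 2)"
    by (rule eventually_subst)
  also have "\<dots> \<longleftrightarrow> label_max R s 1 < label_max R s 2"
    by simp
  also have "label_max R s 2 = label_max R t 1"
    using label_max_one_ring[of s t 1 r] assms by (simp add: numeral_2_eq_2)
  finally show ?thesis by (simp only: lt)
qed

text \<open>
  On a grid that separates the rings of \<open>(1, 2)\<close> and \<open>(2, 3)\<close>, the successful rings correspond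
  one-to-one to the slots in which the label at position 1 changes.
\<close>

lemma eventually_card_jumps_eq_osp_swaps:
  assumes "0 \<le> t"
  shows "\<forall>\<^sub>F n in sequentially.
    card {k. k < n \<and> label_max R (grid t n k) 1 < label_max R (grid t n (Suc k)) 1} = osp_swaps R t"
proof -
  let ?S = "(R 1 \<inter> {0..t}) \<union> (R 2 \<inter> {0..t})"
  let ?ok = "\<lambda>r. \<forall>\<^sub>F u in at_left r. osp_label R u 1 < osp_label R u 2"
  have "finite ?S" using finite_rings by simp
  from eventually_slots_separate[OF this, of t] eventually_gt_at_top[of 0]
  show ?thesis
  proof eventually_elim
    case (elim n)
    let ?jump = "\<lambda>k. label_max R (grid t n k) 1 < label_max R (grid t n (Suc k)) 1"
    have slot_sub: "slot t n k \<subseteq> {0..t}" if "k < n" for k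
      using grid_nonneg[OF assms, of n k] grid_le[OF assms, of "Suc k" n] that elim(2)
      by (auto simp: slot_def)
    have jump_iff: "?jump k \<longleftrightarrow> ?ok r" if "k < n" "r \<in> R 1 \<inter> slot t n k" for k r
    proof -
      have *: "y = r" if "y \<in> (R 1 \<union> R 2) \<inter> slot t n k" for y
        using elim(1) \<open>r \<in> R 1 \<inter> slot t n k\<close> that slot_sub[OF \<open>k < n\<close>] by blast
      have "R 1 \<inter> R 2 = {}" by (rule rings_disjoint) auto
      then have "R 1 \<inter> slot t n k = {r}" "R 2 \<inter> slot t n k = {}" using * that by blast+
      then show ?thesis
        using successful_ring_iff_jump[of "grid t n k" r "grid t n (Suc k)"] that
        by (simp add: slot_def grid_nonneg assms)
    qed
    have ring: "\<exists>r. r \<in> R 1 \<inter> slot t n k" if "?jump k" for k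
      using label_max_silent[of "grid t n k" "grid t n (Suc k)" 1] that
      by (force simp: slot_def grid_nonneg grid_mono assms)
    define g where "g k = (SOME r. r \<in> R 1 \<inter> slot t n k)" for k
    have g: "g k \<in> R 1 \<inter> slot t n k" if "?jump k" for k
      unfolding g_def using ring[OF that] by (rule someI_ex)
    have "bij_betw g {k. k < n \<and> ?jump k} {s \<in> {0..t}. s \<in> R 1 \<and> ?ok s}"
    proof (rule bij_betwI')
      fix k l assume "k \<in> {k. k < n \<and> ?jump k}" "l \<in> {k. k < n \<and> ?jump k}"
      then show "g k = g l \<longleftrightarrow> k = l" using g[of k] g[of l] slot_disjoint[OF assms] by auto
    next
      fix k assume "k \<in> {k. k < n \<and> ?jump k}"
      then show "g k \<in> {s \<in> {0..t}. s \<in> R 1 \<and> ?ok s}"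
        using g[of k] jump_iff[of k "g k"] slot_sub[of k] by auto
    next
      fix s assume s: "s \<in> {s \<in> {0..t}. s \<in> R 1 \<and> ?ok s}"
      then obtain k where k: "k < n" "s \<in> slot t n k"
        using in_some_slot[of s t n] rings_pos[of 1 s] elim(2) by auto
      then have "?jump k" using jump_iff[of k s] s by auto
      then have "g k \<in> ?S" "s \<in> ?S" "g k \<in> slot t n k"
        using g[of k] s k slot_sub[of k] by auto
      then have "s = g k" using elim(1) k by blast
      then show "\<exists>k\<in>{k. k < n \<and> ?jump k}. s = g k" using k \<open>?jump k\<close> by blast
    qed
    then show ?case unfolding osp_swaps_def by (rule bij_betw_same_card)
  qed
qed

text \<open>
  Each change raises the integer label at position 1. This bound makes dominated convergence
  available for the number of jumps.
\<close>

lemma card_jumps_le: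
  assumes "0 \<le> t" "k \<le> n"
  shows "card {j. j < k \<and> label_max R (grid t n j) 1 < label_max R (grid t n (Suc j)) 1} + 1
    \<le> label_max R (grid t n k) 1"
  using assms(2)
proof (induction k)
  case 0
  then show ?case by (simp add: label_max_0)
next
  case (Suc k)
  let ?jump = "\<lambda>k. label_max R (grid t n k) 1 < label_max R (grid t n (Suc k)) 1"
  have eq: "{j. j < Suc k \<and> ?jump j} = {j. j < k \<and> ?jump j} \<union> (if ?jump k then {k} else {})"
    by (auto simp: less_Suc_eq)
  have "label_max R (grid t n k) 1 \<le> label_max R (grid t n (Suc k)) 1"
    using assms(1) by (intro label_max_mono) (auto simp: grid_nonneg grid_mono)
  then show ?case unfolding eq using Suc by auto
qed

end

section \<open>Counting paths, independence and completion\<close>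

definition counting_path :: "(real \<Rightarrow> nat) \<Rightarrow> bool" where
  "counting_path n \<longleftrightarrow> n 0 = 0 \<and> mono_on {0..} n \<and> (\<forall>t\<ge>0. continuous (at_right t) n)"

lemma counting_path_mono: "counting_path n \<Longrightarrow> 0 \<le> s \<Longrightarrow> s \<le> t \<Longrightarrow> n s \<le> n t"
  unfolding counting_path_def by (auto elim: mono_onD)

text \<open>
  The infimum of the times at which the path exceeds \<open>n s\<close> is attained by right continuity, and it is
  a ring time.
\<close>

lemma first_ring_after:
  assumes n: "counting_path n" and s: "0 \<le> s" "s \<le> t" and inc: "n s < n t"
  obtains r where "r \<in> ring_times n" "s < r" "r \<le> t"
proof -
  define A where "A = {u. s \<le> u \<and> n s < n u}"
  \<comment> \<open>The candidate for the ring time; right continuity puts it into \<open>A\<close>.\<close>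
  define r where "r = Inf A"
  have A: "t \<in> A" "\<And>u. u \<in> A \<Longrightarrow> s \<le> u" "bdd_below A"
    using s inc by (auto simp: A_def)
  have r: "s \<le> r" "r \<le> t"
    unfolding r_def using A by (auto intro: cInf_greatest cInf_lower)
  have "(n \<longlongrightarrow> n r) (at_right r)"
    using n r s by (auto simp: counting_path_def continuous_within)
  then have "\<forall>\<^sub>F u in at_right r. n u = n r"
    by (simp add: tendsto_discrete)
  then obtain d where d: "r < d" "\<And>u. r < u \<Longrightarrow> u < d \<Longrightarrow> n u = n r"
    by (auto simp: eventually_at_right_field)
  obtain u where u: "u \<in> A" "u < d"
    using cInf_lessD[of A d] A(1) d(1) by (auto simp: r_def)
  have "r \<le> u" unfolding r_def using u A by (auto intro: cInf_lower)
  then have "n u = n r" using d(2)[of u] u by (cases "u = r") auto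
  then have nr: "n s < n r" using u by (simp add: A_def)
  have "n u < n r" if "0 \<le> u" "u < r" for u
  proof (cases "s \<le> u")
    case True
    have "u \<notin> A" using that A(3) cInf_lower[of u A] by (auto simp: r_def)
    then show ?thesis using True nr by (simp add: A_def)
  next
    case False
    then show ?thesis using counting_path_mono[OF n, of u s] that nr by simp
  qed
  moreover have "s < r" using nr r by (cases "s = r") auto
  ultimately show thesis using that[of r] r s by (auto simp: ring_times_def)
qed

lemma ring_times_less: "r \<in> ring_times n \<Longrightarrow> 0 \<le> s \<Longrightarrow> s < r \<Longrightarrow> n s < n r"
  by (simp add: ring_times_def)

lemma ring_times_pos: "r \<in> ring_times n \<Longrightarrow> 0 < r"
  by (simp add: ring_times_def)

lemma no_ring_iff:
  assumes "counting_path n" "0 \<le> s" "s \<le> t"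
  shows "ring_times n \<inter> {s<..t} = {} \<longleftrightarrow> n t - n s = 0"
proof
  assume none: "ring_times n \<inter> {s<..t} = {}"
  have "\<not> n s < n t"
  proof
    assume "n s < n t"
    then obtain r where "r \<in> ring_times n" "s < r" "r \<le> t"
      by (rule first_ring_after[OF assms])
    then have "r \<in> ring_times n \<inter> {s<..t}" by simp
    then show False using none by blast
  qed
  then show "n t - n s = 0" by simp
next
  assume eq: "n t - n s = 0"
  have False if "r \<in> ring_times n" "s < r" "r \<le> t" for r
  proof -
    have "n s < n r" using that assms by (intro ring_times_less)
    also have "n r \<le> n t" using that assms by (intro counting_path_mono) auto
    finally show False using eq by simp
  qed
  then show "ring_times n \<inter> {s<..t} = {}" by auto
qed

lemma single_ring:
  assumes "counting_path n" "0 \<le> s" "s \<le> t" "n t - n s = 1"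
  obtains r where "ring_times n \<inter> {s<..t} = {r}"
proof -
  have "ring_times n \<inter> {s<..t} \<noteq> {}" using no_ring_iff[OF assms(1-3)] assms(4) by simp
  then obtain r where r: "r \<in> ring_times n" "s < r" "r \<le> t" by auto
  have no_two: False if "x \<in> ring_times n" "y \<in> ring_times n" "s < x" "x < y" "y \<le> t" for x y
  proof -
    have "n s < n x" "n x < n y" "n y \<le> n t"
      using that assms by (auto intro: ring_times_less counting_path_mono)
    then show False using assms(4) by simp
  qed
  have only: "x = r" if "x \<in> ring_times n \<inter> {s<..t}" for x
  proof (cases x r rule: linorder_cases)
    case less
    then show ?thesis using no_two[of x r] that r by simp
  next
    case greater
    then show ?thesis using no_two[of r x] that r by simp
  qed
  have "ring_times n \<inter> {s<..t} = {r}"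
  proof (intro equalityI subsetI)
    show "x \<in> {r}" if "x \<in> ring_times n \<inter> {s<..t}" for x using only[OF that] by simp
  qed (use r in simp)
  then show thesis by (rule that)
qed

lemma finite_ring_times:
  assumes "counting_path n"
  shows "finite (ring_times n \<inter> {0..t})"
proof (rule inj_on_finite)
  show "inj_on n (ring_times n \<inter> {0..t})"
  proof (rule linorder_inj_onI)
    fix x y assume "x < y" "x \<in> ring_times n \<inter> {0..t}" "y \<in> ring_times n \<inter> {0..t}"
    then show "n x \<noteq> n y" using ring_times_less[of y n x] by auto
  qed auto
  show "n ` (ring_times n \<inter> {0..t}) \<subseteq> {..n t}"
    using counting_path_mono[OF assms] by auto
qed simp

text \<open>
  Functionals of the swap process are almost sure limits of functions of finitely many increments;
  in a complete space this is enough for measurability.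
\<close>

lemma (in complete_measure) measurable_AE_eventually_eq:
  assumes X: "\<And>n::nat. X n \<in> measurable M L" and f: "\<And>\<omega>. \<omega> \<in> space M \<Longrightarrow> f \<omega> \<in> space L"
    and ae: "AE \<omega> in M. \<forall>\<^sub>F n in sequentially. X n \<omega> = f \<omega>"
  shows "f \<in> measurable M L"
proof (rule measurableI)
  fix A assume A: "A \<in> sets L"
  define B where "B = {\<omega> \<in> space M. \<forall>\<^sub>F n in sequentially. X n \<omega> \<in> A}"
  have [measurable]: "X n \<in> measurable M L" "A \<in> sets L" for n by fact+
  have "B \<in> sets M" unfolding B_def eventually_sequentially by measurable
  moreover have "AE \<omega> in M. \<omega> \<in> B \<longleftrightarrow> \<omega> \<in> f -` A \<inter> space M"
    using ae AE_space
  proof eventually_elim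
    case (elim \<omega>)
    have "(\<forall>\<^sub>F n in sequentially. X n \<omega> \<in> A) \<longleftrightarrow> (\<forall>\<^sub>F n::nat in sequentially. f \<omega> \<in> A)"
      by (rule eventually_subst) (use elim(1) in eventually_elim, simp)
    then show ?case using elim(2) by (simp add: B_def)
  qed
  ultimately show "f -` A \<inter> space M \<in> sets M" using in_sets_AE by blast
qed (use f in simp)

lemma measurable_Pair_count_space:
  fixes f :: "'a \<Rightarrow> 'b::countable" and g :: "'a \<Rightarrow> 'c::countable"
  assumes "f \<in> measurable M (count_space UNIV)" "g \<in> measurable M (count_space UNIV)"
  shows "(\<lambda>x. (f x, g x)) \<in> measurable M (count_space UNIV)"
  using measurable_Pair[OF assms] pair_measure_countable[of "UNIV :: 'b set" "UNIV :: 'c set"] by simp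

text \<open>
  Independent rows, each of which consists of independent entries, form an independent array.
  Row \<open>i\<close> is \<open>Y i\<close>, and its entries are the functions \<open>f k\<close> of it.
\<close>

lemma (in prob_space) indep_vars_Times:
  assumes rows: "\<And>i. i \<in> I \<Longrightarrow> indep_vars (\<lambda>_. S) (X i) K"
    and indep: "indep_vars P Y I"
    and f: "\<And>i k. i \<in> I \<Longrightarrow> k \<in> K \<Longrightarrow> f k \<in> measurable (P i) S"
    and X: "\<And>i k \<omega>. i \<in> I \<Longrightarrow> k \<in> K \<Longrightarrow> X i k \<omega> = f k (Y i \<omega>)"
  shows "indep_vars (\<lambda>_. S) (\<lambda>(i, k). X i k) (I \<times> K)"
  unfolding indep_vars_def2
proof (intro conjI ballI)
  have rv: "random_variable S (X i k)" if "i \<in> I" "k \<in> K" for i k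
    using rows[OF that(1)] that(2) by (simp add: indep_vars_def2)
  then show "random_variable S (case j of (i, k) \<Rightarrow> X i k)" if "j \<in> I \<times> K" for j
    using that by auto
  show "indep_sets (\<lambda>j. {(case j of (i, k) \<Rightarrow> X i k) -` A \<inter> space M |A. A \<in> sets S}) (I \<times> K)"
  proof (rule indep_setsI)
    fix j assume "j \<in> I \<times> K"
    then show "{(case j of (i, k) \<Rightarrow> X i k) -` A \<inter> space M |A. A \<in> sets S} \<subseteq> events"
      using rv by (auto intro: measurable_sets)
  next
    fix A J assume J: "J \<noteq> {}" "J \<subseteq> I \<times> K" "finite J"
      and "\<forall>j\<in>J. A j \<in> {(case j of (i, k) \<Rightarrow> X i k) -` A \<inter> space M |A. A \<in> sets S}"
    then have "\<forall>j\<in>J. \<exists>B. A j = X (fst j) (snd j) -` B \<inter> space M \<and> B \<in> sets S"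
      by (auto simp: case_prod_beta)
    then obtain B where B: "\<And>j. j \<in> J \<Longrightarrow> A j = X (fst j) (snd j) -` B j \<inter> space M \<and> B j \<in> sets S"
      by metis
    define I' where "I' = fst ` J"
    define K' where "K' i = {k. (i, k) \<in> J}" for i
    \<comment> \<open>A finite set of entries meets finitely many rows, each in a finite set of columns.\<close>
    have J_eq: "J = Sigma I' K'" by (force simp: I'_def K'_def)
    have I': "finite I'" "I' \<noteq> {}" "I' \<subseteq> I" using J by (auto simp: I'_def)
    have K'_fin: "finite (K' i)" for i
      by (rule finite_subset[OF _ finite_imageI[OF J(3), of snd]]) (force simp: K'_def)
    have K'_sub: "i \<in> I" "k \<in> K" "B (i, k) \<in> sets S" if "k \<in> K' i" for i k
      using that J(2) B[of "(i, k)"] by (auto simp: K'_def)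
    have K'_ne: "K' i \<noteq> {}" if "i \<in> I'" for i
      using that by (auto simp: K'_def I'_def)
    \<comment> \<open>All conditions on row \<open>i\<close>, as one event of that row.\<close>
    define E where "E i = {y \<in> space (P i). \<forall>k\<in>K' i. f k y \<in> B (i, k)}" for i
    have E: "E i \<in> sets (P i)" if "i \<in> I'" for i
    proof -
      have "E i = (\<Inter>k\<in>K' i. f k -` B (i, k) \<inter> space (P i))"
        using K'_ne[OF that] by (auto simp: E_def)
      also have "\<dots> \<in> sets (P i)"
        by (intro sets.finite_INT K'_fin K'_ne that measurable_sets[OF f] K'_sub)
      finally show ?thesis .
    qed
    have Yi: "Y i -` E i \<inter> space M = (\<Inter>k\<in>K' i. X i k -` B (i, k) \<inter> space M)" if i: "i \<in> I'" for i
    proof -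
      have "Y i \<in> measurable M (P i)" using indep I'(3) i by (auto simp: indep_vars_def2)
      then have Yi: "Y i \<omega> \<in> space (P i)" if "\<omega> \<in> space M" for \<omega> using that by (rule measurable_space)
      have XY: "X i k \<omega> = f k (Y i \<omega>)" if "k \<in> K' i" for k \<omega>
        using that K'_sub by (intro X) auto
      show ?thesis
      proof (intro equalityI subsetI)
        fix \<omega> assume "\<omega> \<in> Y i -` E i \<inter> space M"
        then show "\<omega> \<in> (\<Inter>k\<in>K' i. X i k -` B (i, k) \<inter> space M)" by (simp add: E_def XY)
      next
        fix \<omega> assume "\<omega> \<in> (\<Inter>k\<in>K' i. X i k -` B (i, k) \<inter> space M)"
        then have "\<omega> \<in> space M" "\<forall>k\<in>K' i. X i k \<omega> \<in> B (i, k)" using K'_ne[OF i] by auto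
        then show "\<omega> \<in> Y i -` E i \<inter> space M" using Yi by (simp add: E_def XY)
      qed
    qed
    have "prob (\<Inter>j\<in>J. A j) = prob (\<Inter>i\<in>I'. Y i -` E i \<inter> space M)"
    proof -
      have "(\<Inter>j\<in>J. A j) = (\<Inter>i\<in>I'. \<Inter>k\<in>K' i. A (i, k))"
        unfolding J_eq by auto
      also have "\<dots> = (\<Inter>i\<in>I'. \<Inter>k\<in>K' i. X i k -` B (i, k) \<inter> space M)"
        using B by (intro INF_cong refl) (simp add: K'_def)
      finally show ?thesis using Yi by simp
    qed
    also have "\<dots> = (\<Prod>i\<in>I'. prob (Y i -` E i \<inter> space M))"
      by (intro indep_varsD[OF indep] I' E)
    also have "\<dots> = (\<Prod>i\<in>I'. \<Prod>k\<in>K' i. prob (X i k -` B (i, k) \<inter> space M))"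
    proof (rule prod.cong[OF refl])
      fix i assume i: "i \<in> I'"
      have "prob (\<Inter>k\<in>K' i. X i k -` B (i, k) \<inter> space M) = (\<Prod>k\<in>K' i. prob (X i k -` B (i, k) \<inter> space M))"
      proof (rule indep_varsD[OF rows])
        show "i \<in> I" using i I' by blast
        show "K' i \<subseteq> K" using K'_sub by blast
      qed (use K'_ne[OF i] K'_fin K'_sub in auto)
      then show "prob (Y i -` E i \<inter> space M) = (\<Prod>k\<in>K' i. prob (X i k -` B (i, k) \<inter> space M))"
        using Yi[OF i] by simp
    qed
    also have "\<dots> = (\<Prod>i\<in>I'. \<Prod>k\<in>K' i. prob (A (i, k)))"
      using B by (intro prod.cong refl) (simp add: K'_def)
    also have "\<dots> = (\<Prod>(i, k)\<in>Sigma I' K'. prob (A (i, k)))"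
      using I' K'_fin by (intro prod.Sigma) auto
    also have "\<dots> = (\<Prod>j\<in>J. prob (A j))"
      by (simp add: J_eq case_prod_beta)
    finally show "prob (\<Inter>j\<in>J. A j) = (\<Prod>j\<in>J. prob (A j))" .
  qed
qed

lemma prob_space_completion:
  assumes "prob_space M"
  shows "prob_space (completion M)"
  using prob_space.emeasure_space_1[OF assms] by (intro prob_spaceI) simp

lemma indep_vars_completion:
  assumes M: "prob_space M" and X: "prob_space.indep_vars M S X I"
  shows "prob_space.indep_vars (completion M) S X I"
proof -
  interpret M: prob_space M by fact
  interpret C: prob_space "completion M" by (rule prob_space_completion[OF M])
  have rv: "X i \<in> measurable M (S i)" if "i \<in> I" for i
    using X that by (simp add: M.indep_vars_def2)
  have indep: "M.indep_sets (\<lambda>i. {X i -` A \<inter> space M |A. A \<in> sets (S i)}) I"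
    using X by (simp add: M.indep_vars_def2)
  have events: "{X i -` A \<inter> space M |A. A \<in> sets (S i)} \<subseteq> sets M" if "i \<in> I" for i
    using measurable_sets[OF rv[OF that]] by auto
  show ?thesis
    unfolding C.indep_vars_def2 space_completion
  proof (intro conjI ballI C.indep_setsI)
    show "X i \<in> measurable (completion M) (S i)" if "i \<in> I" for i
      using rv[OF that] by (rule measurable_completion)
    show "{X i -` A \<inter> space M |A. A \<in> sets (S i)} \<subseteq> sets (completion M)" if "i \<in> I" for i
      using events[OF that] by (meson sets_completionI_sets subset_iff)
    fix A J assume J: "J \<noteq> {}" "J \<subseteq> I" "finite J"
      and A: "\<forall>j\<in>J. A j \<in> {X j -` A \<inter> space M |A. A \<in> sets (S j)}"
    have sets: "A j \<in> sets M" if "j \<in> J" for j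
      using bspec[OF A that] events[of j] J(2) that by (meson subsetD)
    moreover have "(\<Inter>j\<in>J. A j) \<in> sets M" using J sets by (intro sets.finite_INT)
    ultimately show "measure (completion M) (\<Inter>j\<in>J. A j) = (\<Prod>j\<in>J. measure (completion M) (A j))"
      using M.indep_setsD[OF indep J(2,1,3) A] by simp
  qed
qed

lemma
  assumes "poisson_process M r N"
  shows poisson_process_measurable: "0 \<le> t \<Longrightarrow> N t \<in> measurable M (count_space UNIV)"
    and poisson_process_paths: "AE \<omega> in M. counting_path (\<lambda>t. N t \<omega>)"
    and poisson_process_distr: "0 \<le> s \<Longrightarrow> s < t \<Longrightarrow>
      distr M (count_space UNIV) (\<lambda>\<omega>. N t \<omega> - N s \<omega>) = measure_pmf (poisson_pmf (r * (t - s)))"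
    and poisson_process_indep: "0 \<le> \<tau> 0 \<Longrightarrow> incseq \<tau> \<Longrightarrow>
      prob_space.indep_vars M (\<lambda>_. count_space UNIV) (\<lambda>k \<omega>. N (\<tau> (Suc k)) \<omega> - N (\<tau> k) \<omega>) {..<n}"
proof -
  note def = assms[unfolded poisson_process_def]
  show "N t \<in> measurable M (count_space UNIV)" if "0 \<le> t"
    using def[THEN conjunct1, rule_format, OF that] .
  show "AE \<omega> in M. counting_path (\<lambda>t. N t \<omega>)"
    using def[THEN conjunct2, THEN conjunct1] unfolding counting_path_def .
  show "distr M (count_space UNIV) (\<lambda>\<omega>. N t \<omega> - N s \<omega>) = measure_pmf (poisson_pmf (r * (t - s)))"
    if "0 \<le> s" "s < t"
    using def[THEN conjunct2, THEN conjunct2, THEN conjunct1, rule_format, OF that] .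
  show "prob_space.indep_vars M (\<lambda>_. count_space UNIV) (\<lambda>k \<omega>. N (\<tau> (Suc k)) \<omega> - N (\<tau> k) \<omega>) {..<n}"
    if "0 \<le> \<tau> 0" "incseq \<tau>"
    using def[THEN conjunct2, THEN conjunct2, THEN conjunct2, rule_format, OF that] .
qed

lemma poisson_process_completion:
  assumes M: "prob_space M" and N: "poisson_process M r N"
  shows "poisson_process (completion M) r N"
  unfolding poisson_process_def
proof (intro conjI[of "\<forall>t\<ge>0. _ t"] conjI[of "eventually _ _"] conjI[of "\<forall>s t. _ s t"] allI impI)
  show "N t \<in> measurable (completion M) (count_space UNIV)" if "0 \<le> t" for t
    using poisson_process_measurable[OF N that] by (rule measurable_completion)
  show "AE \<omega> in completion M. N 0 \<omega> = 0 \<and> mono_on {0..} (\<lambda>t. N t \<omega>) \<and>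
      (\<forall>t\<ge>0. continuous (at_right t) (\<lambda>s. N s \<omega>))"
    using AE_completion[OF poisson_process_paths[OF N]] unfolding counting_path_def .
  show "distr (completion M) (count_space UNIV) (\<lambda>\<omega>. N t \<omega> - N s \<omega>) =
      measure_pmf (poisson_pmf (r * (t - s)))" if "0 \<le> s" "s < t" for s t
  proof -
    have [measurable]: "N s \<in> measurable M (count_space UNIV)" "N t \<in> measurable M (count_space UNIV)"
      using that by (auto intro: poisson_process_measurable[OF N])
    have "(\<lambda>\<omega>. N t \<omega> - N s \<omega>) \<in> measurable M (count_space UNIV)" by measurable
    then show ?thesis using poisson_process_distr[OF N that] by (simp only: distr_completion)
  qed
  show "prob_space.indep_vars (completion M) (\<lambda>_. count_space UNIV)
      (\<lambda>k \<omega>. N (\<tau> (Suc k)) \<omega> - N (\<tau> k) \<omega>) {..<n}" if "0 \<le> \<tau> 0" "incseq \<tau>" for \<tau> n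
    by (intro indep_vars_completion[OF M] poisson_process_indep[OF N] that)
qed

section \<open>A family of independent Poisson clocks\<close>

text \<open>The probability that a unit rate clock rings during a period of length \<open>x\<close> is at most \<open>x\<close>.\<close>

lemma one_minus_exp_le: "1 - exp (- x) \<le> (x::real)"
  using exp_ge_add_one_self[of "- x"] by simp

lemma path_increment_measurable:
  fixes s t :: real
  assumes "0 \<le> s" "0 \<le> t"
  shows "(\<lambda>y. y t - y s) \<in> measurable (Pi\<^sub>M {0..} (\<lambda>_. count_space UNIV)) (count_space (UNIV :: nat set))"
proof -
  have "(\<lambda>y. y u) \<in> measurable (Pi\<^sub>M {0..} (\<lambda>_. count_space UNIV)) (count_space (UNIV :: nat set))"
    if "0 \<le> u" for u :: real
    using that by (intro measurable_component_singleton) auto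
  from measurable_compose[OF measurable_Pair_count_space[OF this[OF assms(2)] this[OF assms(1)]],
    of "\<lambda>p. fst p - snd p" "count_space UNIV"]
  show ?thesis by simp
qed

lemma (in prob_space) bounded_integrable:
  fixes f :: "'a \<Rightarrow> real"
  assumes "f \<in> borel_measurable M" "\<And>\<omega>. \<bar>f \<omega>\<bar> \<le> C"
  shows "integrable M f"
  using assms by (intro integrable_const_bound[of _ C]) auto

lemma (in prob_space) expectation_of_bool:
  assumes "{\<omega> \<in> space M. P \<omega>} \<in> events"
  shows "expectation (\<lambda>\<omega>. of_bool (P \<omega>) :: real) = prob {\<omega> \<in> space M. P \<omega>}"
proof -
  have "expectation (\<lambda>\<omega>. of_bool (P \<omega>) :: real) = expectation (indicator {\<omega> \<in> space M. P \<omega>})"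
    by (intro Bochner_Integration.integral_cong) (auto simp: indicator_def)
  then show ?thesis using assms by simp
qed

lemma (in prob_space) abs_diff_expectation_le:
  fixes f g :: "'a \<Rightarrow> real"
  assumes fg: "integrable M f" "integrable M g" and P: "{\<omega> \<in> space M. P \<omega>} \<in> events"
    and diff: "AE \<omega> in M. \<bar>f \<omega> - g \<omega>\<bar> \<le> K * of_bool (P \<omega>)"
  shows "\<bar>expectation f - expectation g\<bar> \<le> K * prob {\<omega> \<in> space M. P \<omega>}"
proof -
  have P': "integrable M (\<lambda>\<omega>. of_bool (P \<omega>) :: real)"
  proof (rule bounded_integrable[of _ 1])
    have "Measurable.pred M P" using P by (simp add: pred_def)
    then show "(\<lambda>\<omega>. of_bool (P \<omega>) :: real) \<in> borel_measurable M" by measurable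
  qed auto
  have "\<bar>expectation f - expectation g\<bar> = \<bar>expectation (\<lambda>\<omega>. f \<omega> - g \<omega>)\<bar>"
    using fg by simp
  also have "\<dots> \<le> expectation (\<lambda>\<omega>. \<bar>f \<omega> - g \<omega>\<bar>)"
    by (rule integral_abs_bound)
  also have "\<dots> \<le> expectation (\<lambda>\<omega>. K * of_bool (P \<omega>))"
    using fg P' diff by (intro integral_mono_AE) auto
  also have "\<dots> = K * prob {\<omega> \<in> space M. P \<omega>}"
    using P' by (simp add: expectation_of_bool[OF P])
  finally show ?thesis .
qed

text \<open>
  The space is complete because functionals of the process are only almost surely equal to
  measurable functions of the clocks.
\<close>

locale poisson_family = prob_space M + complete_measure M for M :: "'a measure" +
  fixes N :: "nat \<Rightarrow> real \<Rightarrow> 'a \<Rightarrow> nat"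
  assumes poisson: "1 \<le> i \<Longrightarrow> poisson_process M 1 (N i)"
    and indep_paths: "indep_vars (\<lambda>_. Pi\<^sub>M {0..} (\<lambda>_. count_space UNIV)) (\<lambda>i \<omega>. \<lambda>t\<in>{0..}. N i t \<omega>) {1..}"
begin

definition incr :: "nat \<Rightarrow> real \<Rightarrow> real \<Rightarrow> 'a \<Rightarrow> nat" where
  "incr i s t \<omega> = N i t \<omega> - N i s \<omega>"

lemma incr_measurable [measurable]:
  assumes "1 \<le> i" "0 \<le> s" "0 \<le> t"
  shows "incr i s t \<in> measurable M (count_space UNIV)"
proof -
  have [measurable]: "N i s \<in> measurable M (count_space UNIV)" "N i t \<in> measurable M (count_space UNIV)"
    using assms by (auto intro: poisson_process_measurable[OF poisson])
  show ?thesis unfolding incr_def[abs_def] by measurable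
qed

lemma indep_incr_grid:
  assumes "0 \<le> \<tau> 0" "incseq \<tau>"
  shows "indep_vars (\<lambda>_. count_space UNIV) (\<lambda>(i, k). incr i (\<tau> k) (\<tau> (Suc k))) ({1..} \<times> {..<n::nat})"
proof (rule indep_vars_Times[where f = "\<lambda>k y. y (\<tau> (Suc k)) - y (\<tau> k)", OF _ indep_paths])
  have pos: "0 \<le> \<tau> k" for k
    using assms order_trans[OF assms(1) incseqD[OF assms(2), of 0 k]] by simp
  show "indep_vars (\<lambda>_. count_space UNIV) (\<lambda>k. incr i (\<tau> k) (\<tau> (Suc k))) {..<n}" if "i \<in> {1..}" for i
    using poisson_process_indep[OF poisson assms] that by (simp add: incr_def[abs_def])
  show "(\<lambda>y. y (\<tau> (Suc k)) - y (\<tau> k)) \<in> measurable (Pi\<^sub>M {0..} (\<lambda>_. count_space UNIV)) (count_space (UNIV :: nat set))" for k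
    by (intro path_increment_measurable pos)
  show "incr i (\<tau> k) (\<tau> (Suc k)) \<omega> = (\<lambda>t\<in>{0..}. N i t \<omega>) (\<tau> (Suc k)) - (\<lambda>t\<in>{0..}. N i t \<omega>) (\<tau> k)" for i k \<omega>
    by (simp add: incr_def pos)
qed

lemma indep_incr:
  assumes "0 \<le> s" "s \<le> t"
  shows "indep_vars (\<lambda>_. count_space UNIV) (\<lambda>i. incr i s t) {1..}"
proof -
  have "indep_vars (\<lambda>_. count_space UNIV) (\<lambda>i \<omega>. (\<lambda>t\<in>{0..}. N i t \<omega>) t - (\<lambda>t\<in>{0..}. N i t \<omega>) s) {1..}"
    using assms by (intro indep_vars_compose2[OF indep_paths] path_increment_measurable) auto
  then show ?thesis using assms by (simp add: incr_def[abs_def])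
qed

lemma prob_incr:
  assumes "1 \<le> i" "0 \<le> s" "s < t"
  shows "prob {\<omega> \<in> space M. incr i s t \<omega> \<in> A} = measure (measure_pmf (poisson_pmf (t - s))) A"
proof -
  have "measure (distr M (count_space UNIV) (incr i s t)) A = prob (incr i s t -` A \<inter> space M)"
    using assms by (intro measure_distr) auto
  then show ?thesis
    using poisson_process_distr[OF poisson assms(2,3)] assms(1)
    by (simp add: incr_def[abs_def] vimage_def Int_def conj_commute)
qed

lemma prob_incr_0:
  assumes "1 \<le> i" "0 \<le> s" "s < t"
  shows "prob {\<omega> \<in> space M. incr i s t \<omega> = 0} = exp (- (t - s))"
  using prob_incr[OF assms, of "{0}"] assms by (simp add: measure_pmf_single)

lemma prob_incr_pos:
  assumes "1 \<le> i" "0 \<le> s" "s < t"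
  shows "prob {\<omega> \<in> space M. incr i s t \<omega> \<noteq> 0} = 1 - exp (- (t - s))"
proof -
  have "incr i s t \<in> measurable M (count_space UNIV)" using assms by auto
  then have "{\<omega> \<in> space M. incr i s t \<omega> = 0} \<in> events" by measurable
  moreover have "{\<omega> \<in> space M. incr i s t \<omega> \<noteq> 0} = space M - {\<omega> \<in> space M. incr i s t \<omega> = 0}" by auto
  ultimately show ?thesis using prob_incr_0[OF assms] by (simp add: prob_compl)
qed

lemma prob_incr_two:
  assumes "1 \<le> i" "0 \<le> s" "s < t"
  shows "prob {\<omega> \<in> space M. 2 \<le> incr i s t \<omega>} \<le> (t - s)\<^sup>2"
proof -
  define h where "h = t - s"
  have h: "0 < h" using assms by (simp add: h_def)
  have "prob {\<omega> \<in> space M. incr i s t \<omega> \<in> - {0, 1}} = measure (measure_pmf (poisson_pmf h)) (- {0, 1})"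
    unfolding h_def by (rule prob_incr[OF assms])
  also have "\<dots> = 1 - measure (measure_pmf (poisson_pmf h)) {0, 1}"
    using measure_pmf.prob_compl[of "{0, 1}" "poisson_pmf h"] by (simp add: Compl_eq_Diff_UNIV)
  also have "measure (measure_pmf (poisson_pmf h)) {0, 1} = exp (- h) * (1 + h)"
    using h by (simp add: measure_measure_pmf_finite algebra_simps)
  also have "1 - exp (- h) * (1 + h) \<le> 1 - (1 - h) * (1 + h)"
    using h exp_ge_add_one_self[of "- h"] by (intro diff_left_mono mult_right_mono) auto
  also have "\<dots> = h\<^sup>2" by (simp add: algebra_simps power2_eq_square)
  also have "{\<omega> \<in> space M. incr i s t \<omega> \<in> - {0, 1}} = {\<omega> \<in> space M. 2 \<le> incr i s t \<omega>}" by auto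
  finally show ?thesis by (simp add: h_def)
qed

lemma prob_both_incr:
  assumes "1 \<le> i" "1 \<le> j" "i \<noteq> j" "0 \<le> s" "s < t"
  shows "prob {\<omega> \<in> space M. incr i s t \<omega> \<noteq> 0 \<and> incr j s t \<omega> \<noteq> 0} \<le> (t - s)\<^sup>2"
proof -
  have "prob (\<Inter>k\<in>{i, j}. incr k s t -` (- {0}) \<inter> space M) = (\<Prod>k\<in>{i, j}. prob (incr k s t -` (- {0}) \<inter> space M))"
    using assms by (intro indep_varsD[OF indep_incr[of s t]]) auto
  also have "\<dots> = (\<Prod>k\<in>{i, j}. 1 - exp (- (t - s)))"
  proof (rule prod.cong[OF refl])
    fix k assume "k \<in> {i, j}"
    moreover have "incr k s t -` (- {0}) \<inter> space M = {\<omega> \<in> space M. incr k s t \<omega> \<noteq> 0}" by auto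
    ultimately show "prob (incr k s t -` (- {0}) \<inter> space M) = 1 - exp (- (t - s))"
      using assms prob_incr_pos[of k s t] by auto
  qed
  also have "\<dots> = (1 - exp (- (t - s)))\<^sup>2" using assms(3) by (simp add: power2_eq_square)
  also have "\<dots> \<le> (t - s)\<^sup>2"
    using assms one_minus_exp_le[of "t - s"] by (intro power_mono) auto
  also have "(\<Inter>k\<in>{i, j}. incr k s t -` (- {0}) \<inter> space M) = {\<omega> \<in> space M. incr i s t \<omega> \<noteq> 0 \<and> incr j s t \<omega> \<noteq> 0}"
    by auto
  finally show ?thesis .
qed

lemma AE_counting_paths: "AE \<omega> in M. \<forall>i\<ge>1. counting_path (\<lambda>t. N i t \<omega>)"
  unfolding AE_all_countable by (intro allI AE_impI poisson_process_paths[OF poisson])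

text \<open>
  A common ring up to time \<open>T\<close> forces two independent increments to be positive in the same slot of
  every grid. With \<open>n\<close> slots this has probability at most \<open>n (T / n)\<^sup>2\<close>, which tends to \<open>0\<close>.
\<close>

lemma AE_no_common_ring:
  assumes ij: "1 \<le> i" "1 \<le> j" "i \<noteq> j"
  shows "AE \<omega> in M. rings N \<omega> i \<inter> rings N \<omega> j = {}"
proof -
  have "AE \<omega> in M. rings N \<omega> i \<inter> rings N \<omega> j \<inter> {..real (Suc T)} = {}" for T
  proof -
    let ?g = "grid (Suc T)"
    define E where "E n = (\<Union>k<Suc n. {\<omega> \<in> space M. incr i (?g (Suc n) k) (?g (Suc n) (Suc k)) \<omega> \<noteq> 0 \<and>
        incr j (?g (Suc n) k) (?g (Suc n) (Suc k)) \<omega> \<noteq> 0})" for n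
    have slot_events: "{\<omega> \<in> space M. incr i (?g n k) (?g n (Suc k)) \<omega> \<noteq> 0 \<and> incr j (?g n k) (?g n (Suc k)) \<omega> \<noteq> 0} \<in> events" for n k
    proof -
      have [measurable]: "incr i (?g n k) (?g n (Suc k)) \<in> measurable M (count_space UNIV)"
        "incr j (?g n k) (?g n (Suc k)) \<in> measurable M (count_space UNIV)"
        using ij by (auto intro!: incr_measurable grid_nonneg)
      show ?thesis by measurable
    qed
    then have E: "E n \<in> events" for n unfolding E_def by auto
    have bound: "prob (E n) \<le> (real (Suc T))\<^sup>2 / Suc n" for n
    proof -
      have total: "(\<Sum>k<Suc n. (c / Suc n)\<^sup>2) = c\<^sup>2 / Suc n" for c :: real
        by (simp add: power_divide power2_eq_square)
      have "prob (E n) \<le> (\<Sum>k<Suc n. (real (Suc T) / Suc n)\<^sup>2)"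
        unfolding E_def
      proof (rule order_trans[OF finite_measure_subadditive_finite sum_mono])
        fix k
        show "prob {\<omega> \<in> space M. incr i (?g (Suc n) k) (?g (Suc n) (Suc k)) \<omega> \<noteq> 0 \<and>
            incr j (?g (Suc n) k) (?g (Suc n) (Suc k)) \<omega> \<noteq> 0} \<le> (real (Suc T) / Suc n)\<^sup>2"
          using prob_both_incr[OF ij, of "?g (Suc n) k" "?g (Suc n) (Suc k)"] by (simp add: grid_nonneg grid_Suc)
      qed (use slot_events in auto)
      also have "\<dots> = (real (Suc T))\<^sup>2 / Suc n" by (rule total)
      finally show ?thesis .
    qed
    have "prob (\<Inter>n. E n) \<le> 0"
    proof (rule LIMSEQ_le_const)
      show "(\<lambda>n. (real (Suc T))\<^sup>2 / Suc n) \<longlonglongrightarrow> 0"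
        using lim_const_over_n[of "(real (Suc T))\<^sup>2"] LIMSEQ_Suc by fast
      show "\<exists>N. \<forall>n\<ge>N. prob (\<Inter>n. E n) \<le> (real (Suc T))\<^sup>2 / Suc n"
        using bound E by (intro exI allI impI order_trans[OF finite_measure_mono bound]) auto
    qed
    then have "(\<Inter>n. E n) \<in> null_sets M"
      using E by (intro null_setsI) (auto simp: emeasure_eq_measure measure_le_0_iff)
    from AE_not_in[OF this] AE_counting_paths AE_space
    show ?thesis
    proof eventually_elim
      case (elim \<omega>)
      then obtain n where n: "\<omega> \<notin> E n" by auto
      have False if r: "r \<in> rings N \<omega> i" "r \<in> rings N \<omega> j" "r \<le> real (Suc T)" for r
      proof -
        have "0 < r" using r(1) by (auto simp: rings_def dest: ring_times_pos)
        then obtain k where k: "k < Suc n" "r \<in> slot (Suc T) (Suc n) k"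
          using in_some_slot[of r "Suc T" "Suc n"] r by auto
        have "incr l (?g (Suc n) k) (?g (Suc n) (Suc k)) \<omega> \<noteq> 0" if "l \<in> {i, j}" for l
        proof -
          have "counting_path (\<lambda>t. N l t \<omega>)" using elim(2) that ij by blast
          then show ?thesis
            using no_ring_iff[of "\<lambda>t. N l t \<omega>" "?g (Suc n) k" "?g (Suc n) (Suc k)"] k(2) r that
            by (auto simp: grid_nonneg grid_mono incr_def slot_def rings_def)
        qed
        then have "\<omega> \<in> E n" using k(1) elim(3) unfolding E_def by blast
        then show False using n by simp
      qed
      then show ?case by auto
    qed
  qed
  then have "AE \<omega> in M. \<forall>T::nat. rings N \<omega> i \<inter> rings N \<omega> j \<inter> {..real (Suc T)} = {}"
    unfolding AE_all_countable by (rule allI)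
  then show ?thesis
  proof eventually_elim
    case (elim \<omega>)
    have False if r: "r \<in> rings N \<omega> i" "r \<in> rings N \<omega> j" for r
    proof -
      obtain T :: nat where "r \<le> real T" using real_arch_simple by blast
      then have "r \<le> real (Suc T)" by simp
      then show False using r elim by blast
    qed
    then show ?case by blast
  qed
qed

text \<open>
  Each pair is silent up to a fixed time with the same positive probability, independently of the
  others.
\<close>

lemma AE_silent_pair:
  assumes "1 \<le> i"
  shows "AE \<omega> in M. \<exists>m\<ge>i. incr m 0 (real (Suc T)) \<omega> = 0"
proof -
  let ?t = "real (Suc T)"
  define E where "E n = (\<Inter>m\<in>{i..i + n}. incr m 0 ?t -` (- {0}) \<inter> space M)" for n
  have E: "E n \<in> events" for n
    unfolding E_def using assms by (intro sets.finite_INT measurable_sets[OF incr_measurable]) auto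
  have prob_E: "prob (E n) = (1 - exp (- ?t)) ^ Suc n" for n
  proof -
    have "prob (E n) = (\<Prod>m\<in>{i..i + n}. prob (incr m 0 ?t -` (- {0}) \<inter> space M))"
      unfolding E_def using assms by (intro indep_varsD[OF indep_incr]) auto
    also have "\<dots> = (\<Prod>m\<in>{i..i + n}. 1 - exp (- ?t))"
    proof (rule prod.cong[OF refl])
      fix m assume "m \<in> {i..i + n}"
      moreover have "incr m 0 ?t -` (- {0}) \<inter> space M = {\<omega> \<in> space M. incr m 0 ?t \<omega> \<noteq> 0}" by auto
      ultimately show "prob (incr m 0 ?t -` (- {0}) \<inter> space M) = 1 - exp (- ?t)"
        using assms prob_incr_pos[of m 0 ?t] by auto
    qed
    finally show ?thesis by simp
  qed
  have "prob (\<Inter>n. E n) \<le> 0"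
  proof (rule LIMSEQ_le_const)
    show "(\<lambda>n. (1 - exp (- ?t)) ^ Suc n) \<longlonglongrightarrow> 0"
      by (intro LIMSEQ_Suc LIMSEQ_realpow_zero) auto
    show "\<exists>N. \<forall>n\<ge>N. prob (\<Inter>n. E n) \<le> (1 - exp (- ?t)) ^ Suc n"
      unfolding prob_E[symmetric] using E by (intro exI allI impI finite_measure_mono) auto
  qed
  then have "(\<Inter>n. E n) \<in> null_sets M"
    using E by (intro null_setsI) (auto simp: emeasure_eq_measure measure_le_0_iff)
  from AE_not_in[OF this] AE_space show ?thesis
  proof eventually_elim
    case (elim \<omega>)
    then obtain n m where "m \<in> {i..i + n}" "incr m 0 ?t \<omega> = 0" by (auto simp: E_def)
    then show ?case by (intro exI[of _ m]) auto
  qed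
qed

lemma AE_harris: "AE \<omega> in M. harris (rings N \<omega>)"
proof -
  have "AE \<omega> in M. \<forall>i j. 1 \<le> i \<longrightarrow> 1 \<le> j \<longrightarrow> i \<noteq> j \<longrightarrow> rings N \<omega> i \<inter> rings N \<omega> j = {}"
    unfolding AE_all_countable by (intro allI AE_impI AE_no_common_ring)
  moreover have "AE \<omega> in M. \<forall>i T. 1 \<le> i \<longrightarrow> (\<exists>m\<ge>i. incr m 0 (real (Suc T)) \<omega> = 0)"
    unfolding AE_all_countable by (intro allI AE_impI AE_silent_pair)
  ultimately show ?thesis using AE_counting_paths
  proof eventually_elim
    case (elim \<omega>)
    show ?case
    proof
      show "0 < r" if "r \<in> rings N \<omega> i" for i r
        using that unfolding rings_def by (rule ring_times_pos)
      show "finite (rings N \<omega> i \<inter> {0..t})" if "1 \<le> i" for i t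
        unfolding rings_def using elim(3) that by (intro finite_ring_times) simp
      show "rings N \<omega> i \<inter> rings N \<omega> j = {}" if "1 \<le> i" "1 \<le> j" "i \<noteq> j" for i j
        using elim(1) that by blast
      show "\<exists>m\<ge>i. rings N \<omega> m \<inter> {0..t} = {}" for i t
      proof -
        obtain T :: nat where T: "t \<le> real T" using real_arch_simple by blast
        obtain m where m: "m \<ge> max 1 i" "incr m 0 (real (Suc T)) \<omega> = 0"
          using elim(2) max.cobounded1 by metis
        then have "ring_times (\<lambda>t. N m t \<omega>) \<inter> {0<..real (Suc T)} = {}"
          using elim(3) no_ring_iff[of "\<lambda>t. N m t \<omega>" 0 "real (Suc T)"] by (simp add: incr_def)
        moreover have "ring_times (\<lambda>t. N m t \<omega>) \<inter> {0..t} \<subseteq> ring_times (\<lambda>t. N m t \<omega>) \<inter> {0<..real (Suc T)}"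
          using T ring_times_pos by fastforce
        ultimately show ?thesis using m(1) unfolding rings_def by (intro exI[of _ m]) auto
      qed
    qed
  qed
qed

end

section \<open>Independence of the configuration from later rings\<close>

lemma walk_cong:
  assumes "\<And>i k. a \<le> i \<Longrightarrow> k < n \<Longrightarrow> c i k = c' i k"
  shows "walk c n a = walk c' n a"
  using assms
proof (induction n arbitrary: a)
  case (Suc n)
  have "walk c n b = walk c' n b" if "a \<le> b" for b
    using that Suc.prems by (intro Suc.IH) auto
  then show ?case using Suc.prems[of a n] by simp
qed simp

lemma walk_measurable:
  assumes "\<And>i k. 1 \<le> i \<Longrightarrow> k < n \<Longrightarrow> (\<lambda>x. c x i k) \<in> measurable L (count_space UNIV)" "1 \<le> a"
  shows "(\<lambda>x. walk (c x) n a) \<in> measurable L (count_space UNIV)"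
  using assms
proof (induction n arbitrary: a)
  case (Suc n)
  have [measurable]: "(\<lambda>x. c x a n) \<in> measurable L (count_space UNIV)"
    "(\<lambda>x. walk (c x) n a) \<in> measurable L (count_space UNIV)"
    "(\<lambda>x. walk (c x) n (Suc a)) \<in> measurable L (count_space UNIV)"
    using Suc.prems by (auto intro: Suc.IH)
  have "(\<lambda>x. walk (c x) (Suc n) a) = (\<lambda>x. if c x a n = 0 then walk (c x) n a else walk (c x) n (Suc a))"
    by auto
  then show ?case by simp
qed simp

context poisson_family
begin

definition counts :: "real \<Rightarrow> nat \<Rightarrow> 'a \<Rightarrow> nat \<Rightarrow> nat \<Rightarrow> nat" where
  "counts t n \<omega> i k = incr i (grid t n k) (grid t n (Suc k)) \<omega>"

definition lmax :: "real \<Rightarrow> nat \<Rightarrow> 'a \<Rightarrow> nat" where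
  "lmax t a \<omega> = label_max (rings N \<omega>) t a"

lemma AE_harris_and_paths: "AE \<omega> in M. harris (rings N \<omega>) \<and> (\<forall>i\<ge>1. counting_path (\<lambda>t. N i t \<omega>))"
  using AE_harris AE_counting_paths by (rule AE_conjI)

lemma walk_counts_measurable:
  assumes "0 \<le> t" "1 \<le> a"
  shows "(\<lambda>\<omega>. walk (counts t n \<omega>) k a) \<in> measurable M (count_space UNIV)"
  using assms by (intro walk_measurable) (auto simp: counts_def[abs_def] grid_nonneg)

lemma AE_walk_eq_lmax:
  assumes "0 \<le> t" "1 \<le> a"
  shows "AE \<omega> in M. \<forall>\<^sub>F n in sequentially. walk (counts t n \<omega>) n a = lmax t a \<omega>"
  using AE_harris_and_paths
proof eventually_elim
  case (elim \<omega>)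
  then interpret harris "rings N \<omega>" by blast
  have "counts t n \<omega> i k = 0 \<longleftrightarrow> rings N \<omega> i \<inter> slot t n k = {}" if "1 \<le> i" for n i k
    unfolding counts_def incr_def rings_def slot_def using elim that assms
    by (intro no_ring_iff[symmetric]) (auto simp: grid_nonneg grid_mono)
  then show ?case
    using eventually_walk_eq_label_max[OF assms] unfolding lmax_def
    by (elim eventually_mono) auto
qed

lemma lmax_measurable [measurable]:
  assumes "0 \<le> t" "1 \<le> a"
  shows "lmax t a \<in> measurable M (count_space UNIV)"
  by (rule measurable_AE_eventually_eq[OF walk_counts_measurable[OF assms] _ AE_walk_eq_lmax[OF assms]]) simp

text \<open>
  The walk is a function of the increments over the slots before \<open>t\<close>. Appending \<open>(t, t + h]\<close> to the
  grid makes both sides functions of disjoint parts of one independent array.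
\<close>

lemma indep_walk_increments:
  assumes t: "0 \<le> t" "0 < h" and pos: "1 \<le> a" "1 \<le> b" "1 \<le> i" "1 \<le> j" and n: "0 < n"
  shows "indep_var (count_space UNIV) (\<lambda>\<omega>. (walk (counts t n \<omega>) n a, walk (counts t n \<omega>) n b))
    (count_space UNIV) (\<lambda>\<omega>. (incr i t (t + h) \<omega>, incr j t (t + h) \<omega>))"
proof -
  \<comment> \<open>The grid up to time \<open>t\<close>, with the period after \<open>t\<close> as its slot number \<open>n\<close>.\<close>
  define \<tau> where "\<tau> k = (if k \<le> n then grid t n k else t + h)" for k
  have "incseq \<tau>"
  proof (rule incseq_SucI)
    fix k show "\<tau> k \<le> \<tau> (Suc k)"
    proof (cases "k = n")
      case True
      then show ?thesis using t n by (simp add: \<tau>_def grid_end)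
    qed (use t in \<open>auto simp: \<tau>_def intro!: grid_mono\<close>)
  qed
  moreover have "0 \<le> \<tau> 0" by (simp add: \<tau>_def)
  ultimately have "indep_vars (\<lambda>_. count_space UNIV) (\<lambda>(i, k). incr i (\<tau> k) (\<tau> (Suc k))) ({1..} \<times> {..<Suc n})"
    by (rule indep_incr_grid[rotated])
  from indep_var_restrict[OF this, of "{1..} \<times> {..<n}" "{1..} \<times> {n}"]
  have "indep_var
      (PiM ({1..} \<times> {..<n}) (\<lambda>_. count_space UNIV)) (\<lambda>\<omega>. \<lambda>(i, k)\<in>{1..} \<times> {..<n}. incr i (\<tau> k) (\<tau> (Suc k)) \<omega>)
      (PiM ({1..} \<times> {n}) (\<lambda>_. count_space UNIV)) (\<lambda>\<omega>. \<lambda>(i, k)\<in>{1..} \<times> {n}. incr i (\<tau> k) (\<tau> (Suc k)) \<omega>)"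
    by (simp add: case_prod_beta' Times_subset_cancel2 subset_eq disjoint_iff)
  moreover have "(\<lambda>x. (walk (\<lambda>i k. x (i, k)) n a, walk (\<lambda>i k. x (i, k)) n b))
      \<in> measurable (PiM ({1..} \<times> {..<n}) (\<lambda>_. count_space UNIV)) (count_space UNIV)"
    using pos by (intro measurable_Pair_count_space walk_measurable measurable_component_singleton) auto
  moreover have "(\<lambda>x. (x (i, n), x (j, n)))
      \<in> measurable (PiM ({1..} \<times> {n}) (\<lambda>_. count_space UNIV)) (count_space (UNIV :: (nat \<times> nat) set))"
    using pos by (intro measurable_Pair_count_space measurable_component_singleton) auto
  ultimately have "indep_var
      (count_space UNIV) ((\<lambda>x. (walk (\<lambda>i k. x (i, k)) n a, walk (\<lambda>i k. x (i, k)) n b)) \<circ>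
        (\<lambda>\<omega>. \<lambda>(i, k)\<in>{1..} \<times> {..<n}. incr i (\<tau> k) (\<tau> (Suc k)) \<omega>))
      (count_space UNIV) ((\<lambda>x. (x (i, n), x (j, n))) \<circ> (\<lambda>\<omega>. \<lambda>(i, k)\<in>{1..} \<times> {n}. incr i (\<tau> k) (\<tau> (Suc k)) \<omega>))"
    by (rule indep_var_compose)
  moreover have "walk (\<lambda>i k. (\<lambda>(i, k)\<in>{1..} \<times> {..<n}. incr i (\<tau> k) (\<tau> (Suc k)) \<omega>) (i, k)) n c =
      walk (counts t n \<omega>) n c" if "1 \<le> c" for c \<omega>
    using that by (intro walk_cong) (auto simp: counts_def \<tau>_def)
  moreover have "(\<lambda>(i, k)\<in>{1..} \<times> {n}. incr i (\<tau> k) (\<tau> (Suc k)) \<omega>) (c, n) = incr c t (t + h) \<omega>"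
    if "1 \<le> c" for c \<omega>
    using that n by (simp add: \<tau>_def grid_end)
  ultimately show ?thesis using pos by (simp add: comp_def)
qed

lemma lmax_pair_measurable [measurable]:
  fixes F :: "nat \<Rightarrow> nat \<Rightarrow> real"
  assumes "0 \<le> t" "0 \<le> s" "1 \<le> a" "1 \<le> b"
  shows "(\<lambda>\<omega>. F (lmax t a \<omega>) (lmax s b \<omega>)) \<in> borel_measurable M"
proof -
  have "(\<lambda>\<omega>. (lmax t a \<omega>, lmax s b \<omega>)) \<in> measurable M (count_space UNIV)"
    using assms by (intro measurable_Pair_count_space lmax_measurable)
  from measurable_compose[OF this, of "\<lambda>(x, y). F x y" borel] show ?thesis by simp
qed

lemma incr_pair_measurable [measurable]:
  fixes G :: "nat \<Rightarrow> nat \<Rightarrow> real"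
  assumes "0 \<le> s" "0 \<le> t" "1 \<le> i" "1 \<le> j"
  shows "(\<lambda>\<omega>. G (incr i s t \<omega>) (incr j s t \<omega>)) \<in> borel_measurable M"
proof -
  have "(\<lambda>\<omega>. (incr i s t \<omega>, incr j s t \<omega>)) \<in> measurable M (count_space UNIV)"
    using assms by (intro measurable_Pair_count_space incr_measurable)
  from measurable_compose[OF this, of "\<lambda>(x, y). G x y" borel] show ?thesis by simp
qed

text \<open>
  The maxima at time \<open>t\<close> are independent of the rings in \<open>(t, t + h]\<close>: this holds for the walks on
  every grid and survives the limit by dominated convergence.
\<close>

lemma expectation_past_times_increments:
  fixes F G :: "nat \<Rightarrow> nat \<Rightarrow> real"
  assumes t: "0 \<le> t" "0 < h" and pos: "1 \<le> a" "1 \<le> b" "1 \<le> i" "1 \<le> j"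
    and F: "\<And>x y. \<bar>F x y\<bar> \<le> C" and G: "\<And>x y. \<bar>G x y\<bar> \<le> D"
  shows "expectation (\<lambda>\<omega>. F (lmax t a \<omega>) (lmax t b \<omega>) * G (incr i t (t + h) \<omega>) (incr j t (t + h) \<omega>)) =
    expectation (\<lambda>\<omega>. F (lmax t a \<omega>) (lmax t b \<omega>)) * expectation (\<lambda>\<omega>. G (incr i t (t + h) \<omega>) (incr j t (t + h) \<omega>))"
proof -
  let ?w = "\<lambda>n \<omega>. F (walk (counts t n \<omega>) n a) (walk (counts t n \<omega>) n b)"
  let ?l = "\<lambda>\<omega>. F (lmax t a \<omega>) (lmax t b \<omega>)"
  let ?g = "\<lambda>\<omega>. G (incr i t (t + h) \<omega>) (incr j t (t + h) \<omega>)"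
  have l: "?l \<in> borel_measurable M" and g: "?g \<in> borel_measurable M"
    using lmax_pair_measurable[of t t a b F] incr_pair_measurable[of t "t + h" i j G] t pos by simp_all
  have w: "?w n \<in> borel_measurable M" for n
  proof -
    have "(\<lambda>\<omega>. (walk (counts t n \<omega>) n a, walk (counts t n \<omega>) n b)) \<in> measurable M (count_space UNIV)"
      using t pos by (intro measurable_Pair_count_space walk_counts_measurable) auto
    from measurable_compose[OF this, of "\<lambda>(x, y). F x y" borel] show ?thesis by simp
  qed
  have C: "0 \<le> C" using order_trans[OF abs_ge_zero F[of 0 0]] .
  have lim: "AE \<omega> in M. (\<lambda>n. ?w n \<omega>) \<longlonglongrightarrow> ?l \<omega>"
    using AE_walk_eq_lmax[OF t(1) pos(1)] AE_walk_eq_lmax[OF t(1) pos(2)]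
  proof eventually_elim
    case (elim \<omega>)
    then have "\<forall>\<^sub>F n in sequentially. ?w n \<omega> = ?l \<omega>" by eventually_elim simp
    then show ?case by (rule tendsto_eventually)
  qed
  have prod: "expectation (\<lambda>\<omega>. ?w n \<omega> * ?g \<omega>) = expectation (?w n) * expectation ?g" if "0 < n" for n
  proof (rule indep_var_lebesgue_integral)
    have "indep_var borel ((\<lambda>(x, y). F x y) \<circ> (\<lambda>\<omega>. (walk (counts t n \<omega>) n a, walk (counts t n \<omega>) n b)))
        borel ((\<lambda>(x, y). G x y) \<circ> (\<lambda>\<omega>. (incr i t (t + h) \<omega>, incr j t (t + h) \<omega>)))"
      by (rule indep_var_compose[OF indep_walk_increments[OF t pos that]]) simp_all
    then show "indep_var borel (?w n) borel ?g" by (simp add: comp_def)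
    show "integrable M (?w n)" by (rule bounded_integrable[OF w F])
    show "integrable M ?g" by (rule bounded_integrable[OF g G])
  qed
  have lim1: "(\<lambda>n. expectation (\<lambda>\<omega>. ?w n \<omega> * ?g \<omega>)) \<longlonglongrightarrow> expectation (\<lambda>\<omega>. ?l \<omega> * ?g \<omega>)"
  proof (rule integral_dominated_convergence)
    show "AE \<omega> in M. (\<lambda>n. ?w n \<omega> * ?g \<omega>) \<longlonglongrightarrow> ?l \<omega> * ?g \<omega>"
      using lim by eventually_elim (intro tendsto_intros)
    show "AE \<omega> in M. norm (?w n \<omega> * ?g \<omega>) \<le> C * D" for n
      using F G C by (auto simp: abs_mult intro!: mult_mono)
  qed (use l g w in simp_all)
  have "(\<lambda>n. expectation (?w n)) \<longlonglongrightarrow> expectation ?l"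
  proof (rule integral_dominated_convergence)
    show "AE \<omega> in M. norm (?w n \<omega>) \<le> C" for n using F by (simp only: real_norm_def) simp
  qed (use l w lim in simp_all)
  then have "(\<lambda>n. expectation (?w n) * expectation ?g) \<longlonglongrightarrow> expectation ?l * expectation ?g"
    by (intro tendsto_intros)
  moreover have "\<forall>\<^sub>F n in sequentially. expectation (?w n) * expectation ?g = expectation (\<lambda>\<omega>. ?w n \<omega> * ?g \<omega>)"
    using eventually_gt_at_top[of 0] by eventually_elim (simp add: prod)
  ultimately have "(\<lambda>n. expectation (\<lambda>\<omega>. ?w n \<omega> * ?g \<omega>)) \<longlonglongrightarrow> expectation ?l * expectation ?g"
    by (rule Lim_transform_eventually)
  with lim1 show ?thesis by (rule LIMSEQ_unique)
qed

text \<open>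
  The event, of probability \<open>O(h\<^sup>2)\<close> in a period of length \<open>h\<close>, on which the new value of \<open>M\<^sub>a\<close> is not
  decided by whether \<open>(a, a + 1)\<close> rings.
\<close>

definition crowded :: "nat \<Rightarrow> real \<Rightarrow> real \<Rightarrow> 'a \<Rightarrow> bool" where
  "crowded a s t \<omega> \<longleftrightarrow> 2 \<le> incr a s t \<omega> \<or> (incr a s t \<omega> \<noteq> 0 \<and> incr (Suc a) s t \<omega> \<noteq> 0)"

lemma crowded_event:
  assumes "1 \<le> a" "0 \<le> s" "0 \<le> t"
  shows "{\<omega> \<in> space M. crowded a s t \<omega>} \<in> events"
proof -
  have [measurable]: "incr a s t \<in> measurable M (count_space UNIV)" "incr (Suc a) s t \<in> measurable M (count_space UNIV)"
    using assms by auto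
  show ?thesis unfolding crowded_def by measurable
qed

lemma prob_crowded:
  assumes "1 \<le> a" "0 \<le> s" "s < t"
  shows "prob {\<omega> \<in> space M. crowded a s t \<omega>} \<le> 2 * (t - s)\<^sup>2"
proof -
  have [measurable]: "incr a s t \<in> measurable M (count_space UNIV)" "incr (Suc a) s t \<in> measurable M (count_space UNIV)"
    using assms by auto
  have "{\<omega> \<in> space M. crowded a s t \<omega>} =
      {\<omega> \<in> space M. 2 \<le> incr a s t \<omega>} \<union> {\<omega> \<in> space M. incr a s t \<omega> \<noteq> 0 \<and> incr (Suc a) s t \<omega> \<noteq> 0}"
    by (auto simp: crowded_def)
  then have "prob {\<omega> \<in> space M. crowded a s t \<omega>} \<le>
      prob {\<omega> \<in> space M. 2 \<le> incr a s t \<omega>} + prob {\<omega> \<in> space M. incr a s t \<omega> \<noteq> 0 \<and> incr (Suc a) s t \<omega> \<noteq> 0}"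
    by (simp only:) (intro measure_Un_le; measurable)
  then show ?thesis
    using prob_incr_two[OF assms] prob_both_incr[of a "Suc a" s t] assms by simp
qed

lemma AE_lmax_step:
  assumes "1 \<le> a" "0 \<le> s" "s \<le> t"
  shows "AE \<omega> in M. \<not> crowded a s t \<omega> \<longrightarrow> lmax t a \<omega> = lmax s (if incr a s t \<omega> = 0 then a else Suc a) \<omega>"
  using AE_harris_and_paths
proof eventually_elim
  case (elim \<omega>)
  then interpret harris "rings N \<omega>" by blast
  have path: "counting_path (\<lambda>t. N i t \<omega>)" if "1 \<le> i" for i using elim that by blast
  show ?case
  proof
    assume nc: "\<not> crowded a s t \<omega>"
    show "lmax t a \<omega> = lmax s (if incr a s t \<omega> = 0 then a else Suc a) \<omega>"
    proof (cases "incr a s t \<omega> = 0")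
      case True
      then have "rings N \<omega> a \<inter> {s<..t} = {}"
        using no_ring_iff[OF path[OF assms(1)] assms(2,3)] by (simp add: rings_def incr_def)
      then show ?thesis using True label_max_silent[of s t a] assms by (simp add: lmax_def)
    next
      case False
      then have "N a t \<omega> - N a s \<omega> = 1" "incr (Suc a) s t \<omega> = 0"
        using nc by (auto simp: crowded_def incr_def)
      then obtain r where r: "rings N \<omega> a \<inter> {s<..t} = {r}"
        using single_ring[OF path[OF assms(1)] assms(2,3)] unfolding rings_def by metis
      have "rings N \<omega> (Suc a) \<inter> {s<..t} = {}"
        using \<open>incr (Suc a) s t \<omega> = 0\<close> no_ring_iff[OF path[of "Suc a"] assms(2,3)]
        by (simp add: rings_def incr_def)
      then show ?thesis using False label_max_one_ring[OF assms(2,3,1) r] by (simp add: lmax_def)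
    qed
  qed
qed

end

section \<open>The evolution equation of the prefix maxima\<close>

text \<open>
  The increment bound by itself gives only a right derivative. For the left derivative it is applied
  at the earlier time, and continuity of \<open>g\<close> moves the base point back to \<open>t\<close>.
\<close>

lemma has_real_derivative_of_increment_bound:
  fixes f g :: "real \<Rightarrow> real"
  assumes f: "\<And>t h. 0 \<le> t \<Longrightarrow> 0 < h \<Longrightarrow> \<bar>f (t + h) - f t - h * g t\<bar> \<le> K * h\<^sup>2"
    and g: "\<And>t h. 0 \<le> t \<Longrightarrow> 0 < h \<Longrightarrow> \<bar>g (t + h) - g t\<bar> \<le> L * h"
    and t: "0 \<le> t"
  shows "(f has_real_derivative g t) (at t within {0..})"
proof -
  have K: "0 \<le> K" using order_trans[OF abs_ge_zero f[of 0 1]] by simp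
  have L: "0 \<le> L" using order_trans[OF abs_ge_zero g[of 0 1]] by simp
  have forward: "\<bar>(f (s + h) - f s) / h - g s\<bar> \<le> K * h" if "0 \<le> s" "0 < h" for s h
  proof -
    have "(f (s + h) - f s) / h - g s = (f (s + h) - f s - h * g s) / h"
      using that by (simp add: field_simps)
    also have "\<bar>\<dots>\<bar> \<le> K * h\<^sup>2 / h"
      using f[OF that] that by (simp add: divide_right_mono)
    also have "\<dots> = K * h" using that by (simp add: power2_eq_square)
    finally show ?thesis .
  qed
  have bound: "\<bar>(f s - f t) / (s - t) - g t\<bar> \<le> (K + L) * \<bar>s - t\<bar>" if s: "0 \<le> s" "s \<noteq> t" for s
  proof (cases "t < s")
    case True
    have "\<bar>(f s - f t) / (s - t) - g t\<bar> \<le> K * \<bar>s - t\<bar>"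
      using forward[of t "s - t"] t True by simp
    also have "\<dots> \<le> (K + L) * \<bar>s - t\<bar>" using L by (intro mult_right_mono) auto
    finally show ?thesis .
  next
    case False
    then have h: "0 < t - s" using s by simp
    have "(f s - f t) / (s - t) = (f t - f s) / (t - s)"
      by (metis minus_diff_eq minus_divide_divide)
    moreover have "\<bar>(f t - f s) / (t - s) - g s\<bar> \<le> K * (t - s)"
      using forward[OF s(1) h] by simp
    moreover have "\<bar>g t - g s\<bar> \<le> L * (t - s)"
      using g[OF s(1) h] by simp
    ultimately show ?thesis using h by (simp add: algebra_simps)
  qed
  have "((\<lambda>s. (f s - f t) / (s - t) - g t) \<longlongrightarrow> 0) (at t within {0..})"
  proof (rule Lim_null_comparison)
    show "\<forall>\<^sub>F s in at t within {0..}. norm ((f s - f t) / (s - t) - g t) \<le> (K + L) * \<bar>s - t\<bar>"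
      using bound by (auto simp: eventually_at_filter)
    show "((\<lambda>s. (K + L) * \<bar>s - t\<bar>) \<longlongrightarrow> 0) (at t within {0..})"
      by (auto intro!: tendsto_eq_intros)
  qed
  then show ?thesis
    unfolding has_field_derivative_iff by (rule LIM_zero_cancel)
qed

lemma exp_minus_bounds:
  fixes h :: real
  assumes "0 < h"
  defines "q \<equiv> 1 - exp (- h)"
  shows "h - h\<^sup>2 \<le> q" "q \<le> h" "0 \<le> q"
proof -
  show le: "q \<le> h" using exp_ge_add_one_self[of "- h"] by (simp add: q_def)
  show "0 \<le> q" using assms by (simp add: q_def)
  have "exp (- h) * (1 + h) \<le> exp (- h) * exp h"
    using exp_ge_add_one_self[of h] by (intro mult_left_mono) auto
  also have "\<dots> = 1" by (simp flip: exp_add)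
  finally have "h * (1 - q) \<le> q" by (simp add: q_def algebra_simps)
  moreover have "h * q \<le> h\<^sup>2" using le assms(1) by (simp add: power2_eq_square)
  ultimately show "h - h\<^sup>2 \<le> q" by (simp add: algebra_simps)
qed

lemma (in prob_space) nat_expectation_sums:
  assumes X: "X \<in> measurable M (count_space UNIV)" and m: "(\<lambda>k. real k * prob {\<omega> \<in> space M. X \<omega> = k}) sums m"
  shows "integrable M (\<lambda>\<omega>. real (X \<omega>))" "expectation (\<lambda>\<omega>. real (X \<omega>)) = m"
proof -
  note [measurable] = X
  let ?E = "\<lambda>k. {\<omega> \<in> space M. X \<omega> = k}"
  have "ennreal (real (X \<omega>)) = (\<Sum>k. ennreal (real k) * indicator (?E k) \<omega>)" if "\<omega> \<in> space M" for \<omega>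
    using that by (subst suminf_finite[of "{X \<omega>}"]) (auto simp: indicator_def)
  then have "(\<integral>\<^sup>+\<omega>. ennreal (real (X \<omega>)) \<partial>M) = (\<integral>\<^sup>+\<omega>. (\<Sum>k. ennreal (real k) * indicator (?E k) \<omega>) \<partial>M)"
    by (intro nn_integral_cong)
  also have "\<dots> = (\<Sum>k. \<integral>\<^sup>+\<omega>. ennreal (real k) * indicator (?E k) \<omega> \<partial>M)"
    by (intro nn_integral_suminf) measurable
  also have "\<dots> = (\<Sum>k. ennreal (real k * prob (?E k)))"
    by (intro suminf_cong) (simp add: nn_integral_cmult_indicator emeasure_eq_measure ennreal_mult)
  also have "\<dots> = ennreal m"
    using m by (intro suminf_ennreal_eq) auto
  finally have nn: "(\<integral>\<^sup>+\<omega>. ennreal (real (X \<omega>)) \<partial>M) = ennreal m" .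
  have "0 \<le> m" using sums_le[OF _ sums_zero m] by simp
  then show "integrable M (\<lambda>\<omega>. real (X \<omega>))" "expectation (\<lambda>\<omega>. real (X \<omega>)) = m"
    using nn nn_integral_eq_integrable[of "\<lambda>\<omega>. real (X \<omega>)" M m] by auto
qed

text \<open>Up to the factor \<open>exp (- t)\<close> this is the mean \<open>1 + t\<close> of a Poisson variable plus one.\<close>

lemma poisson_mean_sums: "(\<lambda>j. (real j + 1) * (t ^ j / fact j)) sums ((1 + t) * exp (t::real))"
proof -
  have e: "(\<lambda>j. t ^ j / fact j) sums exp t"
    using exp_converges[of t] by (simp add: divide_inverse mult.commute)
  have "(\<lambda>i. real (Suc i) * (t ^ Suc i / fact (Suc i))) sums (t * exp t)"
  proof -
    have "real (Suc i) * (t ^ Suc i / fact (Suc i)) = t * (t ^ i / fact i)" for i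
      by (simp del: of_nat_Suc)
    then show ?thesis using sums_mult[OF e, of t] by simp
  qed
  then have "(\<lambda>j. real j * (t ^ j / fact j)) sums (t * exp t)"
    by (subst (asm) sums_Suc_iff) simp
  from sums_add[OF this e] show ?thesis by (simp add: algebra_simps add_divide_distrib)
qed

context poisson_family
begin

lemma expectation_incr_pair:
  assumes "1 \<le> a" "1 \<le> b" "a \<noteq> b" "0 \<le> s" "s < t"
  defines "q \<equiv> 1 - exp (- (t - s))"
  shows "expectation (\<lambda>\<omega>. of_bool ((incr a s t \<omega> = 0 \<longleftrightarrow> x) \<and> (incr b s t \<omega> = 0 \<longleftrightarrow> y)) :: real) =
    (if x then 1 - q else q) * (if y then 1 - q else q)"
proof -
  define A where "A z = (if z then {0} else - {0 :: nat})" for z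
  have inA: "k \<in> A z \<longleftrightarrow> (k = 0 \<longleftrightarrow> z)" for k z by (simp add: A_def)
  have [measurable]: "incr a s t \<in> measurable M (count_space UNIV)" "incr b s t \<in> measurable M (count_space UNIV)"
    using assms by auto
  have marginal: "prob (incr i s t -` A z \<inter> space M) = (if z then 1 - q else q)" if "1 \<le> i" for i z
  proof -
    have "incr i s t -` A z \<inter> space M = {\<omega> \<in> space M. incr i s t \<omega> = 0 \<longleftrightarrow> z}" by (auto simp: inA)
    then show ?thesis using prob_incr_0[OF that assms(4,5)] prob_incr_pos[OF that assms(4,5)]
      by (cases z) (simp_all add: q_def)
  qed
  have "prob (\<Inter>i\<in>{a, b}. incr i s t -` A (if i = a then x else y) \<inter> space M) =
      (\<Prod>i\<in>{a, b}. prob (incr i s t -` A (if i = a then x else y) \<inter> space M))"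
    using assms by (intro indep_varsD[OF indep_incr[of s t]]) auto
  also have "\<dots> = (if x then 1 - q else q) * (if y then 1 - q else q)"
    using assms(1-3) by (simp add: marginal)
  also have "(\<Inter>i\<in>{a, b}. incr i s t -` A (if i = a then x else y) \<inter> space M) =
      {\<omega> \<in> space M. (incr a s t \<omega> = 0 \<longleftrightarrow> x) \<and> (incr b s t \<omega> = 0 \<longleftrightarrow> y)}"
    using assms(3) by (auto simp: inA)
  also have "prob \<dots> = expectation (\<lambda>\<omega>. of_bool ((incr a s t \<omega> = 0 \<longleftrightarrow> x) \<and> (incr b s t \<omega> = 0 \<longleftrightarrow> y)))"
    by (rule expectation_of_bool[symmetric]) measurable
  finally show ?thesis by simp
qed

definition mean :: "(nat \<Rightarrow> nat \<Rightarrow> real) \<Rightarrow> real \<Rightarrow> nat \<Rightarrow> nat \<Rightarrow> real" where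
  "mean F t a b = expectation (\<lambda>\<omega>. F (lmax t a \<omega>) (lmax t b \<omega>))"

lemma lmax_pair_integrable:
  fixes F :: "nat \<Rightarrow> nat \<Rightarrow> real"
  assumes "\<And>x y. \<bar>F x y\<bar> \<le> C" "0 \<le> t" "0 \<le> s" "1 \<le> a" "1 \<le> b"
  shows "integrable M (\<lambda>\<omega>. F (lmax t a \<omega>) (lmax s b \<omega>))"
  by (rule bounded_integrable[OF lmax_pair_measurable]) (use assms in simp_all)

lemma mean_abs_le:
  assumes "\<And>x y. \<bar>F x y\<bar> \<le> C" "0 \<le> t" "1 \<le> a" "1 \<le> b"
  shows "\<bar>mean F t a b\<bar> \<le> C"
proof -
  have "\<bar>mean F t a b\<bar> \<le> expectation (\<lambda>\<omega>. \<bar>F (lmax t a \<omega>) (lmax t b \<omega>)\<bar>)"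
    unfolding mean_def by (rule integral_abs_bound)
  also have "\<dots> \<le> expectation (\<lambda>_. C)"
    using lmax_pair_integrable[where F = F and C = C, OF assms(1) assms(2) assms(2-4)] assms(1)
    by (intro integral_mono_AE integrable_abs) simp_all
  finally show ?thesis by (simp add: prob_space)
qed

text \<open>
  Outside the crowded events, each maximum moves to the next index independently with probability
  \<open>q\<close>, and these moves are independent of the maxima at time \<open>t\<close>.
\<close>

lemma mean_one_step:
  fixes F :: "nat \<Rightarrow> nat \<Rightarrow> real"
  assumes F: "\<And>x y. \<bar>F x y\<bar> \<le> C" and ab: "1 \<le> a" "1 \<le> b" "a \<noteq> b" and t: "0 \<le> t" "0 < h"
  defines "q \<equiv> 1 - exp (- h)"
  shows "\<bar>mean F (t + h) a b - ((1 - q) * (1 - q) * mean F t a b + q * (1 - q) * mean F t (Suc a) b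
    + (1 - q) * q * mean F t a (Suc b) + q * q * mean F t (Suc a) (Suc b))\<bar> \<le> 8 * C * h\<^sup>2"
proof -
  let ?Z = "\<lambda>i \<omega>. incr i t (t + h) \<omega>"
  \<comment> \<open>\<open>x\<close> and \<open>y\<close> say that \<open>(a, a + 1)\<close> and \<open>(b, b + 1)\<close>, respectively, do not ring.\<close>
  let ?part = "\<lambda>x y \<omega>. F (lmax t (if x then a else Suc a) \<omega>) (lmax t (if y then b else Suc b) \<omega>) *
      of_bool ((?Z a \<omega> = 0 \<longleftrightarrow> x) \<and> (?Z b \<omega> = 0 \<longleftrightarrow> y))"
  let ?w = "\<lambda>\<omega>. ?part True True \<omega> + ?part False True \<omega> + ?part True False \<omega> + ?part False False \<omega>"
  have C: "0 \<le> C" using order_trans[OF abs_ge_zero F[of 0 0]] .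
  have part_int: "integrable M (?part x y)" for x y
  proof (rule bounded_integrable)
    have "(\<lambda>\<omega>. F (lmax t (if x then a else Suc a) \<omega>) (lmax t (if y then b else Suc b) \<omega>)) \<in> borel_measurable M"
      using ab t by (intro lmax_pair_measurable) auto
    moreover have "(\<lambda>\<omega>. of_bool ((?Z a \<omega> = 0 \<longleftrightarrow> x) \<and> (?Z b \<omega> = 0 \<longleftrightarrow> y)) :: real) \<in> borel_measurable M"
      using ab t incr_pair_measurable[of t "t + h" a b "\<lambda>z w. of_bool ((z = 0 \<longleftrightarrow> x) \<and> (w = 0 \<longleftrightarrow> y))"] by simp
    ultimately show "?part x y \<in> borel_measurable M" by (rule borel_measurable_times)
    show "\<bar>?part x y \<omega>\<bar> \<le> C" for \<omega> using F C by (simp add: abs_mult)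
  qed
  have part: "expectation (?part x y) = mean F t (if x then a else Suc a) (if y then b else Suc b) *
      ((if x then 1 - q else q) * (if y then 1 - q else q))" for x y
  proof -
    have "expectation (?part x y) = mean F t (if x then a else Suc a) (if y then b else Suc b) *
        expectation (\<lambda>\<omega>. of_bool ((?Z a \<omega> = 0 \<longleftrightarrow> x) \<and> (?Z b \<omega> = 0 \<longleftrightarrow> y)))"
      unfolding mean_def using F ab t
      by (intro expectation_past_times_increments[where C = C and D = 1 and
          G = "\<lambda>z w. of_bool ((z = 0 \<longleftrightarrow> x) \<and> (w = 0 \<longleftrightarrow> y))"]) auto
    then show ?thesis using expectation_incr_pair[OF ab t(1), of "t + h" x y] t by (simp add: q_def)
  qed
  have w_int: "integrable M ?w"
    by (intro Bochner_Integration.integrable_add part_int)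
  have w: "expectation ?w = (1 - q) * (1 - q) * mean F t a b + q * (1 - q) * mean F t (Suc a) b
    + (1 - q) * q * mean F t a (Suc b) + q * q * mean F t (Suc a) (Suc b)"
  proof -
    have "expectation ?w = expectation (?part True True) + expectation (?part False True) +
        expectation (?part True False) + expectation (?part False False)"
      by (simp only: Bochner_Integration.integral_add Bochner_Integration.integrable_add part_int)
    then show ?thesis by (simp only: part) simp
  qed
  let ?bad = "\<lambda>\<omega>. crowded a t (t + h) \<omega> \<or> crowded b t (t + h) \<omega>"
  have events: "{\<omega> \<in> space M. crowded a t (t + h) \<omega>} \<in> events" "{\<omega> \<in> space M. crowded b t (t + h) \<omega>} \<in> events"
    using ab t by (auto intro!: crowded_event)
  have bad_eq: "{\<omega> \<in> space M. ?bad \<omega>} = {\<omega> \<in> space M. crowded a t (t + h) \<omega>} \<union> {\<omega> \<in> space M. crowded b t (t + h) \<omega>}"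
    by auto
  have "AE \<omega> in M. \<bar>F (lmax (t + h) a \<omega>) (lmax (t + h) b \<omega>) - ?w \<omega>\<bar> \<le> 2 * C * of_bool (?bad \<omega>)"
  proof -
    have "AE \<omega> in M. \<not> crowded a t (t + h) \<omega> \<longrightarrow> lmax (t + h) a \<omega> = lmax t (if ?Z a \<omega> = 0 then a else Suc a) \<omega>"
      "AE \<omega> in M. \<not> crowded b t (t + h) \<omega> \<longrightarrow> lmax (t + h) b \<omega> = lmax t (if ?Z b \<omega> = 0 then b else Suc b) \<omega>"
      by (rule AE_lmax_step; use ab t in simp)+
    then show ?thesis
    proof eventually_elim
      case (elim \<omega>)
      have w: "?w \<omega> = F (lmax t (if ?Z a \<omega> = 0 then a else Suc a) \<omega>) (lmax t (if ?Z b \<omega> = 0 then b else Suc b) \<omega>)"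
        by simp
      show ?case
      proof (cases "?bad \<omega>")
        case True
        have "\<bar>F (lmax (t + h) a \<omega>) (lmax (t + h) b \<omega>) - ?w \<omega>\<bar> \<le> \<bar>F (lmax (t + h) a \<omega>) (lmax (t + h) b \<omega>)\<bar> + \<bar>?w \<omega>\<bar>"
          by (rule abs_triangle_ineq4)
        also have "\<dots> \<le> C + C" unfolding w by (intro add_mono F)
        finally show ?thesis using True by simp
      next
        case False
        then show ?thesis using elim w by simp
      qed
    qed
  qed
  then have "\<bar>mean F (t + h) a b - expectation ?w\<bar> \<le> 2 * C * prob {\<omega> \<in> space M. ?bad \<omega>}"
    unfolding mean_def
  proof (rule abs_diff_expectation_le[rotated 3])
    show "integrable M (\<lambda>\<omega>. F (lmax (t + h) a \<omega>) (lmax (t + h) b \<omega>))"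
      by (rule lmax_pair_integrable[where F = F and C = C, OF F]) (use ab t in simp_all)
    show "integrable M ?w" by (rule w_int)
    show "{\<omega> \<in> space M. ?bad \<omega>} \<in> events" unfolding bad_eq by (intro sets.Un events)
  qed
  also have "\<dots> \<le> 2 * C * (2 * h\<^sup>2 + 2 * h\<^sup>2)"
  proof (intro mult_left_mono)
    have "prob {\<omega> \<in> space M. ?bad \<omega>} \<le> prob {\<omega> \<in> space M. crowded a t (t + h) \<omega>} + prob {\<omega> \<in> space M. crowded b t (t + h) \<omega>}"
      unfolding bad_eq by (intro measure_Un_le events)
    then show "prob {\<omega> \<in> space M. ?bad \<omega>} \<le> 2 * h\<^sup>2 + 2 * h\<^sup>2"
      using prob_crowded[OF ab(1) t(1), of "t + h"] prob_crowded[OF ab(2) t(1), of "t + h"] t by simp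
  qed (use C in simp)
  finally show ?thesis unfolding w by simp
qed

text \<open>
  Expanding \<open>q = h + O(h\<^sup>2)\<close> in the one-step formula leaves the generator of two independent walks
  that step to the right at rate 1.
\<close>

lemma mean_increment:
  fixes F :: "nat \<Rightarrow> nat \<Rightarrow> real"
  assumes F: "\<And>x y. \<bar>F x y\<bar> \<le> C" and ab: "1 \<le> a" "1 \<le> b" "a \<noteq> b" and t: "0 \<le> t" "0 < h"
  shows "\<bar>mean F (t + h) a b - mean F t a b - h * (mean F t (Suc a) b + mean F t a (Suc b) - 2 * mean F t a b)\<bar>
    \<le> 16 * C * h\<^sup>2"
proof -
  define q where "q = 1 - exp (- h)"
  have q: "h - h\<^sup>2 \<le> q" "q \<le> h" "0 \<le> q" using exp_minus_bounds[OF t(2)] by (simp_all add: q_def)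
  have q2: "q\<^sup>2 \<le> h\<^sup>2" using q by (intro power_mono)
  let ?A = "mean F t a b" and ?B = "mean F t (Suc a) b" and ?D = "mean F t a (Suc b)" and ?E = "mean F t (Suc a) (Suc b)"
  have bound: "\<bar>?A\<bar> \<le> C" "\<bar>?B\<bar> \<le> C" "\<bar>?D\<bar> \<le> C" "\<bar>?E\<bar> \<le> C"
    by (rule mean_abs_le[where F = F and C = C, OF F]; use ab t in simp)+
  have C: "0 \<le> C" using order_trans[OF abs_ge_zero bound(1)] .
  let ?X = "mean F (t + h) a b"
  let ?Y = "(1 - q) * (1 - q) * ?A + q * (1 - q) * ?B + (1 - q) * q * ?D + q * q * ?E"
  have step: "\<bar>?X - ?Y\<bar> \<le> 8 * C * h\<^sup>2"
    using mean_one_step[where F = F and C = C, OF F ab t] by (simp only: q_def)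
  have q0: "0 \<le> q\<^sup>2" "0 \<le> h\<^sup>2" by simp_all
  \<comment> \<open>With variables in place of the squares the estimates are linear.\<close>
  have abstract: "\<bar>2 * (h - q) + y\<bar> \<le> 3 * x" "\<bar>q - h - y\<bar> \<le> 2 * x"
    if "h - x \<le> q" "y \<le> x" "0 \<le> y" for x y
    using that q(2) by (simp_all add: abs_le_iff)
  note c1 = abstract(1)[OF q(1) q2 q0(1)] and c2 = abstract(2)[OF q(1) q2 q0(1)]
  have c3: "\<bar>q\<^sup>2\<bar> \<le> h\<^sup>2" using q2 q0 by linarith
  have terms: "\<bar>(2 * (h - q) + q\<^sup>2) * ?A\<bar> \<le> 3 * h\<^sup>2 * C" "\<bar>(q - h - q\<^sup>2) * ?B\<bar> \<le> 2 * h\<^sup>2 * C"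
    "\<bar>(q - h - q\<^sup>2) * ?D\<bar> \<le> 2 * h\<^sup>2 * C" "\<bar>q\<^sup>2 * ?E\<bar> \<le> h\<^sup>2 * C"
    unfolding abs_mult
    using mult_mono[OF c1 bound(1)] mult_mono[OF c2 bound(2)] mult_mono[OF c2 bound(3)] mult_mono[OF c3 bound(4)]
    by simp_all
  have "?X - ?A - h * (?B + ?D - 2 * ?A) =
      (?X - ?Y) + (2 * (h - q) + q\<^sup>2) * ?A + (q - h - q\<^sup>2) * ?B + (q - h - q\<^sup>2) * ?D + q\<^sup>2 * ?E"
    by (simp add: algebra_simps power2_eq_square)
  also have "\<bar>\<dots>\<bar> \<le> 8 * C * h\<^sup>2 + 3 * h\<^sup>2 * C + 2 * h\<^sup>2 * C + 2 * h\<^sup>2 * C + h\<^sup>2 * C"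
    by (intro order_trans[OF abs_triangle_ineq] add_mono step terms)
  also have "\<dots> = 16 * C * h\<^sup>2" by simp
  finally show ?thesis .
qed

lemma mean_Lipschitz:
  fixes F :: "nat \<Rightarrow> nat \<Rightarrow> real"
  assumes F: "\<And>x y. \<bar>F x y\<bar> \<le> C" and ab: "1 \<le> a" "1 \<le> b" "a \<noteq> b" and t: "0 \<le> t" "0 < h"
  shows "\<bar>mean F (t + h) a b - mean F t a b\<bar> \<le> 20 * C * h"
proof (cases "h \<le> 1")
  case True
  let ?g = "mean F t (Suc a) b + mean F t a (Suc b) - 2 * mean F t a b"
  have bound: "\<bar>mean F t a b\<bar> \<le> C" "\<bar>mean F t (Suc a) b\<bar> \<le> C" "\<bar>mean F t a (Suc b)\<bar> \<le> C"
    by (rule mean_abs_le[where F = F and C = C, OF F]; use ab t in simp)+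
  then have "\<bar>?g\<bar> \<le> 4 * C" by linarith
  then have hg: "\<bar>h * ?g\<bar> \<le> h * (4 * C)" using t by (simp add: abs_mult)
  have "C * h\<^sup>2 \<le> C * h"
    using True t bound(1) by (intro mult_left_mono) (auto simp: power2_eq_square mult_left_le)
  then have sq: "16 * C * h\<^sup>2 + h * (4 * C) \<le> 20 * C * h" by simp
  have "\<bar>(mean F (t + h) a b - mean F t a b - h * ?g) + h * ?g\<bar> \<le> 16 * C * h\<^sup>2 + h * (4 * C)"
    by (intro order_trans[OF abs_triangle_ineq] add_mono hg mean_increment[where F = F and C = C, OF F ab t])
  from order_trans[OF this sq] show ?thesis by simp
next
  case False
  have "\<bar>mean F (t + h) a b\<bar> \<le> C" "\<bar>mean F t a b\<bar> \<le> C"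
    by (rule mean_abs_le[where F = F and C = C, OF F]; use ab t in simp)+
  then have "\<bar>mean F (t + h) a b - mean F t a b\<bar> \<le> 20 * C * 1" by linarith
  also have "\<dots> \<le> 20 * C * h"
    using False \<open>\<bar>mean F t a b\<bar> \<le> C\<close> by (intro mult_left_mono) auto
  finally show ?thesis .
qed

end

section \<open>The label at position 1 and the ascent probability\<close>

text \<open>
  The \<open>n\<close>-th power of the operator that lets one of two walks make a step and kills the pair once
  the walks are equal.
\<close>

primrec two_walks :: "nat \<Rightarrow> (nat \<Rightarrow> nat \<Rightarrow> real) \<Rightarrow> nat \<Rightarrow> nat \<Rightarrow> real" where
  "two_walks 0 g a b = g a b"
| "two_walks (Suc n) g a b = (if a < b then two_walks n g (Suc a) b + two_walks n g a (Suc b) else 0)"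

lemma two_walks_abs_le:
  assumes g: "\<And>a b. 1 \<le> a \<Longrightarrow> a \<le> b \<Longrightarrow> \<bar>g a b\<bar> \<le> B" and "1 \<le> a" "a \<le> b"
  shows "\<bar>two_walks n g a b\<bar> \<le> 2 ^ n * B"
  using assms(2,3)
proof (induction n arbitrary: a b)
  case 0
  then show ?case using g by simp
next
  case (Suc n)
  have B: "0 \<le> B" using order_trans[OF abs_ge_zero g[of 1 1]] by simp
  show ?case
  proof (cases "a < b")
    case True
    have "\<bar>two_walks n g (Suc a) b\<bar> \<le> 2 ^ n * B" "\<bar>two_walks n g a (Suc b)\<bar> \<le> 2 ^ n * B"
      using True Suc.prems by (auto intro!: Suc.IH)
    then show ?thesis using True by simp
  qed (use B in simp)
qed

text \<open>
  If differentiation acts on \<open>f\<close> as \<open>two_walks 1\<close>, then the \<open>n\<close>-th derivative of \<open>f\<close> is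
  \<open>two_walks n\<close>; this is the induction step.
\<close>

lemma two_walks_has_derivative:
  assumes f: "\<And>a b. 1 \<le> a \<Longrightarrow> a \<le> b \<Longrightarrow>
      ((\<lambda>x. f x a b) has_real_derivative two_walks 1 (f t) a b) (at t within S)"
    and "1 \<le> a" "a \<le> b"
  shows "((\<lambda>x. two_walks n (f x) a b) has_real_derivative two_walks (Suc n) (f t) a b) (at t within S)"
  using assms(2,3)
proof (induction n arbitrary: a b)
  case 0
  then show ?case using f[of a b] by simp
next
  case (Suc n)
  show ?case
  proof (cases "a < b")
    case True
    have "((\<lambda>x. two_walks n (f x) (Suc a) b + two_walks n (f x) a (Suc b)) has_real_derivative
        two_walks (Suc n) (f t) (Suc a) b + two_walks (Suc n) (f t) a (Suc b)) (at t within S)"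
      using True Suc.prems by (intro DERIV_add Suc.IH) auto
    then show ?thesis using True by (simp only: two_walks.simps(2) if_True)
  qed simp
qed

text \<open>The number of simple random walk paths with \<open>n\<close> steps that start at \<open>d\<close> and never visit \<open>0\<close>.\<close>

fun ballot :: "nat \<Rightarrow> nat \<Rightarrow> nat" where
  "ballot 0 d = (if d = 0 then 0 else 1)"
| "ballot (Suc n) d = (if d = 0 then 0 else ballot n (d - 1) + ballot n (Suc d))"

lemma two_walks_of_bool: "a \<le> b \<Longrightarrow> two_walks n (\<lambda>a b. of_bool (a < b)) a b = real (ballot n (b - a))"
proof (induction n arbitrary: a b)
  case (Suc n)
  show ?case
  proof (cases "a < b")
    case True
    then show ?thesis using Suc.IH[of "Suc a" b] Suc.IH[of a "Suc b"] by (simp add: Suc_diff_le)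
  qed (use Suc.prems in simp)
qed simp

text \<open>
  An integer bound lets Pascal's rule hold without side conditions; nonpositive bounds give the
  empty sum.
\<close>

definition binomial_prefix :: "nat \<Rightarrow> int \<Rightarrow> int" where
  "binomial_prefix n x = (\<Sum>j<nat x. int (n choose j))"

lemma binomial_prefix_Suc: "binomial_prefix (Suc n) x = binomial_prefix n x + binomial_prefix n (x - 1)"
proof (cases "0 < x")
  case True
  then obtain m where m: "nat x = Suc m" "nat (x - 1) = m" by (cases "nat x") (auto simp: nat_diff_distrib)
  have "(\<Sum>j<Suc m. int (Suc n choose j)) = (\<Sum>j<Suc m. int (n choose j)) + (\<Sum>j<m. int (n choose j))"
    unfolding sum.lessThan_Suc_shift by (simp add: sum.distrib)
  then show ?thesis by (simp only: binomial_prefix_def m)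
next
  case False
  then show ?thesis by (simp add: binomial_prefix_def)
qed

text \<open>
  The reflection principle: the paths from \<open>d\<close> that avoid \<open>0\<close> are as many as the paths whose total
  displacement lies in \<open>(- d, d]\<close>. The right hand side counts the latter, and it satisfies the
  recursion and the boundary condition of \<open>ballot\<close>.
\<close>

lemma ballot_eq: "int (ballot n d) =
  binomial_prefix n ((int n + int d + 1) div 2) - binomial_prefix n ((int n - int d + 1) div 2)"
proof (induction n arbitrary: d)
  case 0
  have "binomial_prefix 0 x = of_bool (0 < x)" for x
  proof (cases "nat x")
    case (Suc m)
    have "(\<Sum>j<Suc m. int (0 choose j)) = 1" by (induction m) simp_all
    then show ?thesis using Suc by (simp only: binomial_prefix_def) simp
  qed (simp add: binomial_prefix_def)
  then show ?case by auto
next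
  case (Suc n)
  show ?case
  proof (cases d)
    case (Suc e)
    let ?u = "(int n + int e + 3) div 2" and ?v = "(int n - int e + 1) div 2"
    have args: "(int (Suc n) + int d + 1) div 2 = ?u" "(int (Suc n) - int d + 1) div 2 = ?v"
      "(int n + int e + 1) div 2 = ?u - 1" "(int n - int (Suc d) + 1) div 2 = ?v - 1"
      "(int n + int (Suc d) + 1) div 2 = ?u"
      unfolding Suc of_nat_Suc by presburger+
    have "int (ballot (Suc n) d) = int (ballot n e) + int (ballot n (Suc d))" using Suc by simp
    then show ?thesis unfolding Suc.IH args binomial_prefix_Suc by simp
  qed simp
qed

lemma ballot_1: "ballot n 1 = n choose (n div 2)"
proof -
  have "(int n + int 1 + 1) div 2 = int (Suc (n div 2))" "(int n - int 1 + 1) div 2 = int (n div 2)" by presburger+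
  then have "int (ballot n 1) = int (n choose (n div 2))"
    unfolding ballot_eq by (simp only:) (simp add: binomial_prefix_def nat_add_distrib)
  then show ?thesis by simp
qed

context poisson_family
begin

lemma mean_Lipschitz_any:
  fixes F :: "nat \<Rightarrow> nat \<Rightarrow> real"
  assumes F: "\<And>x y. \<bar>F x y\<bar> \<le> C" and ab: "1 \<le> a" "1 \<le> b" and t: "0 \<le> t" "0 < h"
  shows "\<bar>mean F (t + h) a b - mean F t a b\<bar> \<le> 20 * C * h"
proof (cases "a = b")
  case True
  have "mean F s a b = mean (\<lambda>x y. F x x) s a (Suc a)" for s
    using True by (simp add: mean_def)
  then show ?thesis
    using mean_Lipschitz[where F = "\<lambda>x y. F x x" and C = C and a = a and b = "Suc a" and t = t and h = h] F ab t
    by simp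
next
  case False
  then show ?thesis using mean_Lipschitz[where F = F and C = C, OF F ab False t] by simp
qed

text \<open>At \<open>t = 0\<close> only the one-sided derivative makes sense; it is enough for Taylor's formula on \<open>{0..}\<close>.\<close>

lemma mean_has_derivative:
  fixes F :: "nat \<Rightarrow> nat \<Rightarrow> real"
  assumes F: "\<And>x y. \<bar>F x y\<bar> \<le> C" and ab: "1 \<le> a" "1 \<le> b" "a \<noteq> b" and t: "0 \<le> t"
  shows "((\<lambda>s. mean F s a b) has_real_derivative (mean F t (Suc a) b + mean F t a (Suc b) - 2 * mean F t a b))
    (at t within {0..})"
proof (rule has_real_derivative_of_increment_bound[where K = "16 * C" and L = "80 * C"])
  fix s h :: real assume s: "0 \<le> s" "0 < h"
  show "\<bar>mean F (s + h) a b - mean F s a b - h * (mean F s (Suc a) b + mean F s a (Suc b) - 2 * mean F s a b)\<bar>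
      \<le> 16 * C * h\<^sup>2"
    by (rule mean_increment[where F = F and C = C, OF F ab s])
  have "\<bar>mean F (s + h) (Suc a) b - mean F s (Suc a) b\<bar> \<le> 20 * C * h"
    "\<bar>mean F (s + h) a (Suc b) - mean F s a (Suc b)\<bar> \<le> 20 * C * h"
    "\<bar>mean F (s + h) a b - mean F s a b\<bar> \<le> 20 * C * h"
    by (rule mean_Lipschitz_any[where F = F and C = C, OF F _ _ s]; use ab in simp)+
  then show "\<bar>mean F (s + h) (Suc a) b + mean F (s + h) a (Suc b) - 2 * mean F (s + h) a b -
      (mean F s (Suc a) b + mean F s a (Suc b) - 2 * mean F s a b)\<bar> \<le> 80 * C * h"
    unfolding abs_le_iff by linarith
qed (rule t)

lemma AE_lmax_0: "1 \<le> a \<Longrightarrow> AE \<omega> in M. lmax 0 a \<omega> = a"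
  using AE_harris by eventually_elim (simp add: lmax_def harris.label_max_0)

lemma AE_lmax_mono: "1 \<le> a \<Longrightarrow> 0 \<le> s \<Longrightarrow> s \<le> t \<Longrightarrow> AE \<omega> in M. lmax s a \<omega> \<le> lmax t a \<omega>"
  using AE_harris by eventually_elim (simp add: lmax_def harris.label_max_mono)

lemma AE_lmax_ge: "1 \<le> a \<Longrightarrow> 0 \<le> t \<Longrightarrow> AE \<omega> in M. a \<le> lmax t a \<omega>"
  using AE_harris by eventually_elim (simp add: lmax_def harris.label_max_ge)

lemma mean_0: "1 \<le> a \<Longrightarrow> 1 \<le> b \<Longrightarrow> mean F 0 a b = F a b"
proof -
  assume ab: "1 \<le> a" "1 \<le> b"
  have "mean F 0 a b = expectation (\<lambda>_. F a b)"
    unfolding mean_def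
  proof (rule integral_cong_AE)
    show "AE \<omega> in M. F (lmax 0 a \<omega>) (lmax 0 b \<omega>) = F a b"
      using AE_lmax_0[OF ab(1)] AE_lmax_0[OF ab(2)] by eventually_elim simp
  qed (use ab in simp_all)
  then show ?thesis by (simp add: prob_space)
qed

text \<open>
  For \<open>F = \<lbrakk>x = j + 1\<rbrakk>\<close> the second walk drops out, and \<open>exp t * P(M\<^sub>a = j + 1)\<close> has the derivative
  \<open>exp t * P(M\<^sub>a\<^sub>+\<^sub>1 = j + 1)\<close>. The chain of derivatives ends in \<open>0\<close> because \<open>M\<^sub>a \<ge> a\<close>, so Taylor's
  formula has no remainder; at time \<open>0\<close> only the term of order \<open>j\<close> is nonzero.
\<close>

lemma prob_lmax_1:
  assumes t: "0 \<le> t"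
  shows "prob {\<omega> \<in> space M. lmax t 1 \<omega> = Suc j} = exp (- t) * (t ^ j / fact j)"
proof -
  define F :: "nat \<Rightarrow> nat \<Rightarrow> real" where "F x y = of_bool (x = Suc j)" for x y
  have F: "\<bar>F x y\<bar> \<le> 1" for x y by (simp add: F_def)
  define P where "P s a = mean F s a (Suc a)" for s a
  have P_any: "mean F s a b = P s a" for s a b by (simp add: P_def mean_def F_def)
  have deriv: "((\<lambda>s. exp s * P s a) has_real_derivative exp s * P s (Suc a)) (at s within {0..})"
    if "1 \<le> a" "0 \<le> s" for a s
  proof -
    have "((\<lambda>s. P s a) has_real_derivative P s (Suc a) + P s a - 2 * P s a) (at s within {0..})"
      using mean_has_derivative[where F = F and C = 1, OF F, of a "Suc a" s] that by (simp only: P_any)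
    from DERIV_mult'[OF has_field_derivative_at_within[OF DERIV_exp] this]
    show ?thesis by (simp add: algebra_simps)
  qed
  have zero: "P s a = 0" if "Suc j < a" "0 \<le> s" for s a
  proof -
    have "1 \<le> a" using that by simp
    have "P s a = expectation (\<lambda>_. 0)"
      unfolding P_def mean_def
    proof (rule integral_cong_AE)
      show "AE \<omega> in M. F (lmax s a \<omega>) (lmax s (Suc a) \<omega>) = 0"
        using AE_lmax_ge[OF \<open>1 \<le> a\<close> that(2)] by eventually_elim (use that in \<open>simp add: F_def\<close>)
    qed (use that \<open>1 \<le> a\<close> in simp_all)
    then show ?thesis by simp
  qed
  have "norm (exp t * P t (1 + 0) - (\<Sum>i\<le>Suc j. exp 0 * P 0 (1 + i) * (t - 0) ^ i / fact i)) \<le>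
      0 * norm (t - 0) ^ Suc (Suc j) / fact (Suc j)"
  proof (rule field_Taylor[where S = "{0..}" and f = "\<lambda>i s. exp s * P s (1 + i)"])
    show "((\<lambda>s. exp s * P s (1 + i)) has_field_derivative exp x * P x (1 + Suc i)) (at x within {0..})"
      if "x \<in> {0..}" for i x
      using deriv[of "1 + i" x] that by simp
    show "norm (exp x * P x (1 + Suc (Suc j))) \<le> 0" if "x \<in> {0..}" for x
      using zero[of "1 + Suc (Suc j)" x] that by simp
  qed (use t in simp_all)
  then have "exp t * P t 1 = (\<Sum>i\<le>Suc j. P 0 (1 + i) * t ^ i / fact i)" by simp
  also have "\<dots> = (\<Sum>i\<le>Suc j. if i = j then t ^ i / fact i else 0)"
    by (intro sum.cong) (simp_all add: P_def mean_0 F_def)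
  also have "\<dots> = t ^ j / fact j" by simp
  finally have "P t 1 = exp (- t) * (t ^ j / fact j)" by (simp add: exp_minus field_simps)
  moreover have "P t 1 = prob {\<omega> \<in> space M. lmax t 1 \<omega> = Suc j}"
    unfolding P_def mean_def F_def using lmax_measurable[of t 1] t by (intro expectation_of_bool) auto
  ultimately show ?thesis by simp
qed

lemma
  assumes t: "0 \<le> t"
  shows integrable_lmax_1: "integrable M (\<lambda>\<omega>. real (lmax t 1 \<omega>))"
    and expectation_lmax_1: "expectation (\<lambda>\<omega>. real (lmax t 1 \<omega>)) = 1 + t"
proof -
  have "(\<lambda>j. exp (- t) * ((real j + 1) * (t ^ j / fact j))) sums (exp (- t) * ((1 + t) * exp t))"
    by (intro sums_mult poisson_mean_sums)
  moreover have "exp (- t) * ((1 + t) * exp t) = 1 + t" by (simp add: exp_minus field_simps)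
  moreover have "exp (- t) * ((real j + 1) * (t ^ j / fact j)) =
      real (Suc j) * prob {\<omega> \<in> space M. lmax t 1 \<omega> = Suc j}" for j
    unfolding prob_lmax_1[OF t] by simp
  ultimately have "(\<lambda>j. real (Suc j) * prob {\<omega> \<in> space M. lmax t 1 \<omega> = Suc j}) sums (1 + t)"
    by (simp only:)
  then have "(\<lambda>k. real k * prob {\<omega> \<in> space M. lmax t 1 \<omega> = k}) sums (1 + t)"
    by (subst (asm) sums_Suc_iff) simp
  then show "integrable M (\<lambda>\<omega>. real (lmax t 1 \<omega>))" "expectation (\<lambda>\<omega>. real (lmax t 1 \<omega>)) = 1 + t"
    using nat_expectation_sums lmax_measurable[OF t] by auto
qed

text \<open>
  The probability that the labels at positions 1 and 2 are in increasing order, which is the rate at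
  which the label at position 1 jumps.
\<close>

definition ascent_prob :: "real \<Rightarrow> real" where
  "ascent_prob t = mean (\<lambda>x y. of_bool (x < y)) t 1 2"

text \<open>
  The factor \<open>exp (2 * t)\<close> removes the diagonal term of the generator. The derivatives that remain
  are sums over pairs of walks, so at time \<open>0\<close> they count the paths by which the walks from 1 and 2
  avoid each other.
\<close>

lemma ascent_prob_sums:
  assumes t: "0 \<le> t"
  shows "(\<lambda>n. real (n choose (n div 2)) * t ^ n / fact n) sums (exp (2 * t) * ascent_prob t)"
proof -
  define F :: "nat \<Rightarrow> nat \<Rightarrow> real" where "F x y = of_bool (x < y)" for x y
  have F: "\<bar>F x y\<bar> \<le> 1" for x y by (simp add: F_def)
  define f where "f s a b = exp (2 * s) * mean F s a b" for s a b
  have diag: "mean F s a a = 0" for s a by (simp add: mean_def F_def)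
  have f_deriv: "((\<lambda>s. f s a b) has_real_derivative two_walks 1 (f s) a b) (at s within {0..t})"
    if "1 \<le> a" "a \<le> b" "0 \<le> s" for s a b
  proof (cases "a = b")
    case True
    then show ?thesis by (simp add: f_def diag)
  next
    case False
    have "((\<lambda>s. mean F s a b) has_real_derivative (mean F s (Suc a) b + mean F s a (Suc b) - 2 * mean F s a b))
        (at s within {0..t})"
      by (rule has_field_derivative_subset[OF mean_has_derivative[where F = F and C = 1, OF F]]) (use that False in auto)
    then have "((\<lambda>s. exp (2 * s) * mean F s a b) has_real_derivative
        exp (2 * s) * (mean F s (Suc a) b + mean F s a (Suc b) - 2 * mean F s a b) + (exp (2 * s) * 2) * mean F s a b)
        (at s within {0..t})"
      by (intro DERIV_mult') (auto intro!: derivative_eq_intros)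
    then show ?thesis using False that by (simp add: f_def algebra_simps)
  qed
  have f_bound: "\<bar>f s a b\<bar> \<le> exp (2 * t)" if "s \<in> {0..t}" "1 \<le> a" "a \<le> b" for s a b
  proof -
    have "\<bar>mean F s a b\<bar> \<le> 1" by (rule mean_abs_le[where F = F and C = 1, OF F]) (use that in auto)
    then have "exp (2 * s) * \<bar>mean F s a b\<bar> \<le> exp (2 * t) * 1" using that by (intro mult_mono) auto
    then show ?thesis by (simp add: f_def abs_mult)
  qed
  \<comment> \<open>At time \<open>0\<close> the walks are at their starting points, and \<open>F\<close> is the indicator of survival.\<close>
  have start: "two_walks i (f 0) 1 2 = real (i choose (i div 2))" for i
  proof -
    have "two_walks i (f 0) a b = two_walks i F a b" if "1 \<le> a" "1 \<le> b" for a b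
      using that by (induction i arbitrary: a b) (simp_all add: f_def mean_0)
    then show ?thesis
      using two_walks_of_bool[of 1 2 i] ballot_1[of i] by (simp add: F_def[abs_def])
  qed
  have taylor: "\<bar>f t 1 2 - (\<Sum>i\<le>n. real (i choose (i div 2)) * t ^ i / fact i)\<bar> \<le>
      2 * t * exp (2 * t) * ((2 * t) ^ n / fact n)" for n
  proof -
    have "norm (two_walks 0 (f t) 1 2 - (\<Sum>i\<le>n. two_walks i (f 0) 1 2 * (t - 0) ^ i / fact i)) \<le>
        (2 ^ Suc n * exp (2 * t)) * norm (t - 0) ^ Suc n / fact n"
    proof (rule field_Taylor[where S = "{0..t}" and f = "\<lambda>i s. two_walks i (f s) 1 2"])
      show "((\<lambda>s. two_walks i (f s) 1 2) has_field_derivative two_walks (Suc i) (f x) 1 2) (at x within {0..t})"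
        if "x \<in> {0..t}" for i x
        using f_deriv that by (intro two_walks_has_derivative) auto
      show "norm (two_walks (Suc n) (f x) 1 2) \<le> 2 ^ Suc n * exp (2 * t)" if "x \<in> {0..t}" for x
        unfolding real_norm_def using f_bound[OF that] by (intro two_walks_abs_le) auto
    qed (use t in simp_all)
    then show ?thesis using t unfolding start by (simp add: power_mult_distrib mult_ac)
  qed
  have "(\<lambda>n. (2 * t) ^ n / fact n) \<longlonglongrightarrow> 0"
    using summable_LIMSEQ_zero[OF sums_summable[OF exp_converges[of "2 * t"]]]
    by (simp add: divide_inverse mult.commute)
  then have "(\<lambda>n. 2 * t * exp (2 * t) * ((2 * t) ^ n / fact n)) \<longlonglongrightarrow> 0"
    by (rule tendsto_mult_right_zero)
  then have "(\<lambda>n. f t 1 2 - (\<Sum>i\<le>n. real (i choose (i div 2)) * t ^ i / fact i)) \<longlonglongrightarrow> 0"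
    by (rule Lim_null_comparison[rotated]) (intro always_eventually allI, simp only: real_norm_def taylor)
  from tendsto_diff[OF tendsto_const[of "f t 1 2"] this]
  have "(\<lambda>n. \<Sum>i\<le>n. real (i choose (i div 2)) * t ^ i / fact i) \<longlonglongrightarrow> f t 1 2" by simp
  then show ?thesis
    unfolding sums_def_le f_def ascent_prob_def F_def .
qed

end

section \<open>Asymptotics of the ascent probability\<close>

lemma tendsto_even_odd:
  fixes f :: "nat \<Rightarrow> 'a::topological_space"
  assumes "(\<lambda>n. f (2 * n)) \<longlonglongrightarrow> l" "(\<lambda>n. f (2 * n + 1)) \<longlonglongrightarrow> l"
  shows "f \<longlonglongrightarrow> l"
proof (rule topological_tendstoI)
  fix S assume S: "open S" "l \<in> S"
  obtain m m' where m: "\<And>n. n \<ge> m \<Longrightarrow> f (2 * n) \<in> S" "\<And>n. n \<ge> m' \<Longrightarrow> f (2 * n + 1) \<in> S"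
    using topological_tendstoD[OF assms(1) S] topological_tendstoD[OF assms(2) S]
    unfolding eventually_sequentially by blast
  have "f n \<in> S" if "n \<ge> 2 * m + 2 * m' + 1" for n
  proof (cases "even n")
    case True
    then obtain k where "n = 2 * k" by (elim evenE)
    then show ?thesis using m(1)[of k] that by simp
  next
    case False
    then obtain k where "n = 2 * k + 1" by (elim oddE)
    then show ?thesis using m(2)[of k] that by simp
  qed
  then show "\<forall>\<^sub>F n in sequentially. f n \<in> S" unfolding eventually_sequentially by blast
qed

text \<open>The largest weight of the binomial distribution with parameters \<open>n\<close> and 1/2.\<close>

definition middle_prob :: "nat \<Rightarrow> real" where
  "middle_prob n = real (n choose (n div 2)) / 2 ^ n"

lemma middle_prob_nonneg: "0 \<le> middle_prob n"
  by (simp add: middle_prob_def)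

lemma middle_prob_odd: "middle_prob (2 * n + 1) = middle_prob (2 * n + 2)"
proof -
  have "(2 * n + 2) choose (n + 1) = 2 * ((2 * n + 1) choose n)"
    using binomial_symmetric[of n "2 * n + 1"] by (simp add: mult_2)
  then show ?thesis by (simp add: middle_prob_def)
qed

lemma middle_prob_even_step: "middle_prob (2 * n + 2) = middle_prob (2 * n) * (2 * real n + 1) / (2 * real n + 2)"
proof -
  have "Suc n * (Suc (2 * n) choose Suc n) = Suc (2 * n) * (2 * n choose n)"
    using Suc_times_binomial_eq[of "2 * n" n] by (metis mult.commute)
  then have "real (Suc n) * real (Suc (2 * n) choose Suc n) = real (Suc (2 * n)) * real (2 * n choose n)"
    by (simp only: flip: of_nat_mult)
  then have B: "real (Suc (2 * n) choose Suc n) = (2 * real n + 1) * real (2 * n choose n) / (real n + 1)"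
    by (simp add: eq_divide_eq mult.commute add.commute del: binomial_Suc_Suc)
  have "(2 * n + 2) choose (n + 1) = 2 * (Suc (2 * n) choose Suc n)"
    using binomial_symmetric[of n "2 * n + 1"] by (simp add: mult_2)
  moreover have "(2 * n + 2) div 2 = n + 1" "2 * n div 2 = n" by simp_all
  ultimately have "middle_prob (2 * n + 2) = real (2 * (Suc (2 * n) choose Suc n)) / 2 ^ (2 * n + 2)"
    "middle_prob (2 * n) = real (2 * n choose n) / 2 ^ (2 * n)"
    by (simp_all only: middle_prob_def)
  then show ?thesis
    by (simp only: of_nat_mult B) (simp add: divide_simps)
qed

text \<open>
  The partial products of Wallis' formula are, up to the factor \<open>2 n + 1\<close>, the inverse squares of the
  central binomial probabilities.
\<close>

lemma middle_prob_wallis: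
  "(middle_prob (2 * n))\<^sup>2 * (2 * real n + 1) * (\<Prod>k=1..n. (4 * real k ^ 2) / (4 * real k ^ 2 - 1)) = 1"
proof (induction n)
  case 0
  then show ?case by (simp add: middle_prob_def)
next
  case (Suc n)
  let ?W = "\<Prod>k=1..n. (4 * real k ^ 2) / (4 * real k ^ 2 - 1)"
  define x where "x = 2 * real n + 1"
  have x: "x > 0" by (simp add: x_def)
  have wallis_factor: "4 * real (Suc n) ^ 2 = (x + 1)\<^sup>2" "(x + 1)\<^sup>2 - 1 = x * (x + 2)"
      "2 * real (Suc n) + 1 = x + 2"
    by (simp_all add: x_def power2_eq_square algebra_simps)
  have "middle_prob (2 * Suc n) = middle_prob (2 * n) * x / (x + 1)"
    using middle_prob_even_step[of n] by (simp add: x_def add.assoc)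
  moreover have "(\<Prod>k=1..Suc n. (4 * real k ^ 2) / (4 * real k ^ 2 - 1)) =
      ?W * ((4 * real (Suc n) ^ 2) / (4 * real (Suc n) ^ 2 - 1))" by simp
  ultimately have "(middle_prob (2 * Suc n))\<^sup>2 * (2 * real (Suc n) + 1) *
      (\<Prod>k=1..Suc n. (4 * real k ^ 2) / (4 * real k ^ 2 - 1)) =
      (middle_prob (2 * n) * x / (x + 1))\<^sup>2 * (x + 2) * (?W * ((x + 1)\<^sup>2 / (x * (x + 2))))"
    by (simp only: wallis_factor)
  also have "\<dots> = (middle_prob (2 * n))\<^sup>2 * x * ?W"
  proof -
    have "(y * x / (x + 1))\<^sup>2 * (x + 2) * (w * ((x + 1)\<^sup>2 / (x * (x + 2)))) = y\<^sup>2 * x * w" for y w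
      using x by (simp add: power2_eq_square)
    then show ?thesis .
  qed
  also have "\<dots> = 1" using Suc.IH by (simp add: x_def)
  finally show ?case .
qed

lemma middle_prob_asymptotics: "(\<lambda>n. middle_prob n * sqrt (real n + 1)) \<longlonglongrightarrow> sqrt (2 / pi)"
proof -
  let ?W = "\<lambda>n. \<Prod>k=1..n. (4 * real k ^ 2) / (4 * real k ^ 2 - 1)"
  have even_sq: "(middle_prob (2 * n))\<^sup>2 * (2 * real n + 1) = inverse (?W n)" for n
    by (rule inverse_unique[symmetric], subst mult.commute, rule middle_prob_wallis)
  have "(\<lambda>n. inverse (?W n)) \<longlonglongrightarrow> inverse (pi / 2)"
    by (intro tendsto_inverse wallis) simp
  then have even: "(\<lambda>n. (middle_prob (2 * n))\<^sup>2 * (2 * real n + 1)) \<longlonglongrightarrow> 2 / pi"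
    by (simp add: even_sq)
  have "(\<lambda>n. (middle_prob (2 * n + 1))\<^sup>2 * (2 * real n + 2)) \<longlonglongrightarrow> 2 / pi * 1"
  proof -
    have "(middle_prob (2 * n + 1))\<^sup>2 * (2 * real n + 2) =
        (middle_prob (2 * Suc n))\<^sup>2 * (2 * real (Suc n) + 1) * ((2 * real n + 2) / (2 * real n + 3))" for n
    proof -
      have "2 * Suc n = 2 * n + 2" "2 * real (Suc n) + 1 = 2 * real n + 3" by simp_all
      then show ?thesis by (simp only: middle_prob_odd) (simp add: divide_simps)
    qed
    moreover have "(\<lambda>n. (2 * real n + 2) / (2 * real n + 3)) \<longlonglongrightarrow> 1"
    proof -
      have "(\<lambda>n. 1 - inverse (2 * real n + 3)) \<longlonglongrightarrow> 1 - 0"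
      proof (intro tendsto_diff tendsto_const Lim_null_comparison[OF always_eventually LIMSEQ_inverse_real_of_nat] allI)
        show "norm (inverse (2 * real n + 3)) \<le> inverse (real (Suc n))" for n
          by (simp add: le_imp_inverse_le)
      qed
      moreover have "1 - inverse (2 * real n + 3) = (2 * real n + 2) / (2 * real n + 3)" for n
        by (simp add: divide_simps)
      ultimately show ?thesis by simp
    qed
    ultimately show ?thesis
      using tendsto_mult[OF LIMSEQ_Suc[OF even]] by (simp only:)
  qed
  then have odd: "(\<lambda>n. (middle_prob (2 * n + 1))\<^sup>2 * (2 * real n + 2)) \<longlonglongrightarrow> 2 / pi" by simp
  have "(\<lambda>n. (middle_prob n)\<^sup>2 * (real n + 1)) \<longlonglongrightarrow> 2 / pi"
  proof (rule tendsto_even_odd)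
    show "(\<lambda>n. (middle_prob (2 * n))\<^sup>2 * (real (2 * n) + 1)) \<longlonglongrightarrow> 2 / pi" using even by simp
    have "real (2 * n + 1) + 1 = 2 * real n + 2" for n by simp
    then show "(\<lambda>n. (middle_prob (2 * n + 1))\<^sup>2 * (real (2 * n + 1) + 1)) \<longlonglongrightarrow> 2 / pi"
      using odd by (simp only:)
  qed
  then have "(\<lambda>n. sqrt ((middle_prob n)\<^sup>2 * (real n + 1))) \<longlonglongrightarrow> sqrt (2 / pi)"
    by (rule tendsto_real_sqrt)
  then show ?thesis by (simp add: real_sqrt_mult middle_prob_nonneg)
qed

definition poisson_weight :: "real \<Rightarrow> nat \<Rightarrow> real" where
  "poisson_weight l n = exp (- l) * (l ^ n / fact n)"

lemma poisson_weight_nonneg: "0 \<le> l \<Longrightarrow> 0 \<le> poisson_weight l n"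
  by (simp add: poisson_weight_def)

lemma poisson_weight_sums: "poisson_weight l sums 1"
proof -
  have "(\<lambda>n. exp (- l) * (l ^ n / fact n)) sums (exp (- l) * exp l)"
    using exp_converges[of l] by (intro sums_mult) (simp add: divide_inverse mult.commute)
  then show ?thesis by (simp add: poisson_weight_def[abs_def] exp_minus)
qed

lemma poisson_weight_summable:
  assumes "0 \<le> l" "\<And>n. \<bar>b n\<bar> \<le> B"
  shows "summable (\<lambda>n. poisson_weight l n * b n)"
proof (rule summable_comparison_test')
  show "summable (\<lambda>n. poisson_weight l n * B)"
    using poisson_weight_sums by (intro summable_mult2) (rule sums_summable)
  show "norm (poisson_weight l n * b n) \<le> poisson_weight l n * B" if "n \<ge> 0" for n
    using assms by (simp add: abs_mult poisson_weight_nonneg mult_left_mono)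
qed

lemma poisson_weight_mean: "(\<lambda>n. poisson_weight l n * (real n + 1)) sums (l + 1)"
proof -
  have "(\<lambda>n. exp (- l) * ((real n + 1) * (l ^ n / fact n))) sums (exp (- l) * ((1 + l) * exp l))"
    by (intro sums_mult poisson_mean_sums)
  moreover have "exp (- l) * ((1 + l) * exp l) = l + 1" by (simp add: exp_minus field_simps)
  ultimately show ?thesis by (simp add: poisson_weight_def mult_ac)
qed

lemma poisson_weight_inverse: "0 < l \<Longrightarrow> (\<lambda>n. poisson_weight l n / (real n + 1)) sums ((1 - exp (- l)) / l)"
proof -
  assume l: "0 < l"
  have "(\<lambda>n. poisson_weight l (Suc n)) sums (1 - poisson_weight l 0)"
    using poisson_weight_sums by (simp add: sums_Suc_iff)
  then have "(\<lambda>n. poisson_weight l (Suc n) / l) sums ((1 - poisson_weight l 0) / l)"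
    by (rule sums_divide)
  moreover have "poisson_weight l (Suc n) / l = poisson_weight l n / (real n + 1)" for n
    using l by (simp add: poisson_weight_def mult.commute add.commute)
  ultimately show ?thesis by (simp add: poisson_weight_def)
qed

definition mean_inverse_sqrt :: "real \<Rightarrow> real" where
  "mean_inverse_sqrt l = (\<Sum>n. poisson_weight l n * (1 / sqrt (real n + 1)))"

lemma mean_inverse_sqrt_sums:
  "0 \<le> l \<Longrightarrow> (\<lambda>n. poisson_weight l n * (1 / sqrt (real n + 1))) sums mean_inverse_sqrt l"
  unfolding mean_inverse_sqrt_def by (intro summable_sums poisson_weight_summable[of _ _ 1]) auto

text \<open>
  The inequality of the arithmetic and geometric mean bounds $1/\sqrt{x}$ by a combination of \<open>1 / x\<close>
  and a constant. The Poisson mean of \<open>1 / (n + 1)\<close> is explicit and at most \<open>1 / l\<close>.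
\<close>

lemma mean_inverse_sqrt_le:
  assumes l: "0 < l"
  shows "mean_inverse_sqrt l \<le> 1 / sqrt l"
proof -
  have am_gm: "1 / sqrt x \<le> (sqrt l / x + 1 / sqrt l) / 2" if "0 < x" for x
  proof -
    define u v where "u = sqrt x" and "v = sqrt l"
    have uv: "0 < u" "0 < v" "x = u\<^sup>2" using that l by (simp_all add: u_def v_def)
    have "(v / u\<^sup>2 + 1 / v) / 2 - 1 / u = (v - u)\<^sup>2 / (2 * u\<^sup>2 * v)"
      using uv by (simp add: field_simps power2_eq_square)
    moreover have "0 \<le> (v - u)\<^sup>2 / (2 * u\<^sup>2 * v)" using uv by simp
    ultimately have "1 / u \<le> (v / u\<^sup>2 + 1 / v) / 2" by linarith
    then show ?thesis by (simp only: uv(3)[symmetric] u_def[symmetric] v_def[symmetric])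
  qed
  have le: "poisson_weight l n * (1 / sqrt (real n + 1)) \<le>
      (sqrt l / 2) * (poisson_weight l n / (real n + 1)) + 1 / (2 * sqrt l) * poisson_weight l n" for n
  proof -
    have "poisson_weight l n * (1 / sqrt (real n + 1)) \<le>
        poisson_weight l n * ((sqrt l / (real n + 1) + 1 / sqrt l) / 2)"
      using l by (intro mult_left_mono am_gm poisson_weight_nonneg) auto
    then show ?thesis by (simp add: algebra_simps add_divide_distrib)
  qed
  have "(\<lambda>n. (sqrt l / 2) * (poisson_weight l n / (real n + 1)) + 1 / (2 * sqrt l) * poisson_weight l n) sums
      ((sqrt l / 2) * ((1 - exp (- l)) / l) + 1 / (2 * sqrt l) * 1)"
    by (intro sums_add sums_mult poisson_weight_inverse poisson_weight_sums l)
  from sums_le[OF le mean_inverse_sqrt_sums[OF less_imp_le[OF l]] this]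
  have "mean_inverse_sqrt l \<le> (sqrt l / 2) * ((1 - exp (- l)) / l) + 1 / (2 * sqrt l) * 1" .
  also have "\<dots> \<le> (sqrt l / 2) * (1 / l) + 1 / (2 * sqrt l) * 1"
    using l by (intro add_right_mono mult_left_mono divide_right_mono) auto
  also have "\<dots> = 1 / sqrt l"
  proof -
    have "sqrt l / l = 1 / sqrt l" using l sqrt_divide_self_eq[of l] by (simp add: inverse_eq_divide)
    then show ?thesis by (simp add: field_simps)
  qed
  finally show ?thesis .
qed

text \<open>
  Jensen's inequality for the convex function $1/\sqrt{x}$ at the mean \<open>m = l + 1\<close>, in the form of its
  tangent line.
\<close>

lemma mean_inverse_sqrt_ge:
  assumes l: "0 < l"
  shows "1 / sqrt (l + 1) \<le> mean_inverse_sqrt l"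
proof -
  define m where "m = l + 1"
  have m: "0 < m" using l by (simp add: m_def)
  have tangent: "1 / sqrt m - (x - m) / (2 * m * sqrt m) \<le> 1 / sqrt x" if "0 < x" for x
  proof -
    define u v where "u = sqrt x" and "v = sqrt m"
    have uv: "0 < u" "0 < v" "x = u\<^sup>2" "m = v\<^sup>2" using that m by (simp_all add: u_def v_def)
    have "1 / u - (1 / v - (u\<^sup>2 - v\<^sup>2) / (2 * v\<^sup>2 * v)) = (u - v)\<^sup>2 * (u + 2 * v) / (2 * u * v ^ 3)"
      using uv by (simp add: field_simps power2_eq_square power3_eq_cube)
    moreover have "0 \<le> (u - v)\<^sup>2 * (u + 2 * v) / (2 * u * v ^ 3)" using uv by simp
    ultimately have "1 / v - (u\<^sup>2 - v\<^sup>2) / (2 * v\<^sup>2 * v) \<le> 1 / u" by linarith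
    then show ?thesis by (simp only: uv(3,4)[symmetric] u_def[symmetric] v_def[symmetric])
  qed
  have le: "poisson_weight l n * (1 / sqrt m + m / (2 * m * sqrt m)) - 1 / (2 * m * sqrt m) * (poisson_weight l n * (real n + 1))
      \<le> poisson_weight l n * (1 / sqrt (real n + 1))" for n
    using mult_left_mono[OF tangent[of "real n + 1"], of "poisson_weight l n"] l
    by (simp add: poisson_weight_nonneg algebra_simps diff_divide_distrib add_divide_distrib)
  have "(\<lambda>n. poisson_weight l n * (1 / sqrt m + m / (2 * m * sqrt m)) - 1 / (2 * m * sqrt m) * (poisson_weight l n * (real n + 1)))
      sums (1 * (1 / sqrt m + m / (2 * m * sqrt m)) - 1 / (2 * m * sqrt m) * (l + 1))"
    by (intro sums_diff sums_mult sums_mult2 poisson_weight_mean poisson_weight_sums)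
  from sums_le[OF le this mean_inverse_sqrt_sums[OF less_imp_le[OF l]]]
  have "1 * (1 / sqrt m + m / (2 * m * sqrt m)) - 1 / (2 * m * sqrt m) * (l + 1) \<le> mean_inverse_sqrt l" .
  then show ?thesis by (simp add: m_def)
qed

lemma mean_inverse_sqrt_asymptotics: "((\<lambda>l. sqrt l * mean_inverse_sqrt l) \<longlongrightarrow> 1) at_top"
proof (rule tendsto_sandwich)
  show "\<forall>\<^sub>F l in at_top. sqrt (1 - 1 / (l + 1)) \<le> sqrt l * mean_inverse_sqrt l"
    using eventually_gt_at_top[of 0]
  proof eventually_elim
    case (elim l)
    have "1 - 1 / (l + 1) = l / (l + 1)" using elim by (simp add: field_simps)
    then have "sqrt (1 - 1 / (l + 1)) = sqrt l * (1 / sqrt (l + 1))" by (simp add: real_sqrt_divide)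
    also have "\<dots> \<le> sqrt l * mean_inverse_sqrt l"
      using elim mean_inverse_sqrt_ge[of l] by (intro mult_left_mono) auto
    finally show ?case .
  qed
  show "\<forall>\<^sub>F l in at_top. sqrt l * mean_inverse_sqrt l \<le> 1"
    using eventually_gt_at_top[of 0]
  proof eventually_elim
    case (elim l)
    have "sqrt l * mean_inverse_sqrt l \<le> sqrt l * (1 / sqrt l)"
      using elim mean_inverse_sqrt_le[of l] by (intro mult_left_mono) auto
    then show ?case using elim by simp
  qed
  have "((\<lambda>l::real. 1 / (l + 1)) \<longlongrightarrow> 0) at_top"
    by (intro tendsto_divide_0[OF tendsto_const] filterlim_at_top_imp_at_infinity
        filterlim_at_top_mono[OF filterlim_ident] always_eventually allI) simp
  then have "((\<lambda>l::real. sqrt (1 - 1 / (l + 1))) \<longlongrightarrow> sqrt (1 - 0)) at_top"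
    by (intro tendsto_real_sqrt tendsto_diff tendsto_const)
  then show "((\<lambda>l::real. sqrt (1 - 1 / (l + 1))) \<longlongrightarrow> 1) at_top" by simp
qed simp

lemma poisson_weight_decay: "((\<lambda>l. sqrt l * poisson_weight l n) \<longlongrightarrow> 0) at_top"
proof (rule Lim_null_comparison)
  show "\<forall>\<^sub>F l in at_top. norm (sqrt l * poisson_weight l n) \<le> l ^ Suc n / exp l"
    using eventually_ge_at_top[of 1]
  proof eventually_elim
    case (elim l)
    have "sqrt l \<le> l" using elim real_le_rsqrt[of l l] by (intro real_le_lsqrt) (auto simp: power2_eq_square)
    moreover have "poisson_weight l n \<le> exp (- l) * l ^ n"
      unfolding poisson_weight_def using elim by (intro mult_left_mono) (auto simp: divide_le_eq mult_left_le fact_ge_1)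
    ultimately have "sqrt l * poisson_weight l n \<le> l * (exp (- l) * l ^ n)"
      using elim by (intro mult_mono poisson_weight_nonneg) auto
    then show ?case using elim by (simp add: poisson_weight_nonneg exp_minus field_simps)
  qed
  show "((\<lambda>l::real. l ^ Suc n / exp l) \<longlongrightarrow> 0) at_top" by (rule tendsto_power_div_exp_0)
qed

text \<open>
  An Abelian theorem: compare \<open>c n\<close> with $k/\sqrt{n+1}$. For large \<open>n\<close> the error is a small multiple of
  $1/\sqrt{n+1}$, whose average is known; finitely many small \<open>n\<close> have exponentially small weight.
\<close>

lemma poisson_average_asymptotics:
  assumes c: "(\<lambda>n. c n * sqrt (real n + 1)) \<longlonglongrightarrow> k"
  shows "((\<lambda>l. sqrt l * (\<Sum>n. poisson_weight l n * c n)) \<longlongrightarrow> k) at_top"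
proof (rule tendstoI)
  fix e :: real assume e: "0 < e"
  define d where "d = e / 3"
  have d: "0 < d" using e by (simp add: d_def)
  obtain B where B: "\<And>n. \<bar>c n * sqrt (real n + 1)\<bar> \<le> B"
    using convergent_imp_Bseq[OF convergentI[OF c]] unfolding Bseq_def by auto
  obtain n0 where n0: "\<And>n. n \<ge> n0 \<Longrightarrow> \<bar>c n * sqrt (real n + 1) - k\<bar> < d"
    using LIMSEQ_D[OF c d] by auto
  define r where "r n = 1 / sqrt (real n + 1)" for n
  have r: "0 < r n" "r n \<le> 1" for n by (simp_all add: r_def)
  have c_eq: "c n = (c n * sqrt (real n + 1)) * r n" for n by (simp add: r_def)
  have c_le: "\<bar>c n\<bar> \<le> B" for n
    using B[of n] r[of n] by (subst c_eq) (auto simp: abs_mult intro: order_trans[OF mult_left_le])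
  define K where "K = B + \<bar>k\<bar>"
  have K: "0 \<le> K" using order_trans[OF abs_ge_zero B[of 0]] by (simp add: K_def)
  have error: "\<bar>c n - k * r n\<bar> \<le> d * r n + (if n < n0 then K else 0)" for n
  proof -
    have "c n - k * r n = (c n * sqrt (real n + 1) - k) * r n"
      by (subst c_eq) (simp add: algebra_simps)
    then have eq: "\<bar>c n - k * r n\<bar> = \<bar>c n * sqrt (real n + 1) - k\<bar> * r n"
      using r(1)[of n] by (simp add: abs_mult)
    show ?thesis
    proof (cases "n < n0")
      case True
      have "\<bar>c n * sqrt (real n + 1) - k\<bar> * r n \<le> K * 1"
        using B[of n] r[of n] K unfolding K_def by (intro mult_mono) auto
      moreover have "0 \<le> d * r n" using d r(1)[of n] by simp
      ultimately show ?thesis using True eq by simp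
    next
      case False
      then show ?thesis using eq n0[of n] r(1)[of n] by (simp add: mult_right_mono)
    qed
  qed
  let ?tail = "\<lambda>l. \<Sum>n<n0. sqrt l * poisson_weight l n"
  have bound: "\<bar>sqrt l * (\<Sum>n. poisson_weight l n * c n) - k\<bar> \<le>
      d * (sqrt l * mean_inverse_sqrt l) + K * ?tail l + \<bar>k\<bar> * \<bar>sqrt l * mean_inverse_sqrt l - 1\<bar>" if l: "0 \<le> l" for l
  proof -
    let ?w = "poisson_weight l"
    have s1: "(\<lambda>n. ?w n * c n) sums (\<Sum>n. ?w n * c n)"
      using poisson_weight_summable[OF l c_le] by (rule summable_sums)
    have s2: "(\<lambda>n. ?w n * r n) sums mean_inverse_sqrt l"
      using mean_inverse_sqrt_sums[OF l] by (simp add: r_def)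
    have s3: "(\<lambda>n. if n < n0 then ?w n * K else 0) sums (\<Sum>n<n0. ?w n * K)"
      using sums_If_finite_set[of "{..<n0}" "\<lambda>n. ?w n * K"] by simp
    have diff: "(\<lambda>n. ?w n * c n - k * (?w n * r n)) sums ((\<Sum>n. ?w n * c n) - k * mean_inverse_sqrt l)"
      by (intro sums_diff sums_mult s1 s2)
    have maj: "(\<lambda>n. d * (?w n * r n) + (if n < n0 then ?w n * K else 0)) sums (d * mean_inverse_sqrt l + (\<Sum>n<n0. ?w n * K))"
      by (intro sums_add sums_mult s2 s3)
    have termwise: "\<bar>?w n * c n - k * (?w n * r n)\<bar> \<le> d * (?w n * r n) + (if n < n0 then ?w n * K else 0)" for n
    proof -
      have "?w n * c n - k * (?w n * r n) = ?w n * (c n - k * r n)" by (simp add: algebra_simps)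
      then have "\<bar>?w n * c n - k * (?w n * r n)\<bar> = ?w n * \<bar>c n - k * r n\<bar>"
        using poisson_weight_nonneg[OF l] by (simp add: abs_mult)
      also have "\<dots> \<le> ?w n * (d * r n + (if n < n0 then K else 0))"
        by (intro mult_left_mono error poisson_weight_nonneg l)
      finally show ?thesis by (simp add: algebra_simps split: if_splits)
    qed
    have "\<bar>(\<Sum>n. ?w n * c n) - k * mean_inverse_sqrt l\<bar> \<le> d * mean_inverse_sqrt l + (\<Sum>n<n0. ?w n * K)"
      unfolding abs_le_iff
      using sums_le[OF _ diff maj] sums_le[OF _ sums_minus[OF diff] maj] termwise
      by (auto simp: abs_le_iff)
    then have "sqrt l * \<bar>(\<Sum>n. ?w n * c n) - k * mean_inverse_sqrt l\<bar> \<le> sqrt l * (d * mean_inverse_sqrt l + (\<Sum>n<n0. ?w n * K))"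
      using l by (intro mult_left_mono) auto
    also have "\<dots> = d * (sqrt l * mean_inverse_sqrt l) + K * ?tail l"
      by (simp add: algebra_simps sum_distrib_left sum_distrib_right)
    finally have main: "\<bar>sqrt l * ((\<Sum>n. ?w n * c n) - k * mean_inverse_sqrt l)\<bar> \<le> d * (sqrt l * mean_inverse_sqrt l) + K * ?tail l"
      using l by (simp add: abs_mult)
    have "sqrt l * (\<Sum>n. ?w n * c n) - k =
        sqrt l * ((\<Sum>n. ?w n * c n) - k * mean_inverse_sqrt l) + k * (sqrt l * mean_inverse_sqrt l - 1)"
      by (simp add: algebra_simps)
    also have "\<bar>\<dots>\<bar> \<le> d * (sqrt l * mean_inverse_sqrt l) + K * ?tail l + \<bar>k\<bar> * \<bar>sqrt l * mean_inverse_sqrt l - 1\<bar>"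
      by (rule order_trans[OF abs_triangle_ineq add_mono[OF main]]) (simp add: abs_mult)
    finally show ?thesis .
  qed
  have "((\<lambda>l. d * (sqrt l * mean_inverse_sqrt l) + K * ?tail l + \<bar>k\<bar> * \<bar>sqrt l * mean_inverse_sqrt l - 1\<bar>) \<longlongrightarrow>
      d * 1 + K * (\<Sum>n<n0. 0) + \<bar>k\<bar> * \<bar>1 - 1\<bar>) at_top"
    by (intro tendsto_intros mean_inverse_sqrt_asymptotics poisson_weight_decay)
  then have "\<forall>\<^sub>F l in at_top. d * (sqrt l * mean_inverse_sqrt l) + K * ?tail l + \<bar>k\<bar> * \<bar>sqrt l * mean_inverse_sqrt l - 1\<bar> < e"
    using d by (intro order_tendstoD(2)[where y = "d * 1 + K * (\<Sum>n<n0. 0) + \<bar>k\<bar> * \<bar>1 - 1\<bar>"]) (auto simp: d_def)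
  then show "\<forall>\<^sub>F l in at_top. dist (sqrt l * (\<Sum>n. poisson_weight l n * c n)) k < e"
    using eventually_ge_at_top[of 0]
  proof eventually_elim
    case (elim l)
    then show ?case unfolding dist_real_def using order_le_less_trans[OF bound] by blast
  qed
qed

lemma (in poisson_family) ascent_prob_asymptotics: "((\<lambda>t. sqrt t * ascent_prob t) \<longlongrightarrow> 1 / sqrt pi) at_top"
proof -
  have "ascent_prob t = (\<Sum>n. poisson_weight (2 * t) n * middle_prob n)" if "0 \<le> t" for t
  proof -
    have "(\<lambda>n. exp (- (2 * t)) * (real (n choose (n div 2)) * t ^ n / fact n)) sums
        (exp (- (2 * t)) * (exp (2 * t) * ascent_prob t))"
      by (intro sums_mult ascent_prob_sums that)
    moreover have "exp (- (2 * t)) * (exp (2 * t) * ascent_prob t) = ascent_prob t"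
      by (simp flip: mult.assoc exp_add)
    moreover have "exp (- (2 * t)) * (real (n choose (n div 2)) * t ^ n / fact n) = poisson_weight (2 * t) n * middle_prob n" for n
      by (simp add: poisson_weight_def middle_prob_def power_mult_distrib)
    ultimately show ?thesis by (simp add: sums_unique)
  qed
  then have eq: "sqrt t * ascent_prob t = sqrt (2 * t) * (\<Sum>n. poisson_weight (2 * t) n * middle_prob n) / sqrt 2" if "0 \<le> t" for t
    using that by (simp add: real_sqrt_mult)
  have "((\<lambda>l. sqrt l * (\<Sum>n. poisson_weight l n * middle_prob n)) \<longlongrightarrow> sqrt (2 / pi)) at_top"
    by (rule poisson_average_asymptotics[OF middle_prob_asymptotics])
  then have "((\<lambda>t. sqrt (2 * t) * (\<Sum>n. poisson_weight (2 * t) n * middle_prob n)) \<longlongrightarrow> sqrt (2 / pi)) at_top"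
    by (rule filterlim_compose)
      (intro filterlim_tendsto_pos_mult_at_top[OF tendsto_const] filterlim_ident, simp)
  then have "((\<lambda>t. sqrt (2 * t) * (\<Sum>n. poisson_weight (2 * t) n * middle_prob n) / sqrt 2) \<longlongrightarrow> sqrt (2 / pi) / sqrt 2) at_top"
    by (intro tendsto_divide tendsto_const) auto
  moreover have "sqrt (2 / pi) / sqrt 2 = 1 / sqrt pi" by (simp add: real_sqrt_divide)
  ultimately have "((\<lambda>t. sqrt (2 * t) * (\<Sum>n. poisson_weight (2 * t) n * middle_prob n) / sqrt 2) \<longlongrightarrow> 1 / sqrt pi) at_top"
    by simp
  then show ?thesis
    by (rule Lim_transform_eventually) (use eventually_ge_at_top[of 0] in \<open>eventually_elim, simp add: eq\<close>)
qed

section \<open>Jumps of the label at position 1\<close>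

context poisson_family
begin

lemma lmax_1_eq_label: "lmax t 1 \<omega> = osp_label (rings N \<omega>) t 1"
  by (simp add: lmax_def label_max_def)

lemma jump_event:
  assumes "0 \<le> s" "0 \<le> t"
  shows "{\<omega> \<in> space M. lmax s 1 \<omega> < lmax t 1 \<omega>} \<in> events"
proof -
  have "(\<lambda>\<omega>. (lmax s 1 \<omega>, lmax t 1 \<omega>)) \<in> measurable M (count_space UNIV)"
    using assms by (intro measurable_Pair_count_space lmax_measurable) auto
  from measurable_sets[OF this, of "{(x, y). x < y}"] show ?thesis
    by (simp add: vimage_def Int_def conj_commute)
qed

lemma ascent_prob_le_1: "0 \<le> t \<Longrightarrow> \<bar>ascent_prob t\<bar> \<le> 1"
  unfolding ascent_prob_def by (rule mean_abs_le) auto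

text \<open>
  Unless the period is crowded, the label at position 1 changes exactly if \<open>(1, 2)\<close> rings and the
  labels at positions 1 and 2 are in increasing order; these two events are independent.
\<close>

lemma prob_jump:
  assumes t: "0 \<le> t" "0 < h"
  shows "\<bar>prob {\<omega> \<in> space M. lmax t 1 \<omega> < lmax (t + h) 1 \<omega>} - (1 - exp (- h)) * ascent_prob t\<bar> \<le> 2 * h\<^sup>2"
proof -
  let ?f = "\<lambda>\<omega>. of_bool (lmax t 1 \<omega> < lmax (t + h) 1 \<omega>) :: real"
  let ?g = "\<lambda>\<omega>. of_bool (lmax t 1 \<omega> < lmax t 2 \<omega>) * of_bool (incr 1 t (t + h) \<omega> \<noteq> 0) :: real"
  have f: "integrable M ?f"
    by (rule lmax_pair_integrable[where F = "\<lambda>x y. of_bool (x < y)" and C = 1]) (use t in auto)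
  have g: "integrable M ?g"
  proof (rule bounded_integrable[of _ 1])
    show "?g \<in> borel_measurable M"
      using lmax_pair_measurable[of t t 1 2 "\<lambda>x y. of_bool (x < y)"]
        incr_pair_measurable[of t "t + h" 1 1 "\<lambda>z w. of_bool (z \<noteq> 0)"] t
      by (intro borel_measurable_times) auto
  qed auto
  have Eg: "expectation ?g = ascent_prob t * (1 - exp (- h))"
  proof -
    have "expectation ?g = expectation (\<lambda>\<omega>. of_bool (lmax t 1 \<omega> < lmax t 2 \<omega>)) *
        expectation (\<lambda>\<omega>. of_bool (incr 1 t (t + h) \<omega> \<noteq> 0))"
      by (rule expectation_past_times_increments[where F = "\<lambda>x y. of_bool (x < y)" and
          G = "\<lambda>z w. of_bool (z \<noteq> 0)" and C = 1 and D = 1 and j = 1]) (use t in auto)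
    moreover have "{\<omega> \<in> space M. incr 1 t (t + h) \<omega> \<noteq> 0} \<in> events"
    proof -
      have [measurable]: "incr 1 t (t + h) \<in> measurable M (count_space UNIV)" using t by auto
      show ?thesis by measurable
    qed
    ultimately show ?thesis
      using prob_incr_pos[of 1 t "t + h"] t by (simp only: expectation_of_bool ascent_prob_def mean_def) simp
  qed
  have "AE \<omega> in M. \<bar>?f \<omega> - ?g \<omega>\<bar> \<le> 1 * of_bool (crowded 1 t (t + h) \<omega>)"
  proof -
    have "AE \<omega> in M. \<not> crowded 1 t (t + h) \<omega> \<longrightarrow> lmax (t + h) 1 \<omega> = lmax t (if incr 1 t (t + h) \<omega> = 0 then 1 else Suc 1) \<omega>"
      by (rule AE_lmax_step) (use t in simp_all)
    then show ?thesis
    proof eventually_elim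
      case (elim \<omega>)
      then show ?case
        by (cases "crowded 1 t (t + h) \<omega>"; cases "incr 1 t (t + h) \<omega> = 0") (simp_all add: numeral_2_eq_2)
    qed
  qed
  from abs_diff_expectation_le[OF f g crowded_event this]
  have "\<bar>expectation ?f - expectation ?g\<bar> \<le> prob {\<omega> \<in> space M. crowded 1 t (t + h) \<omega>}" using t by simp
  also have "\<dots> \<le> 2 * h\<^sup>2" using prob_crowded[of 1 t "t + h"] t by simp
  finally show ?thesis
    unfolding Eg using t by (simp only: expectation_of_bool jump_event) (simp add: mult.commute)
qed

lemma ascent_prob_pos:
  assumes "0 \<le> t"
  shows "0 < ascent_prob t"
proof -
  have s: "(\<lambda>n. real (n choose (n div 2)) * t ^ n / fact n) sums (exp (2 * t) * ascent_prob t)"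
    by (rule ascent_prob_sums[OF assms])
  have "(\<Sum>n<1. real (n choose (n div 2)) * t ^ n / fact n) \<le> (\<Sum>n. real (n choose (n div 2)) * t ^ n / fact n)"
    using s assms by (intro sum_le_suminf) (auto simp: sums_iff)
  then have "1 \<le> exp (2 * t) * ascent_prob t" using s by (simp add: sums_iff)
  then have "0 < exp (2 * t) * ascent_prob t" by linarith
  then show ?thesis by (simp add: zero_less_mult_iff)
qed

text \<open>
  The increment vanishes off the conditioning event, so the numerator is the full mean increment
  \<open>(1 + t + h) - (1 + t)\<close>.
\<close>

lemma osp_increment_height_eq:
  assumes t: "0 \<le> t" "0 < h"
  shows "osp_increment_height M N t h = h / prob {\<omega> \<in> space M. lmax t 1 \<omega> < lmax (t + h) 1 \<omega>}"
proof -
  let ?B = "{\<omega> \<in> space M. lmax t 1 \<omega> < lmax (t + h) 1 \<omega>}"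
  let ?X = "\<lambda>\<omega>. real (lmax (t + h) 1 \<omega>) - real (lmax t 1 \<omega>)"
  have int: "integrable M (\<lambda>\<omega>. real (lmax (t + h) 1 \<omega>))" "integrable M (\<lambda>\<omega>. real (lmax t 1 \<omega>))"
    by (rule integrable_lmax_1; use t in simp)+
  have "(LINT \<omega>:?B|M. ?X \<omega>) = expectation ?X"
    unfolding set_lebesgue_integral_def
  proof (rule integral_cong_AE)
    show "?X \<in> borel_measurable M" using int by auto
    then show "(\<lambda>\<omega>. indicat_real ?B \<omega> *\<^sub>R ?X \<omega>) \<in> borel_measurable M"
      using jump_event[of t "t + h"] t by (intro borel_measurable_scaleR borel_measurable_indicator) auto
    show "AE \<omega> in M. indicat_real ?B \<omega> *\<^sub>R ?X \<omega> = ?X \<omega>"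
      using AE_lmax_mono[of 1 t "t + h"] t by (auto elim!: eventually_mono simp: indicator_def)
  qed
  also have "\<dots> = (1 + (t + h)) - (1 + t)"
    using int t by (simp only: Bochner_Integration.integral_diff expectation_lmax_1)
  finally show ?thesis
    unfolding osp_increment_height_def event_expectation_def lmax_1_eq_label[symmetric] by simp
qed

lemma osp_increment_height_tendsto:
  assumes t: "0 \<le> t"
  shows "(osp_increment_height M N t \<longlongrightarrow> 1 / ascent_prob t) (at_right 0)"
proof -
  let ?P = "\<lambda>h. prob {\<omega> \<in> space M. lmax t 1 \<omega> < lmax (t + h) 1 \<omega>}"
  have bound: "\<bar>?P h / h - ascent_prob t\<bar> \<le> 3 * h" if h: "0 < h" for h
  proof -
    define q where "q = 1 - exp (- h)"
    have q: "h - h\<^sup>2 \<le> q" "q \<le> h" using exp_minus_bounds[OF h] by (simp_all add: q_def)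
    have "\<bar>(q - h) * ascent_prob t\<bar> \<le> h\<^sup>2 * 1"
      unfolding abs_mult using q ascent_prob_le_1[OF t] by (intro mult_mono) auto
    moreover have "\<bar>?P h - q * ascent_prob t\<bar> \<le> 2 * h\<^sup>2"
      using prob_jump[OF t h] by (simp only: q_def)
    moreover have "?P h - h * ascent_prob t = (?P h - q * ascent_prob t) + (q - h) * ascent_prob t"
      by (simp add: algebra_simps)
    ultimately have "\<bar>?P h - h * ascent_prob t\<bar> \<le> 3 * h\<^sup>2"
      using abs_triangle_ineq[of "?P h - q * ascent_prob t" "(q - h) * ascent_prob t"] by simp
    then have "\<bar>?P h - h * ascent_prob t\<bar> / h \<le> 3 * h\<^sup>2 / h"
      using h by (intro divide_right_mono) auto
    moreover have "\<bar>?P h / h - ascent_prob t\<bar> = \<bar>?P h - h * ascent_prob t\<bar> / h"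
    proof -
      have "?P h / h - ascent_prob t = (?P h - h * ascent_prob t) / h" using h by (simp add: diff_divide_distrib)
      then show ?thesis using h by simp
    qed
    ultimately show ?thesis using h by (simp add: power2_eq_square)
  qed
  have "((\<lambda>h. ?P h / h - ascent_prob t) \<longlongrightarrow> 0) (at_right 0)"
  proof (rule Lim_null_comparison)
    show "\<forall>\<^sub>F h in at_right 0. norm (?P h / h - ascent_prob t) \<le> 3 * h"
      using bound by (simp add: eventually_at_filter)
    have "((\<lambda>h::real. 3 * h) \<longlongrightarrow> 3 * 0) (at_right 0)" by (intro tendsto_intros)
    then show "((\<lambda>h::real. 3 * h) \<longlongrightarrow> 0) (at_right 0)" by simp
  qed
  then have "((\<lambda>h. ?P h / h) \<longlongrightarrow> ascent_prob t) (at_right 0)" by (rule LIM_zero_cancel)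
  then have "((\<lambda>h. 1 / (?P h / h)) \<longlongrightarrow> 1 / ascent_prob t) (at_right 0)"
    using ascent_prob_pos[OF t] by (intro tendsto_divide tendsto_const) auto
  then show ?thesis
    by (rule Lim_transform_eventually) (use t in \<open>simp add: eventually_at_filter osp_increment_height_eq\<close>)
qed

lemma osp_jump_height_eq: "0 \<le> t \<Longrightarrow> osp_jump_height M N t = 1 / ascent_prob t"
  unfolding osp_jump_height_def by (rule tendsto_Lim[OF _ osp_increment_height_tendsto]) simp_all

lemma osp_jump_height_asymptotics: "((\<lambda>t. osp_jump_height M N t / sqrt t) \<longlongrightarrow> sqrt pi) at_top"
proof -
  have "((\<lambda>t. 1 / (sqrt t * ascent_prob t)) \<longlongrightarrow> 1 / (1 / sqrt pi)) at_top"
    by (intro tendsto_divide tendsto_const ascent_prob_asymptotics) simp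
  then have "((\<lambda>t. 1 / (sqrt t * ascent_prob t)) \<longlongrightarrow> sqrt pi) at_top" by simp
  then show ?thesis
    by (rule Lim_transform_eventually)
      (use eventually_ge_at_top[of 0] in \<open>eventually_elim, simp add: osp_jump_height_eq mult.commute\<close>)
qed

text \<open>This integral turns out to be $E J_t$, see \<open>expectation_osp_swaps\<close>.\<close>

definition mean_swaps :: "real \<Rightarrow> real" where
  "mean_swaps t = integral {0..t} ascent_prob"

lemma ascent_prob_Lipschitz: "0 \<le> s \<Longrightarrow> s \<le> t \<Longrightarrow> \<bar>ascent_prob t - ascent_prob s\<bar> \<le> 20 * (t - s)"
  using mean_Lipschitz[where F = "\<lambda>x y. of_bool (x < y)" and C = 1 and a = 1 and b = 2 and t = s and h = "t - s"]
  by (cases "s = t") (auto simp: ascent_prob_def)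

lemma ascent_prob_continuous: "continuous_on {0..t} ascent_prob"
proof (rule DERIV_continuous_on)
  show "(ascent_prob has_real_derivative mean (\<lambda>x y. of_bool (x < y)) s (Suc 1) 2 +
      mean (\<lambda>x y. of_bool (x < y)) s 1 (Suc 2) - 2 * mean (\<lambda>x y. of_bool (x < y)) s 1 2) (at s within {0..t})"
    if "s \<in> {0..t}" for s
    unfolding ascent_prob_def[abs_def]
    by (rule has_field_derivative_subset[OF mean_has_derivative[where C = 1]]) (use that in auto)
qed

lemma mean_swaps_derivative:
  assumes "0 \<le> s" "s \<le> t"
  shows "(mean_swaps has_real_derivative ascent_prob s) (at s within {0..t})"
  unfolding mean_swaps_def[abs_def]
  using assms by (intro integral_has_real_derivative ascent_prob_continuous) auto

lemma mean_swaps_increment: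
  assumes "0 \<le> s" "0 < h"
  shows "\<bar>mean_swaps (s + h) - mean_swaps s - h * ascent_prob s\<bar> \<le> 20 * h\<^sup>2"
proof -
  have "\<exists>x\<in>{s<..<s + h}. mean_swaps (s + h) - mean_swaps s = (*) (ascent_prob x) (s + h - s)"
  proof (rule mvt_simple)
    fix x assume x: "s \<le> x" "x \<le> s + h"
    have "(mean_swaps has_real_derivative ascent_prob x) (at x within {s..s + h})"
      by (rule has_field_derivative_subset[OF mean_swaps_derivative[of x "s + h"]]) (use x assms in auto)
    then show "(mean_swaps has_derivative (*) (ascent_prob x)) (at x within {s..s + h})"
      by (rule has_field_derivative_imp_has_derivative)
  qed (use assms in simp)
  then obtain x where x: "s < x" "x < s + h" "mean_swaps (s + h) - mean_swaps s = ascent_prob x * h" by auto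
  then have "\<bar>mean_swaps (s + h) - mean_swaps s - h * ascent_prob s\<bar> = h * \<bar>ascent_prob x - ascent_prob s\<bar>"
    using assms by (simp add: abs_mult flip: right_diff_distrib mult.commute)
  also have "\<dots> \<le> h * (20 * h)"
    using ascent_prob_Lipschitz[of s x] x assms by (intro mult_left_mono) auto
  finally show ?thesis by (simp add: power2_eq_square)
qed

definition grid_jumps :: "real \<Rightarrow> nat \<Rightarrow> 'a \<Rightarrow> real" where
  "grid_jumps t n \<omega> = (\<Sum>k<n. of_bool (lmax (grid t n k) 1 \<omega> < lmax (grid t n (Suc k)) 1 \<omega>))"

lemma grid_jumps_eq_card:
  "grid_jumps t n \<omega> = real (card {k. k < n \<and> label_max (rings N \<omega>) (grid t n k) 1 < label_max (rings N \<omega>) (grid t n (Suc k)) 1})"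
proof -
  have "grid_jumps t n \<omega> = (\<Sum>k\<in>{k \<in> {..<n}. lmax (grid t n k) 1 \<omega> < lmax (grid t n (Suc k)) 1 \<omega>}. 1)"
    by (simp only: sum.inter_filter[OF finite_lessThan] grid_jumps_def of_bool_def)
  then show ?thesis by (simp add: lmax_def)
qed

lemma grid_jumps_measurable: "0 \<le> t \<Longrightarrow> grid_jumps t n \<in> borel_measurable M"
  unfolding grid_jumps_def[abs_def]
  by (intro borel_measurable_sum lmax_pair_measurable) (simp_all add: grid_nonneg)

lemma AE_grid_jumps:
  assumes "0 \<le> t"
  shows "AE \<omega> in M. \<forall>\<^sub>F n in sequentially. grid_jumps t n \<omega> = real (osp_swaps (rings N \<omega>) t)"
  using AE_harris
proof eventually_elim
  case (elim \<omega>)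
  from harris.eventually_card_jumps_eq_osp_swaps[OF elim assms]
  show ?case by eventually_elim (simp only: grid_jumps_eq_card)
qed

text \<open>
  Over one slot of length \<open>h\<close> both the jump probability and the increment of the integral are
  \<open>h p + O(h\<^sup>2)\<close>. Adding up \<open>n\<close> slots of length \<open>t / n\<close> leaves an error of order \<open>t\<^sup>2 / n\<close>.
\<close>

lemma expectation_osp_swaps:
  assumes t: "0 \<le> t"
  shows "expectation (\<lambda>\<omega>. real (osp_swaps (rings N \<omega>) t)) = mean_swaps t"
proof -
  let ?J = "\<lambda>\<omega>. real (osp_swaps (rings N \<omega>) t)"
  have J: "?J \<in> borel_measurable M"
    by (rule measurable_AE_eventually_eq[OF grid_jumps_measurable[OF t] _ AE_grid_jumps[OF t]]) simp
  have lim: "(\<lambda>n. expectation (grid_jumps t (Suc n))) \<longlonglongrightarrow> expectation ?J"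
  proof (rule integral_dominated_convergence)
    show "integrable M (\<lambda>\<omega>. real (lmax t 1 \<omega>))" by (rule integrable_lmax_1[OF t])
    show "AE \<omega> in M. (\<lambda>n. grid_jumps t (Suc n) \<omega>) \<longlonglongrightarrow> ?J \<omega>"
      using AE_grid_jumps[OF t]
    proof eventually_elim
      case (elim \<omega>)
      then have "(\<lambda>n. grid_jumps t n \<omega>) \<longlonglongrightarrow> ?J \<omega>" by (rule tendsto_eventually)
      then show ?case by (rule LIMSEQ_Suc)
    qed
    show "AE \<omega> in M. norm (grid_jumps t (Suc n) \<omega>) \<le> real (lmax t 1 \<omega>)" for n
      using AE_harris
    proof eventually_elim
      case (elim \<omega>)
      from harris.card_jumps_le[OF elim t order_refl[of "Suc n"]]
      show ?case unfolding grid_jumps_eq_card lmax_def by (simp add: grid_end)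
    qed
  qed (use J grid_jumps_measurable[OF t] in simp_all)
  have close: "\<bar>expectation (grid_jumps t (Suc n)) - mean_swaps t\<bar> \<le> 23 * t\<^sup>2 / Suc n" for n
  proof (cases "t = 0")
    case True
    then show ?thesis by (simp add: grid_jumps_def[abs_def] grid_def mean_swaps_def)
  next
    case False
    let ?g = "grid t (Suc n)"
    define h where "h = t / Suc n"
    have h: "0 < h" using t False by (simp add: h_def)
    let ?P = "\<lambda>k. prob {\<omega> \<in> space M. lmax (?g k) 1 \<omega> < lmax (?g (Suc k)) 1 \<omega>}"
    have step: "\<bar>?P k - (mean_swaps (?g (Suc k)) - mean_swaps (?g k))\<bar> \<le> 23 * h\<^sup>2" for k
    proof -
      have g: "?g (Suc k) = ?g k + h" "0 \<le> ?g k" using t by (simp_all add: grid_Suc h_def grid_nonneg)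
      define q where "q = 1 - exp (- h)"
      have q: "h - h\<^sup>2 \<le> q" "q \<le> h" using exp_minus_bounds[OF h] by (simp_all add: q_def)
      have "\<bar>(q - h) * ascent_prob (?g k)\<bar> \<le> h\<^sup>2 * 1"
        unfolding abs_mult using q ascent_prob_le_1[OF g(2)] by (intro mult_mono) auto
      moreover have "\<bar>?P k - q * ascent_prob (?g k)\<bar> \<le> 2 * h\<^sup>2"
        using prob_jump[OF g(2) h] unfolding g(1) q_def .
      moreover have "\<bar>mean_swaps (?g (Suc k)) - mean_swaps (?g k) - h * ascent_prob (?g k)\<bar> \<le> 20 * h\<^sup>2"
        using mean_swaps_increment[OF g(2) h] unfolding g(1) .
      ultimately show ?thesis by (simp add: abs_le_iff left_diff_distrib)
    qed
    have "expectation (grid_jumps t (Suc n)) = (\<Sum>k<Suc n. ?P k)"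
    proof -
      have "expectation (grid_jumps t (Suc n)) =
          (\<Sum>k<Suc n. expectation (\<lambda>\<omega>. of_bool (lmax (?g k) 1 \<omega> < lmax (?g (Suc k)) 1 \<omega>)))"
        unfolding grid_jumps_def[abs_def]
        by (intro Bochner_Integration.integral_sum lmax_pair_integrable[where F = "\<lambda>x y. of_bool (x < y)" and C = 1])
          (auto simp: grid_nonneg t)
      also have "\<dots> = (\<Sum>k<Suc n. ?P k)"
        by (intro sum.cong refl expectation_of_bool jump_event grid_nonneg t)
      finally show ?thesis .
    qed
    moreover have "mean_swaps t = (\<Sum>k<Suc n. mean_swaps (?g (Suc k)) - mean_swaps (?g k))"
    proof -
      have "mean_swaps 0 = 0" by (simp add: mean_swaps_def)
      moreover have "?g (Suc n) = t" by (rule grid_end) simp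
      ultimately show ?thesis
        using sum_lessThan_telescope[of "\<lambda>k. mean_swaps (?g k)" "Suc n"] by (simp only: grid_0 diff_zero)
    qed
    ultimately have "expectation (grid_jumps t (Suc n)) - mean_swaps t =
        (\<Sum>k<Suc n. ?P k - (mean_swaps (?g (Suc k)) - mean_swaps (?g k)))"
      by (simp only: sum_subtractf)
    also have "\<bar>\<dots>\<bar> \<le> (\<Sum>k<Suc n. 23 * h\<^sup>2)"
      by (rule order_trans[OF sum_abs sum_mono[OF step]])
    also have "\<dots> = 23 * t\<^sup>2 / Suc n"
    proof -
      have "x * (23 * (t / x)\<^sup>2) = 23 * t\<^sup>2 / x" if "x \<noteq> 0" for x
        using that by (simp add: power2_eq_square)
      from this[of "real (Suc n)"] show ?thesis unfolding h_def sum_constant card_lessThan by simp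
    qed
    finally show ?thesis .
  qed
  have "(\<lambda>n. 23 * t\<^sup>2 / real (Suc n)) \<longlonglongrightarrow> 0"
    by (rule LIMSEQ_Suc[OF lim_const_over_n])
  then have "(\<lambda>n. expectation (grid_jumps t (Suc n)) - mean_swaps t) \<longlonglongrightarrow> 0"
    by (rule Lim_null_comparison[rotated]) (intro always_eventually allI, simp only: real_norm_def close)
  then have "(\<lambda>n. expectation (grid_jumps t (Suc n))) \<longlonglongrightarrow> mean_swaps t" by (rule LIM_zero_cancel)
  with lim show ?thesis by (rule LIMSEQ_unique)
qed

lemma mean_swaps_asymptotics: "((\<lambda>t. mean_swaps t / sqrt t) \<longlongrightarrow> 2 / sqrt pi) at_top"
proof (rule lhospital_at_top_at_top)
  show "LIM t at_top. sqrt t :> at_top" by (rule sqrt_at_top)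
  show "\<forall>\<^sub>F t in at_top. inverse (sqrt t) / 2 \<noteq> 0"
    using eventually_gt_at_top[of 0] by eventually_elim simp
  show "\<forall>\<^sub>F t in at_top. (mean_swaps has_real_derivative ascent_prob t) (at t)"
    using eventually_gt_at_top[of 0]
  proof eventually_elim
    case (elim t)
    then have "(mean_swaps has_real_derivative ascent_prob t) (at t within {0..t + 1})"
      by (intro mean_swaps_derivative) auto
    moreover have "at t within {0..t + 1} = at t" using elim by (intro at_within_Icc_at) auto
    ultimately show ?case by simp
  qed
  show "\<forall>\<^sub>F t in at_top. (sqrt has_real_derivative inverse (sqrt t) / 2) (at t)"
    using eventually_gt_at_top[of 0] by eventually_elim (rule DERIV_real_sqrt)
  have "((\<lambda>t. 2 * (sqrt t * ascent_prob t)) \<longlongrightarrow> 2 * (1 / sqrt pi)) at_top"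
    by (intro tendsto_mult tendsto_const ascent_prob_asymptotics)
  then show "((\<lambda>t. ascent_prob t / (inverse (sqrt t) / 2)) \<longlongrightarrow> 2 / sqrt pi) at_top"
    by (simp add: field_simps)
qed

end

lemma poisson_family_completion:
  assumes "prob_space M"
    and "\<And>i. 1 \<le> i \<Longrightarrow> poisson_process M 1 (N i)"
    and "prob_space.indep_vars M (\<lambda>_. Pi\<^sub>M {0..} (\<lambda>_. count_space UNIV))
           (\<lambda>i \<omega>. \<lambda>t\<in>{0..}. N i t \<omega>) {1..}"
  shows "poisson_family (completion M) N"
proof -
  interpret prob_space "completion M" by (rule prob_space_completion[OF assms(1)])
  interpret complete_measure "completion M" by (rule completion.complete_measure_axioms)
  show ?thesis
    by unfold_locales (intro poisson_process_completion indep_vars_completion assms; assumption)+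
qed

theorem theorem1p4:
  fixes M :: "'a measure" and N :: "nat \<Rightarrow> real \<Rightarrow> 'a \<Rightarrow> nat"
  assumes "prob_space M"
    and "\<And>i. 1 \<le> i \<Longrightarrow> poisson_process M 1 (N i)"
    and "prob_space.indep_vars M (\<lambda>_. Pi\<^sub>M {0..} (\<lambda>_. count_space UNIV))
           (\<lambda>i \<omega>. \<lambda>t\<in>{0..}. N i t \<omega>) {1..}"
  shows "((\<lambda>t. \<integral>\<omega>. real (osp_swaps (rings N \<omega>) t) / sqrt t \<partial>(completion M))
            \<longlongrightarrow> 2 / sqrt pi) at_top
       \<and> (\<forall>t\<ge>0. (osp_increment_height (completion M) N t
            \<longlongrightarrow> osp_jump_height (completion M) N t) (at_right 0))
       \<and> ((\<lambda>t. osp_jump_height (completion M) N t / sqrt t) \<longlongrightarrow> sqrt pi) at_top"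
proof -
  interpret poisson_family "completion M" N by (rule poisson_family_completion[OF assms])
  have "((\<lambda>t. \<integral>\<omega>. real (osp_swaps (rings N \<omega>) t) / sqrt t \<partial>(completion M)) \<longlongrightarrow> 2 / sqrt pi) at_top"
    using mean_swaps_asymptotics
    by (rule Lim_transform_eventually)
      (use eventually_ge_at_top[of 0] in \<open>eventually_elim, simp add: expectation_osp_swaps\<close>)
  moreover have "(osp_increment_height (completion M) N t \<longlongrightarrow> osp_jump_height (completion M) N t) (at_right 0)"
    if "0 \<le> t" for t
    using osp_increment_height_tendsto[OF that] osp_jump_height_eq[OF that] by simp
  ultimately show ?thesis using osp_jump_height_asymptotics by blast
qed

end
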